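(* For $\vec{x}=(a,b,c,d,e,f,g)^T\in V$, $$A(1-a,1-b,1-c,1-d)\,A(1+a-e,1+b-e,1+c-e,1+d-e)\,B_2(\vec{x})\,K_{p_0}(\vec{x})$$ $$+\,S(e)\,A(f-a,f-b,f-c,f-d)\,A(g-a,g-b,g-c,g-d)\,\bigl(A(a,1+a-e,1+a-f,1+a-g)\bigr)^2\,K_{n_0}(\vec{x})-C(\vec{x})\,K_{p_4}(\vec{x})=0.$$
   Context: $V=\{(a,b,c,d,e,f,g)^T\in\mathbb{C}^7: e+f+g-a-b-c-d=1\}$. ${}_4F_3\left[\begin{smallmatrix}a,b,c,d\\ e,f,g\end{smallmatrix};1\right]=\sum_{n\ge0}\frac{(a)_n(b)_n(c)_n(d)_n}{n!(e)_n(f)_n(g)_n}$, with $(a)_n$ the rising factorial. For $(a,b,c,d,e,f,g)^T\in V$, $$K(a;b,c,d;e,f,g)=\frac{{}_4F_3\left[\begin{smallmatrix}a,b,c,d\\ e,f,g\end{smallmatrix};1\right]}{\sin\pi a\,\Gamma(a)\Gamma(1+a-e)\Gamma(1+a-f)\Gamma(1+a-g)\Gamma(e)\Gamma(f)\Gamma(g)}+\frac{{}_4F_3\left[\begin{smallmatrix}a,1+a-e,1+a-f,1+a-g\\ 1+a-b,1+a-c,1+a-d\end{smallmatrix};1\right]}{\sin\pi a\,\Gamma(a)\Gamma(b)\Gamma(c)\Gamma(d)\Gamma(1+a-b)\Gamma(1+a-c)\Gamma(1+a-d)}.$$ Notation: $S(a_1,\dots,a_n)=\sin\pi a_1\cdots\sin\pi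 a_n$; $A(x,y,z,w)=\frac{1}{\Gamma(x)\Gamma(y)\Gamma(z)\Gamma(w)}$ (with $1/\Gamma=0$ at nonpositive integers). The relation is asserted for those $\vec{x}\in V$ at which the $K$ functions occurring are defined (no lower parameter of an occurring series is a nonpositive integer, no sine in an occurring denominator vanishes). Here $K_{p_0}(\vec{x})=K(a;b,c,d;e,f,g)$, $K_{n_0}(\vec{x})=K(1-a;1-b,1-c,1-d;2-e,2-f,2-g)$, $K_{p_4}(\vec{x})=K(1+a-e;1+b-e,1+c-e,1+d-e;1+f-e,1+g-e,2-e)$, and $B_2(\vec{x})=\pi^{-4}S(f-a,g-a)\,[S(b-a,c-a,d-a)+S(e-2a,f-a,g-a)]$, $B_4(\vec{x})=\pi^{-4}S(f-a,g-a)\,[S(b,c,d)+S(e-a,f,g)]$, $C(\vec{x})=\pi^{-4}S(e-a)\,[S(b,c,d)B_2(\vec{x})+S(e,f-a,g-a)B_4(\vec{x})]$. *)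

theory Defs
  imports "HOL-Analysis.Analysis"
begin

type_synonym vec7 = "complex \<times> complex \<times> complex \<times> complex \<times> complex \<times> complex \<times> complex"

definition V :: "vec7 set" where
  "V = {(a, b, c, d, e, f, g). e + f + g - a - b - c - d = 1}"

text \<open>The series \<open>4F3(a,b,c,d; e,f,g; 1)\<close>. All series used below have lower parameters
  minus upper parameters summing to \<open>1\<close> (see \<^term>\<open>V\<close>), so they converge absolutely whenever no
  lower parameter is a nonpositive integer.\<close>

definition hyp4F3_at_1 ::
  "complex \<Rightarrow> complex \<Rightarrow> complex \<Rightarrow> complex \<Rightarrow> complex \<Rightarrow> complex \<Rightarrow> complex \<Rightarrow> complex" where
  "hyp4F3_at_1 a b c d e f g =
     (\<Sum>n. (pochhammer a n * pochhammer b n * pochhammer c n * pochhammer d n) /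
          (fact n * pochhammer e n * pochhammer f n * pochhammer g n))"

definition sin_prod :: "complex list \<Rightarrow> complex" where
  "sin_prod xs = (\<Prod>x\<leftarrow>xs. sin (of_real pi * x))"

text \<open>Reciprocal Gamma factors are written with the entire function \<^const>\<open>rGamma\<close>, which is
  \<open>1 / \<Gamma>\<close> extended by \<open>0\<close> at the nonpositive integers.\<close>

definition A4 :: "complex \<Rightarrow> complex \<Rightarrow> complex \<Rightarrow> complex \<Rightarrow> complex" where
  "A4 x y z w = rGamma x * rGamma y * rGamma z * rGamma w"

fun K_fun :: "vec7 \<Rightarrow> complex" where
  "K_fun (a, b, c, d, e, f, g) =
     hyp4F3_at_1 a b c d e f g / sin (of_real pi * a)
       * (rGamma a * rGamma (1 + a - e) * rGamma (1 + a - f) * rGamma (1 + a - g)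
          * rGamma e * rGamma f * rGamma g)
     + hyp4F3_at_1 a (1 + a - e) (1 + a - f) (1 + a - g) (1 + a - b) (1 + a - c) (1 + a - d)
         / sin (of_real pi * a)
       * (rGamma a * rGamma b * rGamma c * rGamma d
          * rGamma (1 + a - b) * rGamma (1 + a - c) * rGamma (1 + a - d))"

fun K_defined :: "vec7 \<Rightarrow> bool" where
  "K_defined (a, b, c, d, e, f, g) \<longleftrightarrow>
     sin (of_real pi * a) \<noteq> 0 \<and>
     e \<notin> \<int>\<^sub>\<le>\<^sub>0 \<and> f \<notin> \<int>\<^sub>\<le>\<^sub>0 \<and> g \<notin> \<int>\<^sub>\<le>\<^sub>0 \<and>
     1 + a - b \<notin> \<int>\<^sub>\<le>\<^sub>0 \<and> 1 + a - c \<notin> \<int>\<^sub>\<le>\<^sub>0 \<and> 1 + a - d \<notin> \<int>\<^sub>\<le>\<^sub>0"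

fun p0 :: "vec7 \<Rightarrow> vec7" where
  "p0 (a, b, c, d, e, f, g) = (a, b, c, d, e, f, g)"

fun n0 :: "vec7 \<Rightarrow> vec7" where
  "n0 (a, b, c, d, e, f, g) = (1 - a, 1 - b, 1 - c, 1 - d, 2 - e, 2 - f, 2 - g)"

fun p4 :: "vec7 \<Rightarrow> vec7" where
  "p4 (a, b, c, d, e, f, g) =
     (1 + a - e, 1 + b - e, 1 + c - e, 1 + d - e, 1 + f - e, 1 + g - e, 2 - e)"

lemma p0_in_V: "x \<in> V \<Longrightarrow> p0 x \<in> V"
  by (cases x) simp

lemma V_iff: "(a, b, c, d, e, f, g) \<in> V \<longleftrightarrow> e = 1 + a + b + c + d - f - g"
  by (auto simp: V_def algebra_simps)

lemma n0_in_V: "x \<in> V \<Longrightarrow> n0 x \<in> V"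
  by (cases x) (simp add: V_iff)

lemma p4_in_V: "x \<in> V \<Longrightarrow> p4 x \<in> V"
  by (cases x) (simp add: V_iff)

fun B2 :: "vec7 \<Rightarrow> complex" where
  "B2 (a, b, c, d, e, f, g) =
     1 / of_real pi ^ 4 * sin_prod [f - a, g - a] *
     (sin_prod [b - a, c - a, d - a] + sin_prod [e - 2 * a, f - a, g - a])"

fun B4 :: "vec7 \<Rightarrow> complex" where
  "B4 (a, b, c, d, e, f, g) =
     1 / of_real pi ^ 4 * sin_prod [f - a, g - a] *
     (sin_prod [b, c, d] + sin_prod [e - a, f, g])"

fun C_coeff :: "vec7 \<Rightarrow> complex" where
  "C_coeff (a, b, c, d, e, f, g) =
     1 / of_real pi ^ 4 * sin_prod [e - a] *
     (sin_prod [b, c, d] * B2 (a, b, c, d, e, f, g)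
      + sin_prod [e, f - a, g - a] * B4 (a, b, c, d, e, f, g))"

end

theory Submission
  imports Defs
begin

text \<open>
  Write \<open>a\<^sub>0, \<dots>, a\<^sub>3 = a, b, c, d\<close> and \<open>e\<^sub>0, \<dots>, e\<^sub>3 = 1, e, f, g\<close>, and let
  \<open>t(s) = \<Prod>\<Gamma>(a\<^sub>i + s) / \<Prod>\<Gamma>(e\<^sub>j + s)\<close>. Put \<open>\<phi>\<^sub>j = \<Sum>t(n + 1 - e\<^sub>j)\<close>, summed over
  \<open>n \<ge> 0\<close>, and let \<open>\<rho>\<^sub>i\<close> be the sum of the residues of \<open>t\<close> at the points \<open>- a\<^sub>i - m\<close>. Up to Gamma factors these
  are the \<open>4F3\<close> series at unit argument attached to the exponents \<open>1 - e\<^sub>j\<close> and \<open>a\<^sub>i\<close>. The partial fraction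
  expansion of \<open>t\<close> gives \<open>\<Sum>\<rho>\<^sub>i = 0\<close> and \<open>\<phi>\<^sub>j = \<pi> \<Sum>cot(\<pi>(a\<^sub>i - e\<^sub>j)) \<rho>\<^sub>i\<close>. Hence all
  trigonometric relations between the \<open>\<phi>\<^sub>j\<close> and \<open>\<rho>\<^sub>0\<close> follow, and the \<open>K\<close> functions at \<open>p\<^sub>0\<close> and \<open>p\<^sub>4\<close> are multiples
  of \<open>\<phi>\<^sub>0 + \<pi>\<rho>\<^sub>0 Q\<close> and \<open>\<phi>\<^sub>1 + \<pi>\<rho>\<^sub>0 Q\<close> with the same \<open>Q\<close>.

  The parameters \<open>1 - a\<^sub>i, 2 - e\<^sub>j\<close> of the third \<open>K\<close> function are linked to these by the fact that
  \<open>\<phi>\<^sub>0 - \<phi>\<^sub>3\<close> is a Gamma multiple of the difference \<open>\<phi>\<^sub>2 - \<phi>\<^sub>1\<close> for the reflected parameters. It comes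
  from Bailey's transformation of terminating very well poised \<open>9F8\<close> series with \<open>A = g - 1 - N\<close>: as
  \<open>N \<longlongrightarrow> \<infinity>\<close>, the terms near both ends of such a series survive, and the two halves converge to the two
  \<open>4F3\<close> series of the pair. The transformation is applied twice. The remaining algebra is a single sine identity in
  five variables, and nongeneric parameters are reached by continuity.
\<close>

section \<open>Dougall's terminating sum\<close>

text \<open>With \<open>A = g - 1 - N\<close> the lower partner of \<open>- N\<close> in a well
  poised series is exactly \<open>g\<close>; taking \<open>A + 1 - e\<close> and
  \<open>A + 1 - f\<close> as upper parameters pins their partners to \<open>e\<close> and
  \<open>f\<close>. The remaining large parameters contribute quotients tending to 1, so a
  \<open>4F3\<close> term is left. Bailey's transformation preserves this shape, but one application
  reflects only the pair \<open>c, d\<close> of upper parameters to \<open>f - c, f - d\<close>. A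
  second one, with the pairs exchanged, reflects \<open>a, b\<close> as well; this is why it is
  applied twice.

  The recurring obstacle is the exchange of limits and sums. Terms decay only like
  \<open>1 / n ^ 2\<close>, so each exchange is a case of Tannery's theorem with an explicit
  majorant. The cotangents arise from sums of \<open>1 / (k + z)\<close> that converge only when
  truncated symmetrically, and the growth of these truncations under integer shifts of
  \<open>z\<close> has to be controlled uniformly. The partial fractions of \<open>t\<close> are
  themselves limits of those of rational functions, in which Pochhammer symbols of length
  \<open>N\<close> stand for the Gamma functions.\<close>

definition wp :: "complex \<Rightarrow> complex \<Rightarrow> nat \<Rightarrow> complex" where
  "wp a p n = pochhammer p n / pochhammer (1 + a - p) n"

text \<open>The factor \<open>(a + 2 n) / a\<close> is
  \<open>pochhammer (1 + a/2) n / pochhammer (a/2) n\<close>, the mark of a very well poised series,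
  and \<open>pochhammer a n / fact n\<close> is \<open>wp a a n\<close>. Hence five further
  \<open>wp\<close> factors make a \<open>7F6\<close> term and seven a \<open>9F8\<close>
  term.\<close>

definition vwp :: "complex \<Rightarrow> nat \<Rightarrow> complex" where
  "vwp a n = (a + 2 * of_nat n) / a * pochhammer a n / fact n"

lemma pochhammer_nz:
  fixes z :: complex
  assumes "z \<notin> \<int>"
  shows "pochhammer z n \<noteq> 0"
  using assms by (auto simp: pochhammer_eq_0_iff)

lemma not_Ints_shift:
  fixes z :: complex
  assumes "z \<notin> \<int>" "w - z \<in> \<int> \<or> w + z \<in> \<int>"
  shows "w \<notin> \<int>"
  using assms Ints_diff[of w "w - z"] Ints_diff[of "w + z" w] by auto

lemma not_Ints_nz: "z \<notin> \<int> \<Longrightarrow> z \<noteq> (0::complex)"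
  by auto

lemma wp_0 [simp]: "wp a p 0 = 1"
  by (simp add: wp_def)

lemma vwp_0: "a \<noteq> 0 \<Longrightarrow> vwp a 0 = 1"
  by (simp add: vwp_def)

lemma wp_Suc: "wp a p (Suc n) = p / (1 + a - p) * wp (a + 2) (p + 1) n"
  by (simp add: wp_def pochhammer_rec algebra_simps)

text \<open>Raising the index by one amounts to raising the base by two. The form without quotients
  is chosen because \<open>(n + 1) (a + n + 1)\<close> is the factor that
  \<open>wp_pair_diff\<close> supplies.\<close>

lemma vwp_Suc:
  assumes "a \<notin> \<int>"
  shows "vwp a (Suc n) * ((of_nat n + 1) * (a + of_nat n + 1)) = (a + 1) * (a + 2) * vwp (a + 2) n"
proof -
  have nz: "a \<noteq> 0" "a + 2 \<noteq> 0"
    using assms not_Ints_nz[OF not_Ints_shift[OF assms, of "a + 2"]] by auto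
  have "pochhammer a (Suc (Suc n)) = a * (a + 1) * pochhammer (a + 2) n"
    by (simp add: pochhammer_rec add.commute)
  moreover have "pochhammer a (Suc (Suc n)) = pochhammer a (Suc n) * (a + of_nat n + 1)"
    by (subst pochhammer_Suc) (simp add: algebra_simps)
  ultimately have eq: "pochhammer a (Suc n) * (a + of_nat n + 1) = a * (a + 1) * pochhammer (a + 2) n"
    by simp
  have f: "fact (Suc n) = (of_nat n + 1) * (fact n :: complex)"
    by simp
  have n1: "(of_nat n + 1 :: complex) \<noteq> 0"
    by (metis of_nat_Suc of_nat_neq_0 add.commute)
  have canc: "x / y * p / (m * F) * (m * q) = x / y * (p * q) / F" if "m \<noteq> 0" for x y p m F q :: complex
    using that by simp
  have canc2: "x / y * (y * b * p) / F = b * c * (x / c * p / F)" if "y \<noteq> 0" "c \<noteq> 0" for x y p b c F :: complex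
    using that by simp
  have "vwp a (Suc n) * ((of_nat n + 1) * (a + of_nat n + 1)) =
      (a + 2 * of_nat (Suc n)) / a * (pochhammer a (Suc n) * (a + of_nat n + 1)) / fact n"
    unfolding vwp_def f by (rule canc[OF n1])
  also have "\<dots> = (a + 1) * (a + 2) * vwp (a + 2) n"
  proof -
    have "a + 2 * of_nat (Suc n) = a + 2 + 2 * of_nat n"
      by simp
    then show ?thesis
      unfolding eq vwp_def by (simp only: canc2[OF nz])
  qed
  finally show ?thesis .
qed

lemma frac_diff:
  fixes u :: "'a::field"
  assumes "x \<noteq> 0" "y \<noteq> 0" "X \<noteq> 0" "E \<noteq> 0" "A \<noteq> 0" "Z \<noteq> 0"
  shows "u * p * q / ((x * X) * (E * y)) - u * r * s / ((A * x) * (y * Z))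
     = u * (p * q * (A * Z) - r * s * (X * E)) / (x * y * X * E * A * Z)"
  using assms by (simp add: field_simps)

text \<open>The contiguity relation behind Dougall's sum. The pairs \<open>- N - 1, e\<close> and
  \<open>- N, e - 1\<close> have the same sum, so at index \<open>Suc j\<close> the two products
  share all but a few linear factors. By the polynomial identity \<open>key\<close> what remains
  factors completely into a part depending on \<open>j\<close>, to be absorbed by
  \<open>vwp_Suc\<close>, and a constant.\<close>

lemma wp_pair_diff:
  fixes a e :: complex
  assumes a: "a \<notin> \<int>" and e: "a - e \<notin> \<int>"
  shows "wp a (- of_nat (Suc N)) (Suc j) * wp a e (Suc j) - wp a (- of_nat N) (Suc j) * wp a (e - 1) (Suc j)
     = (of_nat j + 1) * (a + of_nat j + 1) *
       ((e + of_nat N) * (e - of_nat N - 2 - a)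
        / ((1 + a - e) * (2 + a - e) * (a + of_nat N + 1) * (a + of_nat N + 2)))
       * (wp (a + 2) (- of_nat N) j * wp (a + 2) e j)"
proof -
  define n J where "n = (of_nat N :: complex)" and "J = (of_nat j :: complex)"
  define u where "u = pochhammer (- n) j * pochhammer e j"
  define x y where "x = pochhammer (a + n + 2) j" and "y = pochhammer (2 + a - e) j"
  define x' y' where "x' = pochhammer (a + n + 3) j" and "y' = pochhammer (3 + a - e) j"
  have nI: "n \<in> \<int>" "J \<in> \<int>" by (auto simp: n_def J_def)
  have nz: "a + n + 1 \<noteq> 0" "a + n + 2 \<noteq> 0" "a + n + 2 + J \<noteq> 0" 
    by (rule not_Ints_nz, rule not_Ints_shift[OF a], use nI in simp)+
  have nz': "1 + a - e \<noteq> 0" "2 + a - e \<noteq> 0" "2 + a - e + J \<noteq> 0"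
    by (rule not_Ints_nz, rule not_Ints_shift[OF e], use nI in \<open>simp add: algebra_simps\<close>)+
  have xn: "x \<noteq> 0" "x' \<noteq> 0" unfolding x_def x'_def
    by (rule pochhammer_nz, rule not_Ints_shift[OF a], use nI in simp)+
  have yn: "y \<noteq> 0" "y' \<noteq> 0" unfolding y_def y'_def
    by (rule pochhammer_nz, rule not_Ints_shift[OF e], use nI in \<open>simp add: algebra_simps\<close>)+
  have xx: "x * (a + n + 2 + J) = (a + n + 2) * x'"
    using pochhammer_Suc[of "a + n + 2" j] pochhammer_rec[of "a + n + 2" j]
    by (simp add: x_def x'_def J_def add.assoc)
  have yy: "y * (2 + a - e + J) = (2 + a - e) * y'"
    using pochhammer_Suc[of "2 + a - e" j] pochhammer_rec[of "2 + a - e" j]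
    by (simp add: y_def y'_def J_def add.assoc add.commute add_diff_eq)
  have a1: "wp a (- of_nat (Suc N)) (Suc j) * wp a e (Suc j) =
      ((- n - 1) * pochhammer (-n) j * (pochhammer e j * (e + J))) / ((x * (a + n + 2 + J)) * ((1 + a - e) * y))"
  proof -
    have 1: "pochhammer (- of_nat (Suc N) :: complex) (Suc j) = (- n - 1) * pochhammer (-n) j"
      by (subst pochhammer_rec) (simp add: n_def)
    have 2: "pochhammer (1 + a - - of_nat (Suc N)) (Suc j) = x * (a + n + 2 + J)"
      by (subst pochhammer_Suc) (simp add: x_def n_def J_def algebra_simps)
    have 3: "pochhammer (1 + a - e) (Suc j) = (1 + a - e) * y"
      by (subst pochhammer_rec) (simp add: y_def algebra_simps)
    have 4: "pochhammer e (Suc j) = pochhammer e j * (e + J)"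
      by (simp add: pochhammer_Suc J_def)
    show ?thesis unfolding wp_def 1 2 3 4 by simp
  qed
  have a2: "wp a (- of_nat N) (Suc j) * wp a (e - 1) (Suc j) =
      ((- n + J) * pochhammer (-n) j * (pochhammer e j * (e - 1))) / (((a + n + 1) * x) * (y * (2 + a - e + J)))"
  proof -
    have 1: "pochhammer (- of_nat N :: complex) (Suc j) = (- n + J) * pochhammer (-n) j"
      by (subst pochhammer_Suc) (simp add: n_def J_def)
    have 2: "pochhammer (1 + a - - of_nat N) (Suc j) = (a + n + 1) * x"
      by (subst pochhammer_rec) (simp add: x_def n_def J_def algebra_simps)
    have 3: "pochhammer (1 + a - (e - 1)) (Suc j) = y * (2 + a - e + J)"
      by (subst pochhammer_Suc) (simp add: y_def J_def algebra_simps)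
    have 4: "pochhammer (e - 1) (Suc j) = pochhammer e j * (e - 1)"
      by (simp add: pochhammer_rec J_def)
    show ?thesis unfolding wp_def 1 2 3 4 by simp
  qed
  have a3: "wp (a + 2) (- of_nat N) j * wp (a + 2) e j = u / (x' * y')"
    by (simp add: wp_def u_def x'_def y'_def n_def algebra_simps)
  have x'e: "x' = x * (a + n + 2 + J) / (a + n + 2)" and y'e: "y' = y * (2 + a - e + J) / (2 + a - e)"
    using xx yy nz nz' by (simp_all add: field_simps)
  have key: "(- n - 1) * (e + J) * ((a + n + 1) * (2 + a - e + J)) - (- n + J) * (e - 1) * ((a + n + 2 + J) * (1 + a - e))
      = (J + 1) * (a + J + 1) * ((e + n) * (e - n - 2 - a))"
    by algebra
  have "u * (- n - 1) * (e + J) / ((x * (a + n + 2 + J)) * ((1 + a - e) * y))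
      - u * (- n + J) * (e - 1) / (((a + n + 1) * x) * (y * (2 + a - e + J)))
     = u * ((- n - 1) * (e + J) * ((a + n + 1) * (2 + a - e + J)) - (- n + J) * (e - 1) * ((a + n + 2 + J) * (1 + a - e)))
        / (x * y * (a + n + 2 + J) * (1 + a - e) * (a + n + 1) * (2 + a - e + J))"
    by (rule frac_diff) (use nz nz' xn yn in auto)
  also have "\<dots> = (J + 1) * (a + J + 1) *
       ((e + n) * (e - n - 2 - a) / ((1 + a - e) * (2 + a - e) * (a + n + 1) * (a + n + 2)))
       * (u / (x' * y'))"
    unfolding key x'e y'e using nz nz' xn yn by (simp add: divide_simps)
  finally show ?thesis
    unfolding a1 a2 a3 unfolding u_def n_def J_def by (simp add: mult_ac)
qed

definition dougall_prod :: "complex \<Rightarrow> complex \<Rightarrow> complex \<Rightarrow> complex \<Rightarrow> nat \<Rightarrow> complex" where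
  "dougall_prod a b c d N =
     (pochhammer (1 + a) N * pochhammer (1 + a - b - c) N * pochhammer (1 + a - b - d) N
        * pochhammer (1 + a - c - d) N)
     / (pochhammer (1 + a - b) N * pochhammer (1 + a - c) N * pochhammer (1 + a - d) N
        * pochhammer (1 + a - b - c - d) N)"

text \<open>Induction on \<open>N\<close>, simultaneously for all parameters. Passing from
  \<open>N, e - 1\<close> to \<open>Suc N, e\<close> changes each term by a constant
  \<open>X\<close> times a term of the series with \<open>a + 2, b + 1, c + 1, d + 1, e\<close> and
  length \<open>N\<close>. The balance condition holds for both shorter sums, so the induction
  hypothesis evaluates them and only a product identity is left.\<close>

lemma dougall_7F6:
  fixes a b c d e :: complex
  assumes "a \<notin> \<int>" "a - b \<notin> \<int>" "a - c \<notin> \<int>" "a - d \<notin> \<int>" "a - b - c - d \<notin> \<int>"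
    and "e = 1 + 2 * a - b - c - d + of_nat N"
  shows "(\<Sum>k\<le>N. vwp a k * wp a b k * wp a c k * wp a d k * wp a e k * wp a (- of_nat N) k)
         = dougall_prod a b c d N"
  using assms
proof (induction N arbitrary: a b c d e)
  case 0
  then show ?case
    by (simp add: dougall_prod_def vwp_0 not_Ints_nz)
next
  case (Suc N)
  note nI = Suc.prems(1-5)
  define n where "n = (of_nat N :: complex)"
  have nInt: "n \<in> \<int>" by (simp add: n_def)
  define B where "B = (\<lambda>a b c d k. vwp a k * wp a b k * wp a c k * wp a d k)"
  define q where "q = a - b - c - d"
  have e: "e = 2 + 2 * a - b - c - d + n"
    using Suc.prems(6) by (simp add: n_def)
  have aeI: "a - e \<notin> \<int>"
    by (rule not_Ints_shift[OF nI(5)]) (use nInt in \<open>auto simp: e\<close>)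
  define X where "X = (a + 1) * (a + 2) * (b / (1 + a - b) * (c / (1 + a - c)) * (d / (1 + a - d)))
     * ((e + n) * (e - n - 2 - a) / ((1 + a - e) * (2 + a - e) * (a + n + 1) * (a + n + 2)))"
  have IH1: "(\<Sum>k\<le>N. B a b c d k * wp a (e - 1) k * wp a (- of_nat N) k) = dougall_prod a b c d N"
    unfolding B_def by (rule Suc.IH) (use nI in \<open>auto simp: e n_def\<close>)
  have IH2: "(\<Sum>k\<le>N. B (a+2) (b+1) (c+1) (d+1) k * wp (a+2) e k * wp (a+2) (- of_nat N) k)
      = dougall_prod (a+2) (b+1) (c+1) (d+1) N"
    unfolding B_def
  proof (rule Suc.IH)
    show "a + 2 \<notin> \<int>" by (rule not_Ints_shift[OF nI(1)]) simp
    show "a + 2 - (b + 1) \<notin> \<int>" by (rule not_Ints_shift[OF nI(2)]) simp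
    show "a + 2 - (c + 1) \<notin> \<int>" by (rule not_Ints_shift[OF nI(3)]) simp
    show "a + 2 - (d + 1) \<notin> \<int>" by (rule not_Ints_shift[OF nI(4)]) simp
    show "a + 2 - (b + 1) - (c + 1) - (d + 1) \<notin> \<int>" by (rule not_Ints_shift[OF nI(5)]) simp
    show "e = 1 + 2 * (a + 2) - (b + 1) - (c + 1) - (d + 1) + of_nat N"
      by (simp add: e n_def)
  qed
  define D where "D = (\<lambda>k. B a b c d k * (wp a (- of_nat (Suc N)) k * wp a e k - wp a (- of_nat N) k * wp a (e - 1) k))"
  have D0: "D 0 = 0" by (simp add: D_def)
  have DS: "D (Suc j) = X * (B (a+2) (b+1) (c+1) (d+1) j * wp (a+2) e j * wp (a+2) (- of_nat N) j)" for j
  proof -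
    have "D (Suc j) = (vwp a (Suc j) * ((of_nat j + 1) * (a + of_nat j + 1))) * (wp a b (Suc j) * wp a c (Suc j) * wp a d (Suc j))
        * ((e + n) * (e - n - 2 - a) / ((1 + a - e) * (2 + a - e) * (a + n + 1) * (a + n + 2)))
       * (wp (a + 2) (- of_nat N) j * wp (a + 2) e j)"
      unfolding D_def B_def wp_pair_diff[OF nI(1) aeI] n_def by (simp only: mult_ac)
    also have "\<dots> = X * (B (a+2) (b+1) (c+1) (d+1) j * wp (a+2) e j * wp (a+2) (- of_nat N) j)"
      unfolding vwp_Suc[OF nI(1)] wp_Suc X_def B_def by (simp only: mult_ac)
    finally show ?thesis .
  qed
  \<comment> \<open>This permits extending the sum of order \<open>N\<close> by one vanishing term,
    so that both sums run over the same range.\<close>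
  have last0: "wp a (- of_nat N) (Suc N) = 0"
    by (simp add: wp_def pochhammer_of_nat_eq_0_iff)
  have "(\<Sum>k\<le>Suc N. B a b c d k * wp a e k * wp a (- of_nat (Suc N)) k)
     = (\<Sum>k\<le>Suc N. B a b c d k * wp a (e - 1) k * wp a (- of_nat N) k) + (\<Sum>k\<le>Suc N. D k)"
    unfolding sum.distrib[symmetric] D_def by (rule sum.cong) (simp_all add: algebra_simps del: of_nat_Suc)
  also have "(\<Sum>k\<le>Suc N. B a b c d k * wp a (e - 1) k * wp a (- of_nat N) k) = dougall_prod a b c d N"
    using IH1 last0 by simp
  also have "(\<Sum>k\<le>Suc N. D k) = X * dougall_prod (a+2) (b+1) (c+1) (d+1) N"
    unfolding sum.atMost_Suc_shift D0 DS IH2[symmetric] by (simp add: sum_distrib_left)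
  also have "dougall_prod a b c d N + X * dougall_prod (a+2) (b+1) (c+1) (d+1) N = dougall_prod a b c d (Suc N)"
  proof -
    have sh: "pochhammer (z + 1) N = pochhammer z N * (z + n) / z" if "z \<noteq> 0" for z
      using pochhammer_Suc[of z N] pochhammer_rec[of z N] that by (simp add: field_simps n_def)
    have e2: "pochhammer (1 + (a + 2)) N = pochhammer (1 + a) N * (1 + a + n) * (2 + a + n) / ((1 + a) * (2 + a))"
    proof -
      have "1 + a \<noteq> 0" "2 + a \<noteq> 0"
        by (rule not_Ints_nz, rule not_Ints_shift[OF nI(1)], simp)+
      then show ?thesis using sh[of "1 + a"] sh[of "2 + a"] by (simp add: add_ac)
    qed
    have nzb: "1 + a - b \<noteq> 0" "1 + a - b + n \<noteq> 0" 
      by (rule not_Ints_nz, rule not_Ints_shift[OF nI(2)], use nInt in \<open>simp add: algebra_simps\<close>)+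
    have nzc: "1 + a - c \<noteq> 0" "1 + a - c + n \<noteq> 0" 
      by (rule not_Ints_nz, rule not_Ints_shift[OF nI(3)], use nInt in \<open>simp add: algebra_simps\<close>)+
    have nzd: "1 + a - d \<noteq> 0" "1 + a - d + n \<noteq> 0" 
      by (rule not_Ints_nz, rule not_Ints_shift[OF nI(4)], use nInt in \<open>simp add: algebra_simps\<close>)+
    have nzq: "q \<noteq> 0" "q + n \<noteq> 0" "1 + q + n \<noteq> 0"
      by (rule not_Ints_nz, rule not_Ints_shift[OF nI(5)], use nInt in \<open>simp add: algebra_simps q_def\<close>)+
    have nza: "1 + a \<noteq> 0" "2 + a \<noteq> 0" "1 + a + n \<noteq> 0" "2 + a + n \<noteq> 0"
      by (rule not_Ints_nz, rule not_Ints_shift[OF nI(1)], use nInt in \<open>simp add: algebra_simps\<close>)+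
    have eb: "pochhammer (2 + a - b) N = pochhammer (1 + a - b) N * (1 + a - b + n) / (1 + a - b)"
      "pochhammer (2 + a - c) N = pochhammer (1 + a - c) N * (1 + a - c + n) / (1 + a - c)"
      "pochhammer (2 + a - d) N = pochhammer (1 + a - d) N * (1 + a - d + n) / (1 + a - d)"
      "pochhammer (1 + q) N = pochhammer q N * (q + n) / q"
      using sh[of "1 + a - b"] sh[of "1 + a - c"] sh[of "1 + a - d"] sh[of q] nzb nzc nzd nzq
      by (simp_all add: add_ac add_diff_eq)
    define R where "R = pochhammer (1 + a) N * pochhammer (1 + a - b - c) N * pochhammer (1 + a - b - d) N
        * pochhammer (1 + a - c - d) N"
    define pb pc pd pq where "pb = pochhammer (1 + a - b) N" "pc = pochhammer (1 + a - c) N"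
       "pd = pochhammer (1 + a - d) N" "pq = pochhammer (1 + q) N"
    have "pochhammer (1 + a - b) N \<noteq> 0" "pochhammer (1 + a - c) N \<noteq> 0" "pochhammer (1 + a - d) N \<noteq> 0" "pochhammer (1 + q) N \<noteq> 0"
      by (rule pochhammer_nz, rule not_Ints_shift[OF nI(2)] not_Ints_shift[OF nI(3)] 
       not_Ints_shift[OF nI(4)] not_Ints_shift[OF nI(5)], simp add: q_def)+
    then have pnz: "pb \<noteq> 0" "pc \<noteq> 0" "pd \<noteq> 0" "pq \<noteq> 0"
      by (auto simp: pb_pc_pd_pq_def)
    have d1: "dougall_prod a b c d N = R / (pb * pc * pd * pq)"
      by (simp add: dougall_prod_def R_def pb_pc_pd_pq_def q_def add_diff_eq)
    have d2: "dougall_prod a b c d (Suc N) = R * ((1 + a + n) * (1 + a + n - b - c) * (1 + a + n - b - d) * (1 + a + n - c - d))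
       / (pb * pc * pd * pq * ((1 + a - b + n) * (1 + a - c + n) * (1 + a - d + n) * (1 + q + n)))"
      by (simp add: dougall_prod_def R_def pb_pc_pd_pq_def q_def pochhammer_Suc n_def algebra_simps)
    have d3: "dougall_prod (a+2) (b+1) (c+1) (d+1) N =
        (R * (1 + a + n) * (2 + a + n) / ((1 + a) * (2 + a))) /
        ((pb * (1 + a - b + n) / (1 + a - b)) * (pc * (1 + a - c + n) / (1 + a - c))
         * (pd * (1 + a - d + n) / (1 + a - d)) * (pq * q / (q + n)))"
    proof -
      have *: "1 + (a + 2) - (b + 1) = 2 + a - b" "1 + (a + 2) - (c + 1) = 2 + a - c" "1 + (a + 2) - (d + 1) = 2 + a - d"
        by simp_all
      have **: "2 + a - b - (c + 1) = 1 + a - b - c" "2 + a - b - (d + 1) = 1 + a - b - d" "2 + a - c - (d + 1) = 1 + a - c - d"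
        "1 + a - b - c - (d + 1) = q"
        by (simp_all add: q_def)
      have pq': "pochhammer q N = pq * q / (q + n)"
        using eb(4) nzq by (simp add: pb_pc_pd_pq_def)
      show ?thesis
        unfolding dougall_prod_def * ** e2 eb(1-3) pq' R_def pb_pc_pd_pq_def(1-3) by (simp add: mult_ac)
    qed
    have X': "X = (a + 1) * (a + 2) * (b / (1 + a - b) * (c / (1 + a - c)) * (d / (1 + a - d)))
       * ((e + n) * q / ((1 + q + n) * (q + n) * (1 + a + n) * (2 + a + n)))"
    proof -
      have "e - n - 2 - a = q" "1 + a - e = - (1 + q + n)" "2 + a - e = - (q + n)"
        by (simp_all add: e q_def algebra_simps)
      then show ?thesis unfolding X_def by (simp only: minus_mult_minus) (simp only: add_ac mult_ac)
    qed
    have d4: "X * dougall_prod (a+2) (b+1) (c+1) (d+1) N = R * (b * c * d * (e + n))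
        / (pb * pc * pd * pq * ((1 + a - b + n) * (1 + a - c + n) * (1 + a - d + n) * (1 + q + n)))"
      unfolding d3 X' using nza nzb nzc nzd nzq pnz by (simp add: divide_simps add_ac)
    have "dougall_prod a b c d N = R * ((1 + a - b + n) * (1 + a - c + n) * (1 + a - d + n) * (1 + q + n))
        / (pb * pc * pd * pq * ((1 + a - b + n) * (1 + a - c + n) * (1 + a - d + n) * (1 + q + n)))"
      unfolding d1 using nza nzb nzc nzd nzq pnz by simp
    \<comment> \<open>After division by the common denominator the induction step is this quartic
      identity; the balance condition enters through the value of \<open>e\<close>.\<close>
    moreover have "(1 + a + n) * (1 + a + n - b - c) * (1 + a + n - b - d) * (1 + a + n - c - d)
       = (1 + a - b + n) * (1 + a - c + n) * (1 + a - d + n) * (1 + q + n) + b * c * d * (e + n)"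
      unfolding q_def e by algebra
    ultimately show ?thesis
      unfolding d2 d4 by (simp only: distrib_left add_divide_distrib)
  qed
  finally show ?case
    by (simp add: B_def)
qed

section \<open>Bailey's terminating transformation\<close>

lemma wp_add: "wp a p (k + m) = wp a p k * wp (a + 2 * of_nat k) (p + of_nat k) m"
  by (simp add: wp_def pochhammer_product' algebra_simps)

lemma pochhammer_minus_of_nat:
  assumes "k \<le> n"
  shows "pochhammer (- of_nat n :: complex) k = (-1) ^ k * fact n / fact (n - k)"
  using assms
proof (induction k)
  case (Suc k)
  then have "n - k = Suc (n - Suc k)" by simp
  then have f: "fact (n - k) = (of_nat (n - k) :: complex) * fact (n - Suc k)"
    by simp
  have nz: "(of_nat (n - k) :: complex) \<noteq> 0"
    using Suc.prems by simp
  have "pochhammer (- of_nat n :: complex) (Suc k) = ((-1) ^ k * fact n / fact (n - k)) * (- of_nat (n - k))"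
    using Suc by (simp add: pochhammer_Suc of_nat_diff)
  then show ?case
    using nz unfolding f by simp
qed simp

lemma pochhammer_reflect:
  fixes z :: complex
  shows "pochhammer (1 - z - of_nat k) k = (-1) ^ k * pochhammer z k"
proof -
  have "pochhammer z k = (-1) ^ k * pochhammer (1 - z - of_nat k) k"
    using pochhammer_minus[of "-z" k] by (simp add: algebra_simps)
  then show ?thesis
    by (simp add: mult.assoc[symmetric] power_mult_distrib[symmetric])
qed

lemma pochhammer_diff:
  fixes z :: complex
  assumes "z \<notin> \<int>" "k \<le> N"
  shows "pochhammer z (N - k) = (-1) ^ k * pochhammer z N / pochhammer (1 - z - of_nat N) k"
proof -
  have I: "1 - z - of_nat N \<notin> \<int>"
    by (rule not_Ints_shift[OF assms(1)]) simp
  have "pochhammer z N = pochhammer z (N - k) * pochhammer (z + of_nat (N - k)) k"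
    using pochhammer_product'[of z "N - k" k] assms(2) by simp
  also have "pochhammer (z + of_nat (N - k)) k = (-1) ^ k * pochhammer (1 - z - of_nat N) k"
    using pochhammer_reflect[of "1 - z - of_nat N" k] assms(2) by (simp add: of_nat_diff algebra_simps)
  finally show ?thesis
    using pochhammer_nz[OF I, of k]
    by (simp add: field_simps power_mult_distrib[symmetric])
qed

text \<open>Prepares the exchange of summation with \<open>n = k + m\<close>. The two
  \<open>wp (a - h)\<close> factors have parameters depending on \<open>n\<close>; they merge with
  the Pochhammer symbols of length \<open>k + m\<close> so that all dependence on \<open>m\<close>
  becomes a very well poised term of base \<open>a + 2 k\<close> with \<open>h\<close> as a new
  parameter.\<close>

lemma vwp_add:
  assumes "a \<notin> \<int>" "h \<notin> \<int>"
  shows "vwp a (k + m) * (pochhammer h (k + m) / pochhammer (1 + a - h) (k + m))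
     * wp (a - h) (a + of_nat (k + m)) k * wp (a - h) (- of_nat (k + m)) k
   = pochhammer (1 + a) (2 * k) / pochhammer (1 + a - h) (2 * k) * (vwp (a + 2 * of_nat k) m * wp (a + 2 * of_nat k) h m)"
  (is "?lhs = ?rhs")
proof -
  define P where "P = pochhammer (1 + a - h) (k + m + k)"
  have a0: "a \<noteq> 0" "a + 2 * of_nat k \<noteq> 0"
    using assms(1) not_Ints_nz[OF not_Ints_shift[OF assms(1), of "a + 2 * of_nat k"]] by auto
  have hk: "pochhammer (1 - h - of_nat (k + m)) k = (-1) ^ k * pochhammer (h + of_nat m) k"
    using pochhammer_reflect[of "h + of_nat m" k] by (simp add: algebra_simps)
  have hm: "pochhammer h (k + m) = pochhammer h m * pochhammer (h + of_nat m) k"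
    using pochhammer_product'[of h m k] by (simp add: add.commute)
  have hnz: "pochhammer (h + of_nat m) k \<noteq> 0"
    by (rule pochhammer_nz, rule not_Ints_shift[OF assms(2)]) simp
  have kmk: "k + m + k = 2 * k + m" by simp
  have akm: "pochhammer a (k + m) * pochhammer (a + of_nat (k + m)) k
      = pochhammer a (2 * k) * pochhammer (a + 2 * of_nat k) m"
    using pochhammer_product'[of a "k + m" k] pochhammer_product'[of a "2 * k" m] unfolding kmk by simp
  have lam: "pochhammer (1 + a - h) (k + m) * pochhammer (1 + a - h + of_nat (k + m)) k
      = pochhammer (1 + a - h) (2 * k) * pochhammer (1 + a + 2 * of_nat k - h) m"
    using pochhammer_product'[of "1 + a - h" "k + m" k] pochhammer_product'[of "1 + a - h" "2 * k" m]
    unfolding kmk by (simp add: diff_add_eq)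
  have a2k: "(a + 2 * of_nat k) / a * pochhammer a (2 * k) = pochhammer (1 + a) (2 * k)"
    using pochhammer_rec[of a "2 * k"] pochhammer_Suc[of a "2 * k"] a0 by (simp add: field_simps)
  have f: "pochhammer (- of_nat (k + m) :: complex) k = (-1) ^ k * fact (k + m) / fact m"
    using pochhammer_minus_of_nat[of k "k + m"] by (simp del: of_nat_add)
  have w1: "wp (a - h) (a + of_nat (k + m)) k = pochhammer (a + of_nat (k + m)) k / ((-1) ^ k * pochhammer (h + of_nat m) k)"
    unfolding hk[symmetric] by (simp add: wp_def algebra_simps)
  have w2: "wp (a - h) (- of_nat (k + m)) k = ((-1) ^ k * fact (k + m) / fact m) / pochhammer (1 + a - h + of_nat (k + m)) k"
    unfolding f[symmetric] by (simp add: wp_def algebra_simps)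
  have s: "(-1) ^ k * (-1) ^ k = (1 :: complex)" 
    by (simp add: power_mult_distrib[symmetric])
  have "?lhs = (a + 2 * of_nat (k + m)) / a * (pochhammer a (k + m) * pochhammer (a + of_nat (k + m)) k) / fact m
     * pochhammer h m / (pochhammer (1 + a - h) (k + m) * pochhammer (1 + a - h + of_nat (k + m)) k)"
    unfolding w1 w2 vwp_def hm using hnz a0 s by (simp add: mult_ac)
  also have "\<dots> = (a + 2 * of_nat (k + m)) / a * (pochhammer a (2 * k) * pochhammer (a + 2 * of_nat k) m) / fact m
     * pochhammer h m / (pochhammer (1 + a - h) (2 * k) * pochhammer (1 + a + 2 * of_nat k - h) m)"
    unfolding akm lam ..
  also have "\<dots> = ?rhs"
  proof -
    define b where "b = a + 2 * of_nat k"
    have "a + 2 * of_nat (k + m) = b + 2 * of_nat m" "1 + a + 2 * of_nat k - h = 1 + b - h"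
      by (simp_all add: b_def algebra_simps)
    note e = this
    show ?thesis
      using a0 unfolding a2k[symmetric] vwp_def wp_def e unfolding b_def[symmetric]
      by (simp add: mult_ac)
  qed
  finally show ?thesis .
qed

text \<open>Dougall's sum read backwards. With base \<open>l\<close> and parameters
  \<open>l + b - a\<close>, \<open>l + c - a\<close>, \<open>l + d - a\<close> the closed product
  consists of the symbols of \<open>b, c, d\<close> over those of \<open>1 + a - b\<close>,
  \<open>1 + a - c\<close>, \<open>1 + a - d\<close>, up to one quotient. The parameter
  \<open>a + n\<close> is the one forced by balance.\<close>

lemma triple_expand:
  fixes a b c d :: complex
  defines "l \<equiv> 1 + 2 * a - b - c - d"
  assumes l: "l \<notin> \<int>" and ab: "a - b \<notin> \<int>" "a - c \<notin> \<int>" "a - d \<notin> \<int>" and al: "a - l \<notin> \<int>"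
  shows "wp a b n * wp a c n * wp a d n = pochhammer (a - l) n / pochhammer (1 + l) n *
    (\<Sum>k\<le>n. vwp l k * wp l (l + b - a) k * wp l (l + c - a) k * wp l (l + d - a) k
        * wp l (a + of_nat n) k * wp l (- of_nat n) k)"
proof -
  have "(\<Sum>k\<le>n. vwp l k * wp l (l + b - a) k * wp l (l + c - a) k * wp l (l + d - a) k
        * wp l (a + of_nat n) k * wp l (- of_nat n) k) = dougall_prod l (l + b - a) (l + c - a) (l + d - a) n"
  proof (rule dougall_7F6[OF l])
    show "l - (l + b - a) \<notin> \<int>" "l - (l + c - a) \<notin> \<int>" "l - (l + d - a) \<notin> \<int>"
      using ab by simp_all
    show "l - (l + b - a) - (l + c - a) - (l + d - a) \<notin> \<int>"
      by (rule not_Ints_shift[OF al]) (simp add: l_def algebra_simps)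
    show "a + of_nat n = 1 + 2 * l - (l + b - a) - (l + c - a) - (l + d - a) + of_nat n"
      by (simp add: l_def algebra_simps)
  qed
  moreover have "dougall_prod l (l + b - a) (l + c - a) (l + d - a) n
     = pochhammer (1 + l) n * pochhammer b n * pochhammer c n * pochhammer d n /
       (pochhammer (1 + a - b) n * pochhammer (1 + a - c) n * pochhammer (1 + a - d) n * pochhammer (a - l) n)"
  proof -
    have *: "1 + l - (l + b - a) = 1 + a - b" "1 + l - (l + c - a) = 1 + a - c" "1 + l - (l + d - a) = 1 + a - d"
      by (simp_all add: l_def algebra_simps)
    have **: "1 + a - b - (l + c - a) = d" "1 + a - b - (l + d - a) = c"
       "1 + a - c - (l + d - a) = b" "d - (l + d - a) = a - l"
      by (simp_all add: l_def algebra_simps)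
    show ?thesis unfolding dougall_prod_def * ** by (simp only: mult_ac)
  qed
  moreover have "pochhammer (a - l) n \<noteq> 0" "pochhammer (1 + l) n \<noteq> 0"
    using pochhammer_nz[OF al] pochhammer_nz[OF not_Ints_shift[OF l, of "1 + l"]] by auto
  ultimately show ?thesis
    by (simp add: wp_def)
qed

text \<open>Dougall's sum is used twice: once to expand the factors with \<open>b, c, d\<close> into
  a sum over \<open>k\<close> of base \<open>l\<close>, and, after the order of summation is
  exchanged, once to evaluate the inner sum over \<open>n - k\<close> of base
  \<open>a + 2 k\<close>. In the inner sum \<open>h = a - l\<close> takes the place of the expanded
  triple.\<close>

lemma bailey_9F8:
  fixes a b c d e f g :: complex
  defines "l \<equiv> 1 + 2 * a - b - c - d"
  assumes bal: "g = 2 + 3 * a - b - c - d - e - f + of_nat N"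
    and nI: "a \<notin> \<int>" "l \<notin> \<int>" "a - b \<notin> \<int>" "a - c \<notin> \<int>" "a - d \<notin> \<int>" "a - l \<notin> \<int>"
      "a - e \<notin> \<int>" "a - f \<notin> \<int>" "a - g \<notin> \<int>" "l - e \<notin> \<int>" "l - f \<notin> \<int>" "l - g \<notin> \<int>"
  shows "(\<Sum>n\<le>N. vwp a n * wp a b n * wp a c n * wp a d n * wp a e n * wp a f n * wp a g n * wp a (- of_nat N) n)
    = pochhammer (1 + a) N * pochhammer (1 + a - e - f) N * pochhammer (1 + l - e) N * pochhammer (1 + l - f) N
      / (pochhammer (1 + a - e) N * pochhammer (1 + a - f) N * pochhammer (1 + l - e - f) N * pochhammer (1 + l) N)
      * (\<Sum>n\<le>N. vwp l n * wp l (l + b - a) n * wp l (l + c - a) n * wp l (l + d - a) n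
           * wp l e n * wp l f n * wp l g n * wp l (- of_nat N) n)"
proof -
  define h where "h = a - l"
  have hI: "h \<notin> \<int>" using nI by (simp add: h_def)
  have lh: "l = a - h" by (simp add: h_def)
  have hl: "1 + a - h = 1 + l" by (simp add: h_def)
  have bal': "e + f + g = 1 + a + l + of_nat N"
    by (simp add: bal l_def)
  define v where "v = (\<lambda>k. vwp l k * wp l (l + b - a) k * wp l (l + c - a) k * wp l (l + d - a) k)"
  define u where "u = (\<lambda>a e f g n. wp a e n * wp a f n * wp a g n)"
  define pre where "pre = pochhammer (1 + a) N * pochhammer (1 + a - e - f) N * pochhammer (1 + l - e) N * pochhammer (1 + l - f) N
      / (pochhammer (1 + a - e) N * pochhammer (1 + a - f) N * pochhammer (1 + l - e - f) N * pochhammer (1 + l) N)"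
  define T where "T = (\<lambda>n k. vwp a n * u a e f g n * wp a (- of_nat N) n * (pochhammer h n / pochhammer (1 + a - h) n)
     * (v k * wp l (a + of_nat n) k * wp l (- of_nat n) k))"
  have "(\<Sum>n\<le>N. vwp a n * wp a b n * wp a c n * wp a d n * wp a e n * wp a f n * wp a g n * wp a (- of_nat N) n)
     = (\<Sum>n\<le>N. \<Sum>k\<le>n. T n k)"
  proof (rule sum.cong[OF refl])
    fix n
    have "wp a b n * wp a c n * wp a d n = pochhammer h n / pochhammer (1 + a - h) n * (\<Sum>k\<le>n. v k * wp l (a + of_nat n) k * wp l (- of_nat n) k)"
      unfolding hl unfolding v_def h_def l_def by (rule triple_expand) (use nI in \<open>simp_all only: l_def not_False_eq_True\<close>)
    moreover have "(\<Sum>k\<le>n. T n k) = vwp a n * u a e f g n * wp a (- of_nat N) n * (pochhammer h n / pochhammer (1 + a - h) n)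
        * (\<Sum>k\<le>n. v k * wp l (a + of_nat n) k * wp l (- of_nat n) k)"
      unfolding T_def sum_distrib_left ..
    ultimately have "(\<Sum>k\<le>n. T n k) = vwp a n * u a e f g n * wp a (- of_nat N) n * (wp a b n * wp a c n * wp a d n)"
      by (simp only: mult.assoc)
    then show "vwp a n * wp a b n * wp a c n * wp a d n * wp a e n * wp a f n * wp a g n * wp a (- of_nat N) n = (\<Sum>k\<le>n. T n k)"
      by (simp only: u_def mult_ac)
  qed
  also have "\<dots> = (\<Sum>(n, k)\<in>Sigma {..N} (\<lambda>n. {..n}). T n k)"
    by (simp add: sum.Sigma)
  \<comment> \<open>The triangle \<open>k \<le> n \<le> N\<close> is parametrized by
    \<open>k\<close> and \<open>m = n - k\<close>.\<close>
  also have "\<dots> = (\<Sum>(k, m)\<in>Sigma {..N} (\<lambda>k. {..N - k}). T (k + m) k)"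
    by (rule sum.reindex_bij_witness[where i = "\<lambda>(k, m). (k + m, k)" and j = "\<lambda>(n, k). (k, n - k)"]) auto
  also have "\<dots> = (\<Sum>k\<le>N. \<Sum>m\<le>N - k. T (k + m) k)"
    by (simp add: sum.Sigma)
  also have "\<dots> = (\<Sum>k\<le>N. pre * (v k * u l e f g k * wp l (- of_nat N) k))"
  proof (rule sum.cong[OF refl])
    fix k assume "k \<in> {..N}"
    then have kN: "k \<le> N" by simp
    define K where "K = (of_nat k :: complex)"
    have KI: "K \<in> \<int>" by (simp add: K_def)
    define M where "M = N - k"
    have M: "of_nat M = of_nat N - K" using kN by (simp add: M_def K_def of_nat_diff)
    define C where "C = v k * u a e f g k * wp a (- of_nat N) k * (pochhammer (1 + a) (2 * k) / pochhammer (1 + l) (2 * k))"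
    have "T (k + m) k = C * (vwp (a + 2 * K) m * wp (a + 2 * K) (e + K) m * wp (a + 2 * K) (f + K) m * wp (a + 2 * K) h m
             * wp (a + 2 * K) (g + K) m * wp (a + 2 * K) (- of_nat M) m)" for m
    proof -
      have "T (k + m) k = v k * u a e f g (k + m) * wp a (- of_nat N) (k + m) * (vwp a (k + m) * (pochhammer h (k + m) / pochhammer (1 + a - h) (k + m))
         * wp (a - h) (a + of_nat (k + m)) k * wp (a - h) (- of_nat (k + m)) k)"
        unfolding T_def lh by (simp only: mult_ac)
      also have "\<dots> = v k * u a e f g (k + m) * wp a (- of_nat N) (k + m) *
         (pochhammer (1 + a) (2 * k) / pochhammer (1 + l) (2 * k) * (vwp (a + 2 * K) m * wp (a + 2 * K) h m))"
        unfolding vwp_add[OF nI(1) hI] by (simp add: lh K_def add_diff_eq)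
      also have "- of_nat M = - of_nat N + (of_nat k :: complex)" using M K_def by simp
      ultimately show ?thesis
        unfolding u_def C_def wp_add K_def by (simp only: mult_ac)
    qed
    then have "(\<Sum>m\<le>N - k. T (k + m) k) = C * (\<Sum>m\<le>M. vwp (a + 2 * K) m * wp (a + 2 * K) (e + K) m * wp (a + 2 * K) (f + K) m * wp (a + 2 * K) h m
             * wp (a + 2 * K) (g + K) m * wp (a + 2 * K) (- of_nat M) m)"
      by (simp add: sum_distrib_left M_def)
    also have "(\<Sum>m\<le>M. vwp (a + 2 * K) m * wp (a + 2 * K) (e + K) m * wp (a + 2 * K) (f + K) m * wp (a + 2 * K) h m
             * wp (a + 2 * K) (g + K) m * wp (a + 2 * K) (- of_nat M) m) = dougall_prod (a + 2 * K) (e + K) (f + K) h M"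
    proof (rule dougall_7F6)
      show "a + 2 * K \<notin> \<int>" by (rule not_Ints_shift[OF nI(1)]) (use KI in simp)
      show "a + 2 * K - (e + K) \<notin> \<int>" by (rule not_Ints_shift[OF nI(7)]) (use KI in simp)
      show "a + 2 * K - (f + K) \<notin> \<int>" by (rule not_Ints_shift[OF nI(8)]) (use KI in simp)
      show "a + 2 * K - h \<notin> \<int>" by (rule not_Ints_shift[OF nI(2)]) (use KI in \<open>simp add: lh\<close>)
      show "a + 2 * K - (e + K) - (f + K) - h \<notin> \<int>"
      proof (rule not_Ints_shift[OF nI(9)])
        have "e + f = 1 + a + l + of_nat N - g"
          using bal' by (simp add: algebra_simps)
        moreover have "a + 2 * K - (e + K) - (f + K) - h = l - (e + f)"
          by (simp add: lh)
        ultimately have eq: "a + 2 * K - (e + K) - (f + K) - h = - (a - g) - 1 - of_nat N"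
          by simp
        show "a + 2 * K - (e + K) - (f + K) - h - (a - g) \<in> \<int> \<or> a + 2 * K - (e + K) - (f + K) - h + (a - g) \<in> \<int>"
          unfolding eq by simp
      qed
      show "g + K = 1 + 2 * (a + 2 * K) - (e + K) - (f + K) - h + of_nat M"
        using bal' by (simp add: M lh algebra_simps)
    qed
    also have "dougall_prod (a + 2 * K) (e + K) (f + K) h M =
       pochhammer (1 + a + 2 * K) M * pochhammer (1 + a - e - f) M * pochhammer (1 + l - e + K) M * pochhammer (1 + l - f + K) M
      / (pochhammer (1 + a - e + K) M * pochhammer (1 + a - f + K) M * pochhammer (1 + l + 2 * K) M * pochhammer (1 + l - e - f) M)"
    proof -
      have *: "1 + (a + 2 * K) - (e + K) = 1 + a - e + K" "1 + (a + 2 * K) - (f + K) = 1 + a - f + K"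
        by (simp_all add: algebra_simps)
      have **: "1 + a - e + K - (f + K) = 1 + a - e - f" "1 + a - e + K - h = 1 + l - e + K"
        "1 + a - f + K - h = 1 + l - f + K" "1 + (a + 2 * K) - h = 1 + l + 2 * K"
        "1 + a - e - f - h = 1 + l - e - f"
        by (simp_all add: lh algebra_simps)
      have ***: "1 + (a + 2 * K) = 1 + a + 2 * K"
        by (simp add: algebra_simps)
      show ?thesis unfolding dougall_prod_def unfolding * unfolding ** unfolding *** ..
    qed
    also have "C * \<dots> = pre * (v k * u l e f g k * wp l (- of_nat N) k)"
    proof -
      have p1: "pochhammer (1 + a) (2 * k) * pochhammer (1 + a + 2 * K) M = pochhammer (1 + a) N * pochhammer (1 + a + of_nat N) k"
        using pochhammer_product'[of "1 + a" "2 * k" M] pochhammer_product'[of "1 + a" N k] kN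
        by (simp add: M_def K_def add.commute[of k N])
      have p2: "pochhammer (1 + l) (2 * k) * pochhammer (1 + l + 2 * K) M = pochhammer (1 + l) N * pochhammer (1 + l + of_nat N) k"
        using pochhammer_product'[of "1 + l" "2 * k" M] pochhammer_product'[of "1 + l" N k] kN
        by (simp add: M_def K_def add.commute[of k N])
      have p3: "pochhammer z k * pochhammer (z + K) M = pochhammer z N" for z :: complex
        using pochhammer_product'[of z k M] kN by (simp add: M_def K_def)
      have efI: "1 + a - e - f \<notin> \<int>" "1 + l - e - f \<notin> \<int>"
      proof -
        have "1 + a - e - f = 1 + a - (1 + a + l + of_nat N - g)" "1 + l - e - f = 1 + l - (1 + a + l + of_nat N - g)"
          unfolding bal'[symmetric] by (simp_all add: algebra_simps)
        then show "1 + a - e - f \<notin> \<int>" "1 + l - e - f \<notin> \<int>"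
          using not_Ints_shift[OF nI(12), of "1 + a - e - f"] not_Ints_shift[OF nI(9), of "1 + l - e - f"]
          by auto
      qed
      \<comment> \<open>Symbols of length \<open>N - k\<close> are reversed into symbols of length
        \<open>k\<close>. Balance identifies the reversed parameters, and together with
        \<open>p5\<close> this exchanges the denominator of \<open>1 + a - g\<close> for that of
        \<open>1 + l - g\<close>; the two signs cancel.\<close>
      have p4: "pochhammer (1 + a - e - f) M = (-1) ^ k * pochhammer (1 + a - e - f) N / pochhammer (1 + l - g) k"
      proof -
        have "1 - (1 + a - e - f) - of_nat N = 1 + l - g"
          using bal' by (simp add: algebra_simps)
        then show ?thesis unfolding M_def using pochhammer_diff[OF efI(1) kN] by simp
      qed
      have p5: "pochhammer (1 + l - e - f) M = (-1) ^ k * pochhammer (1 + l - e - f) N / pochhammer (1 + a - g) k"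
      proof -
        have "1 - (1 + l - e - f) - of_nat N = 1 + a - g"
          using bal' by (simp add: algebra_simps)
        then show ?thesis unfolding M_def using pochhammer_diff[OF efI(2) kN] by simp
      qed
      have nz: "pochhammer (1 + a - e) n \<noteq> 0" "pochhammer (1 + a - f) n \<noteq> 0" "pochhammer (1 + a - g) n \<noteq> 0"
          "pochhammer (1 + l - e) n \<noteq> 0" "pochhammer (1 + l - f) n \<noteq> 0" "pochhammer (1 + l - g) n \<noteq> 0"
          "pochhammer (1 + l) n \<noteq> 0" "pochhammer (1 + a + of_nat N) n \<noteq> 0" "pochhammer (1 + l + of_nat N) n \<noteq> 0" for n
        by (rule pochhammer_nz,
            rule not_Ints_shift[OF nI(7)] not_Ints_shift[OF nI(8)] not_Ints_shift[OF nI(9)]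
              not_Ints_shift[OF nI(10)] not_Ints_shift[OF nI(11)] not_Ints_shift[OF nI(12)]
              not_Ints_shift[OF nI(2)] not_Ints_shift[OF nI(1)], simp)+
      have nz2: "pochhammer (1 + l - e - f) N \<noteq> 0" by (rule pochhammer_nz[OF efI(2)])
      have nz3: "pochhammer (1 + a - e + K) M \<noteq> 0" "pochhammer (1 + a - f + K) M \<noteq> 0" "pochhammer (1 + l + 2 * K) M \<noteq> 0"
        by (rule pochhammer_nz, rule not_Ints_shift[OF nI(7)] not_Ints_shift[OF nI(8)] not_Ints_shift[OF nI(2)], use KI in simp)+
      define A1 A2 A3 L1 L2 L3 s where "A1 = pochhammer (1 + a - e) k" "A2 = pochhammer (1 + a - f) k" "A3 = pochhammer (1 + a - g) k"
        "L1 = pochhammer (1 + l - e) k" "L2 = pochhammer (1 + l - f) k" "L3 = pochhammer (1 + l - g) k" "s = (-1 :: complex) ^ k"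
      note dd = this
      define A1' A2' L1' L2' where "A1' = pochhammer (1 + a - e + K) M" "A2' = pochhammer (1 + a - f + K) M" "L1' = pochhammer (1 + l - e + K) M" "L2' = pochhammer (1 + l - f + K) M"
      note dd' = this
      define a2 l2 a2' l2' where "a2 = pochhammer (1 + a) (2 * k)" "l2 = pochhammer (1 + l) (2 * k)" "a2' = pochhammer (1 + a + 2 * K) M" "l2' = pochhammer (1 + l + 2 * K) M"
      note dd2 = this
      define aN lN where "aN = pochhammer (1 + a + of_nat N) k" "lN = pochhammer (1 + l + of_nat N) k"
      note dd3 = this
      define E X Y where "E = pochhammer e k * pochhammer f k * pochhammer g k * pochhammer (- of_nat N) k * v k"
        "X = pochhammer (1 + a - e - f) N" "Y = pochhammer (1 + l - e - f) N"
      note dd4 = this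
      have nzz: "A1 \<noteq> 0" "A2 \<noteq> 0" "A3 \<noteq> 0" "L1 \<noteq> 0" "L2 \<noteq> 0" "L3 \<noteq> 0" "A1' \<noteq> 0" "A2' \<noteq> 0" "l2 \<noteq> 0" "l2' \<noteq> 0" "aN \<noteq> 0" "lN \<noteq> 0" "Y \<noteq> 0" "s \<noteq> 0"
        unfolding dd dd' dd2 dd3 dd4 using nz nz2 nz3 by auto
      have "C * (a2' * (s * X / L3) * L1' * L2' / (A1' * A2' * l2' * (s * Y / A3)))
         = E * (a2 * a2') * X * (L1 * L1') * (L2 * L2') / ((A1 * A1') * (A2 * A2') * (l2 * l2') * Y * aN * L1 * L2 * L3)"
      proof -
        have "C = E / (A1 * A2 * A3 * aN) * (a2 / l2)"
          unfolding C_def u_def wp_def dd dd2 dd3 dd4 by (simp add: mult_ac)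
        then show ?thesis using nzz by (simp add: field_simps)
      qed
      also have "\<dots> = pre * (E / (L1 * L2 * L3 * lN))"
      proof -
        have e1: "a2 * a2' = pochhammer (1 + a) N * aN" "l2 * l2' = pochhammer (1 + l) N * lN"
          unfolding dd2 dd3 using p1 p2 by auto
        have e2: "L1 * L1' = pochhammer (1 + l - e) N" "L2 * L2' = pochhammer (1 + l - f) N"
          "A1 * A1' = pochhammer (1 + a - e) N" "A2 * A2' = pochhammer (1 + a - f) N"
          unfolding dd dd' p3 by auto
        show ?thesis unfolding e1 e2 pre_def using nzz unfolding dd4(2,3) by (simp add: mult_ac)
      qed
      also have "E / (L1 * L2 * L3 * lN) = v k * u l e f g k * wp l (- of_nat N) k"
        unfolding u_def wp_def dd dd3 dd4 by (simp add: mult_ac)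
      finally show ?thesis unfolding p4 p5 dd dd' dd2 dd4 .
    qed
    finally show "(\<Sum>m\<le>N - k. T (k + m) k) = pre * (v k * u l e f g k * wp l (- of_nat N) k)" .
  qed
  also have "\<dots> = pre * (\<Sum>k\<le>N. v k * u l e f g k * wp l (- of_nat N) k)"
    by (simp add: sum_distrib_left)
  finally show ?thesis
    unfolding pre_def v_def u_def by (simp add: mult_ac)
qed

section \<open>Asymptotics of Gamma quotients\<close>

text \<open>Euler's limit for the reciprocal Gamma function, with \<open>exp (z ln n)\<close> as the
  power of \<open>n\<close>. At nonpositive integers the sequence is eventually zero, so upper
  parameters need no exclusion later.\<close>

lemma tendsto_rGamma_pochhammer:
  fixes z :: complex
  shows "(\<lambda>n. pochhammer z n / (fact (n - 1) * exp (z * of_real (ln (of_nat n))))) \<longlonglongrightarrow> rGamma z"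
proof (cases "z \<in> \<int>\<^sub>\<le>\<^sub>0")
  case True
  then obtain k where k: "z = - of_nat k" by (elim nonpos_Ints_cases')
  have "eventually (\<lambda>n. pochhammer z n / (fact (n - 1) * exp (z * of_real (ln (of_nat n)))) = 0) sequentially"
    using eventually_gt_at_top[of k] by eventually_elim (simp add: k pochhammer_of_nat_eq_0_iff)
  moreover have "rGamma z = 0"
    using True by (simp add: rGamma_eq_zero_iff)
  ultimately show ?thesis
    by (simp only: tendsto_eventually)
next
  case False
  then have "Gamma z \<noteq> 0" by (simp add: Gamma_eq_zero_iff)
  from tendsto_inverse[OF Gamma_series'_LIMSEQ this]
  show ?thesis
    by (simp add: Gamma_series'_def[abs_def] field_simps rGamma_inverse_Gamma)
qed

lemma exp_ln_of_nat: "n > 0 \<Longrightarrow> exp (of_real (ln (real n))) = (of_nat n :: complex)"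
  by (simp add: exp_of_real)

lemma prod_list_pochhammer:
  fixes ps :: "complex list"
  shows "(\<Prod>p\<leftarrow>ps. pochhammer p n)
     = (\<Prod>p\<leftarrow>ps. pochhammer p n / (fact (n - 1) * exp (p * of_real (ln (of_nat n)))))
       * (fact (n - 1) ^ length ps * exp (sum_list ps * of_real (ln (of_nat n))))"
  by (induction ps) (auto simp: exp_add distrib_right field_simps)

lemma tendsto_prod_list:
  fixes f :: "'a \<Rightarrow> 'b \<Rightarrow> 'c :: real_normed_field"
  assumes "\<And>p. ((\<lambda>n. f p n) \<longlongrightarrow> g p) F"
  shows "((\<lambda>n. \<Prod>p\<leftarrow>ps. f p n) \<longlongrightarrow> (\<Prod>p\<leftarrow>ps. g p)) F"
  by (induction ps) (auto intro!: tendsto_intros assms)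

text \<open>Equally many symbols above and below make the factorials cancel, and only a power of
  \<open>n\<close> is left. Below it occurs with the exponents 2, 0, -1 and -2.\<close>

lemma pochhammer_ratio_limit:
  fixes ps qs :: "complex list"
  assumes "length ps = length qs" "\<And>q. q \<in> set qs \<Longrightarrow> q \<notin> \<int>\<^sub>\<le>\<^sub>0"
  shows "(\<lambda>n. (\<Prod>p\<leftarrow>ps. pochhammer p n) / (\<Prod>q\<leftarrow>qs. pochhammer q n)
           * exp ((sum_list qs - sum_list ps) * of_real (ln (of_nat n))))
    \<longlonglongrightarrow> (\<Prod>p\<leftarrow>ps. rGamma p) * (\<Prod>q\<leftarrow>qs. Gamma q)"
proof -
  define R where "R = (\<lambda>z n. pochhammer z n / (fact (n - 1) * exp (z * of_real (ln (of_nat n)) :: complex)))"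
  have "(\<Prod>q\<leftarrow>qs. rGamma q) \<noteq> 0"
    using assms(2) by (auto simp: prod_list_zero_iff rGamma_eq_zero_iff)
  then have "(\<lambda>n. (\<Prod>p\<leftarrow>ps. R p n) / (\<Prod>q\<leftarrow>qs. R q n)) \<longlonglongrightarrow> (\<Prod>p\<leftarrow>ps. rGamma p) / (\<Prod>q\<leftarrow>qs. rGamma q)"
    unfolding R_def by (intro tendsto_divide tendsto_prod_list tendsto_rGamma_pochhammer)
  moreover have "(\<Prod>q\<leftarrow>qs. Gamma q) = 1 / (\<Prod>q\<leftarrow>qs. rGamma q)"
    by (induction qs) (auto simp: Gamma_def inverse_eq_divide)
  moreover have "(\<Prod>p\<leftarrow>ps. pochhammer p n) / (\<Prod>q\<leftarrow>qs. pochhammer q n)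
           * exp ((sum_list qs - sum_list ps) * of_real (ln (of_nat n))) = (\<Prod>p\<leftarrow>ps. R p n) / (\<Prod>q\<leftarrow>qs. R q n)" for n
  proof -
    have R: "(\<Prod>p\<leftarrow>ps. pochhammer p n) = (\<Prod>p\<leftarrow>ps. R p n) * (fact (n - 1) ^ length ps * exp (sum_list ps * of_real (ln (of_nat n))))" for ps
      unfolding R_def by (rule prod_list_pochhammer)
    show ?thesis
      unfolding R[of ps] R[of qs] assms(1) by (simp add: left_diff_distrib exp_diff)
  qed
  ultimately show ?thesis by simp
qed

section \<open>Convergence of balanced series at unit argument\<close>

definition hyp4F3_term where
  "hyp4F3_term a b c d e f g n = (pochhammer a n * pochhammer b n * pochhammer c n * pochhammer d n) /
          (fact n * pochhammer e n * pochhammer f n * pochhammer g n :: complex)"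

lemma hyp4F3_at_1_eq: "hyp4F3_at_1 a b c d e f g = (\<Sum>n. hyp4F3_term a b c d e f g n)"
  by (simp add: hyp4F3_at_1_def hyp4F3_term_def)

text \<open>The factorial counts as a symbol with parameter 1, so the lower parameters exceed the
  upper ones by 2 in total and the terms are of order \<open>1 / n ^ 2\<close>.\<close>

lemma summable_hyp4F3:
  assumes bal: "e + f + g = 1 + a + b + c + d" and nz: "e \<notin> \<int>\<^sub>\<le>\<^sub>0" "f \<notin> \<int>\<^sub>\<le>\<^sub>0" "g \<notin> \<int>\<^sub>\<le>\<^sub>0"
  shows "summable (\<lambda>n. norm (hyp4F3_term a b c d e f g n))"
proof -
  have "(\<lambda>n. (\<Prod>p\<leftarrow>[a,b,c,d]. pochhammer p n) / (\<Prod>q\<leftarrow>[1,e,f,g]. pochhammer q n)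
           * exp ((sum_list [1,e,f,g] - sum_list [a,b,c,d]) * of_real (ln (of_nat n))))
    \<longlonglongrightarrow> (\<Prod>p\<leftarrow>[a,b,c,d]. rGamma p) * (\<Prod>q\<leftarrow>[1,e,f,g]. Gamma q)" (is "?t \<longlonglongrightarrow> _")
    by (rule pochhammer_ratio_limit) (use nz in auto)
  then have "Bseq ?t" by (intro convergent_imp_Bseq) (auto simp: convergent_def)
  then obtain K where K: "\<And>n. norm (?t n) \<le> K"
    unfolding Bseq_def by blast
  have e: "sum_list [1,e,f,g] - sum_list [a,b,c,d] = 2"
  proof -
    have "sum_list [1,e,f,g] - sum_list [a,b,c,d] = 1 + (e + f + g) - (a + b + c + d)" by simp
    then show ?thesis unfolding bal by simp
  qed
  have B: "norm (hyp4F3_term a b c d e f g n) \<le> K * (1 / real n ^ 2)" if "n \<ge> 1" for n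
  proof -
    have "exp (2 * of_real (ln (real n))) = (of_nat n :: complex) ^ 2"
      using exp_ln_of_nat[of n] that by (simp add: exp_double)
    then have "?t n = hyp4F3_term a b c d e f g n * of_nat n ^ 2"
      unfolding e by (simp add: hyp4F3_term_def pochhammer_fact mult_ac)
    then have "norm (hyp4F3_term a b c d e f g n) * real n ^ 2 \<le> K"
      using K[of n] by (simp add: norm_mult norm_power)
    then show ?thesis using that by (simp add: field_simps)
  qed
  have "summable (\<lambda>n. K * (1 / real n ^ 2))"
    using inverse_power_summable[of 2, where ?'a = real] by (intro summable_mult) (simp add: inverse_eq_divide)
  then have S: "summable (\<lambda>n. K * (1 / real n ^ 2))" by blast
  show ?thesis
  proof (rule summable_comparison_test'[OF S])
    fix n :: nat
    assume "n \<ge> 1"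
    from B[OF this] show "norm (norm (hyp4F3_term a b c d e f g n)) \<le> K * (1 / real n ^ 2)"
      by (simp only: real_norm_def abs_norm_cancel)
  qed
qed

text \<open>First-order expansions \<open>f = 1 + \<alpha> x + o(x)\<close> along a filter on which \<open>x\<close> tends to \<open>0\<close>.\<close>

lemma expansion_mult:
  fixes f g x :: "'a \<Rightarrow> complex"
  assumes x: "(x \<longlongrightarrow> 0) F" "eventually (\<lambda>i. x i \<noteq> 0) F"
    and f: "((\<lambda>i. (f i - 1) / x i) \<longlongrightarrow> \<alpha>) F" and g: "((\<lambda>i. (g i - 1) / x i) \<longlongrightarrow> \<beta>) F"
  shows "((\<lambda>i. (f i * g i - 1) / x i) \<longlongrightarrow> \<alpha> + \<beta>) F"
proof -
  have "((\<lambda>i. (f i - 1) / x i + (g i - 1) / x i + (f i - 1) / x i * ((g i - 1) / x i) * x i) \<longlongrightarrow> \<alpha> + \<beta> + \<alpha> * \<beta> * 0) F"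
    by (intro tendsto_intros assms)
  moreover have "eventually (\<lambda>i. (f i - 1) / x i + (g i - 1) / x i + (f i - 1) / x i * ((g i - 1) / x i) * x i
      = (f i * g i - 1) / x i) F"
    using x(2) by eventually_elim (simp add: field_simps)
  ultimately have "((\<lambda>i. (f i * g i - 1) / x i) \<longlongrightarrow> \<alpha> + \<beta> + \<alpha> * \<beta> * 0) F"
    by (rule Lim_transform_eventually)
  then show ?thesis by simp
qed

lemma expansion_tendsto_1:
  fixes f x :: "'a \<Rightarrow> complex"
  assumes x: "(x \<longlongrightarrow> 0) F" "eventually (\<lambda>i. x i \<noteq> 0) F" and f: "((\<lambda>i. (f i - 1) / x i) \<longlongrightarrow> \<alpha>) F"
  shows "(f \<longlongrightarrow> 1) F"
proof -
  have "((\<lambda>i. 1 + (f i - 1) / x i * x i) \<longlongrightarrow> 1 + \<alpha> * 0) F"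
    by (intro tendsto_intros assms)
  moreover have "eventually (\<lambda>i. 1 + (f i - 1) / x i * x i = f i) F"
    using x(2) by eventually_elim simp
  ultimately have "(f \<longlongrightarrow> 1 + \<alpha> * 0) F"
    by (rule Lim_transform_eventually)
  then show ?thesis by simp
qed

lemma expansion_quotient:
  fixes p q x :: "'a \<Rightarrow> complex"
  assumes x: "(x \<longlongrightarrow> 0) F" "eventually (\<lambda>i. x i \<noteq> 0) F" and p: "(p \<longlongrightarrow> \<alpha>) F" and q: "(q \<longlongrightarrow> \<beta>) F"
  shows "((\<lambda>i. ((1 + p i * x i) / (1 + q i * x i) - 1) / x i) \<longlongrightarrow> \<alpha> - \<beta>) F"
proof -
  have q1: "((\<lambda>i. 1 + q i * x i) \<longlongrightarrow> 1 + \<beta> * 0) F"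
    by (intro tendsto_intros assms)
  then have ev: "eventually (\<lambda>i. 1 + q i * x i \<noteq> 0) F"
    by (auto intro: tendsto_imp_eventually_ne[where c = 1])
  have "((\<lambda>i. (p i - q i) / (1 + q i * x i)) \<longlongrightarrow> (\<alpha> - \<beta>) / (1 + \<beta> * 0)) F"
    using q1 by (intro tendsto_intros assms) auto
  moreover have "eventually (\<lambda>i. (p i - q i) / (1 + q i * x i) = ((1 + p i * x i) / (1 + q i * x i) - 1) / x i) F"
    using x(2) ev
  proof eventually_elim
    case (elim i)
    have "(1 + p i * x i) / (1 + q i * x i) - 1 = (p i - q i) / (1 + q i * x i) * x i"
      using elim(2) by (simp add: diff_divide_eq_iff divide_diff_eq_iff left_diff_distrib)
    then show ?case using elim(1) by simp
  qed
  ultimately have "((\<lambda>i. ((1 + p i * x i) / (1 + q i * x i) - 1) / x i) \<longlongrightarrow> (\<alpha> - \<beta>) / (1 + \<beta> * 0)) F"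
    by (rule Lim_transform_eventually)
  then show ?thesis by simp
qed

text \<open>Here \<open>1 / x\<close> plays the role of the summation index. The offsets may vary
  along the filter: constant ones serve limits in the index alone, variable ones the joint limit in
  index and parameters in \<open>hyp4F3_at_1_tendsto\<close>.\<close>

lemma expansion_quotient4:
  fixes x :: "'a \<Rightarrow> complex"
  assumes x: "(x \<longlongrightarrow> 0) F" "eventually (\<lambda>i. x i \<noteq> 0) F"
    and p: "(u1 \<longlongrightarrow> \<alpha>1) F" "(u2 \<longlongrightarrow> \<alpha>2) F" "(u3 \<longlongrightarrow> \<alpha>3) F" "(u4 \<longlongrightarrow> \<alpha>4) F"
    and q: "(v1 \<longlongrightarrow> \<beta>1) F" "(v2 \<longlongrightarrow> \<beta>2) F" "(v3 \<longlongrightarrow> \<beta>3) F" "(v4 \<longlongrightarrow> \<beta>4) F"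
    and s: "\<alpha>1 + \<alpha>2 + \<alpha>3 + \<alpha>4 - (\<beta>1 + \<beta>2 + \<beta>3 + \<beta>4) = \<sigma>"
  shows "((\<lambda>i. (((1 / x i + u1 i) * (1 / x i + u2 i) * (1 / x i + u3 i) * (1 / x i + u4 i)) /
      ((1 / x i + v1 i) * (1 / x i + v2 i) * (1 / x i + v3 i) * (1 / x i + v4 i)) - 1) / x i) \<longlongrightarrow> \<sigma>) F"
proof -
  define Q where "Q = (\<lambda>p q i. (1 + p i * x i) / (1 + q i * x i))"
  have "((\<lambda>i. (Q u1 v1 i * Q u2 v2 i * Q u3 v3 i * Q u4 v4 i - 1) / x i) \<longlongrightarrow>
     (\<alpha>1 - \<beta>1) + (\<alpha>2 - \<beta>2) + (\<alpha>3 - \<beta>3) + (\<alpha>4 - \<beta>4)) F"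
    unfolding Q_def by (intro expansion_mult x expansion_quotient p q)
  moreover have ev: "eventually (\<lambda>i. Q u1 v1 i * Q u2 v2 i * Q u3 v3 i * Q u4 v4 i =
     ((1 / x i + u1 i) * (1 / x i + u2 i) * (1 / x i + u3 i) * (1 / x i + u4 i)) /
      ((1 / x i + v1 i) * (1 / x i + v2 i) * (1 / x i + v3 i) * (1 / x i + v4 i))) F"
    using x(2)
  proof eventually_elim
    case (elim i)
    have "1 / x i + p = (1 + p * x i) / x i" for p using elim by (simp add: field_simps)
    then show ?case using elim by (simp add: Q_def)
  qed
  then have "eventually (\<lambda>i. (Q u1 v1 i * Q u2 v2 i * Q u3 v3 i * Q u4 v4 i - 1) / x i =
     (((1 / x i + u1 i) * (1 / x i + u2 i) * (1 / x i + u3 i) * (1 / x i + u4 i)) /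
      ((1 / x i + v1 i) * (1 / x i + v2 i) * (1 / x i + v3 i) * (1 / x i + v4 i)) - 1) / x i) F"
    by eventually_elim (simp only:)
  ultimately have "((\<lambda>i. (((1 / x i + u1 i) * (1 / x i + u2 i) * (1 / x i + u3 i) * (1 / x i + u4 i)) /
      ((1 / x i + v1 i) * (1 / x i + v2 i) * (1 / x i + v3 i) * (1 / x i + v4 i)) - 1) / x i) \<longlongrightarrow>
     (\<alpha>1 - \<beta>1) + (\<alpha>2 - \<beta>2) + (\<alpha>3 - \<beta>3) + (\<alpha>4 - \<beta>4)) F"
    by (rule Lim_transform_eventually)
  moreover have "(\<alpha>1 - \<beta>1) + (\<alpha>2 - \<beta>2) + (\<alpha>3 - \<beta>3) + (\<alpha>4 - \<beta>4) = \<sigma>"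
    using s by (simp add: algebra_simps)
  ultimately show ?thesis by (simp only:)
qed

section \<open>Limits of terminating series\<close>

text \<open>A terminating very well poised \<open>9F8\<close> term. The partners of
  \<open>A + 1 - e\<close>, \<open>A + 1 - f\<close> and \<open>- N\<close> are \<open>e\<close>,
  \<open>f\<close> and \<open>g\<close> for every \<open>N\<close>, whereas those of
  \<open>a, b, c, d\<close> move to infinity together with \<open>A\<close>.\<close>

definition bailey_term :: "complex \<Rightarrow> complex \<Rightarrow> complex \<Rightarrow> complex \<Rightarrow> complex \<Rightarrow> complex \<Rightarrow> complex \<Rightarrow> nat \<Rightarrow> nat \<Rightarrow> complex" where
  "bailey_term a b c d e f g N n =
     (let A = g - 1 - of_nat N
      in vwp A n * wp A a n * wp A b n * wp A c n * wp A d n * wp A (A + 1 - e) n * wp A (A + 1 - f) n * wp A (- of_nat N) n)"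

text \<open>One linear factor of each of the eight symbols whose parameters depend on
  \<open>N\<close>, with the signs removed. Evaluated at \<open>q = N - k\<close> it no longer
  depends on \<open>N\<close> otherwise, so one asymptotic expansion in \<open>q\<close> serves all
  \<open>N\<close>.\<close>

definition bailey_factor :: "complex \<Rightarrow> complex \<Rightarrow> complex \<Rightarrow> complex \<Rightarrow> complex \<Rightarrow> complex \<Rightarrow> complex \<Rightarrow> nat \<Rightarrow> complex" where
  "bailey_factor a b c d e f g q =
     ((of_nat q + (1 - g)) * (of_nat q + (e - g)) * (of_nat q + (f - g)) * (of_nat q + 0))
     / ((of_nat q + (a - g)) * (of_nat q + (b - g)) * (of_nat q + (c - g)) * (of_nat q + (d - g)))"

lemma bailey_term_eq:
  assumes "n \<le> N"
  shows "bailey_term a b c d e f g N n = hyp4F3_term a b c d e f g n *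
    (((g - 1 - of_nat N) + 2 * of_nat n) / (g - 1 - of_nat N) * (\<Prod>k<n. bailey_factor a b c d e f g (N - k)))"
proof -
  define A where "A = g - 1 - of_nat N"
  have 1: "1 + A - (A + 1 - e) = e" "1 + A - (A + 1 - f) = f" "1 + A - (- of_nat N) = g"
    by (simp_all add: A_def)
  have pr: "(\<Prod>k<n. bailey_factor a b c d e f g (N - k)) =
     (pochhammer A n * pochhammer (A + 1 - e) n * pochhammer (A + 1 - f) n * pochhammer (- of_nat N) n)
     / (pochhammer (1 + A - a) n * pochhammer (1 + A - b) n * pochhammer (1 + A - c) n * pochhammer (1 + A - d) n)"
    unfolding pochhammer_prod atLeast0LessThan prod.distrib[symmetric] prod_dividef[symmetric]
  proof (rule prod.cong[OF refl])
    fix k assume "k \<in> {..<n}"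
    then have q: "of_nat (N - k) = (of_nat N - of_nat k :: complex)"
      using assms by (simp add: of_nat_diff)
    have m: "(A + of_nat k) = - (of_nat (N - k) + (1 - g))" "A + 1 - e + of_nat k = - (of_nat (N - k) + (e - g))"
      "A + 1 - f + of_nat k = - (of_nat (N - k) + (f - g))" "- of_nat N + of_nat k = - (of_nat (N - k) + 0 :: complex)"
      "1 + A - a + of_nat k = - (of_nat (N - k) + (a - g))" "1 + A - b + of_nat k = - (of_nat (N - k) + (b - g))"
      "1 + A - c + of_nat k = - (of_nat (N - k) + (c - g))" "1 + A - d + of_nat k = - (of_nat (N - k) + (d - g))"
      unfolding q by (simp_all add: A_def)
    show "bailey_factor a b c d e f g (N - k) = (A + of_nat k) * (A + 1 - e + of_nat k) * (A + 1 - f + of_nat k) * (- of_nat N + of_nat k)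
       / ((1 + A - a + of_nat k) * (1 + A - b + of_nat k) * (1 + A - c + of_nat k) * (1 + A - d + of_nat k))"
      unfolding m bailey_factor_def by (simp only: minus_mult_minus mult_minus_left mult_minus_right minus_minus)
  qed
  show ?thesis
    unfolding pr A_def[symmetric] unfolding bailey_term_def Let_def A_def[symmetric] vwp_def wp_def 1 hyp4F3_term_def
    by (simp add: mult_ac)
qed

lemma bailey_factor_expansion:
  assumes bal: "e + f + g = 1 + a + b + c + d"
  shows "((\<lambda>q. (bailey_factor a b c d e f g q - 1) / (1 / of_nat q)) \<longlongrightarrow> 2) sequentially"
proof -
  have "((\<lambda>q. (((1 / (1 / of_nat q) + (1 - g)) * (1 / (1 / of_nat q) + (e - g)) * (1 / (1 / of_nat q) + (f - g)) * (1 / (1 / of_nat q) + 0))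
     / ((1 / (1 / of_nat q) + (a - g)) * (1 / (1 / of_nat q) + (b - g)) * (1 / (1 / of_nat q) + (c - g)) * (1 / (1 / of_nat q) + (d - g))) - 1) / (1 / of_nat q)) \<longlongrightarrow> 2) sequentially"
  proof (rule expansion_quotient4)
    show "((\<lambda>q. 1 / of_nat q :: complex) \<longlongrightarrow> 0) sequentially" by (rule lim_1_over_n)
    show "eventually (\<lambda>q. 1 / of_nat q \<noteq> (0 :: complex)) sequentially"
      using eventually_gt_at_top[of 0] by eventually_elim simp
    have "(1 - g) + (e - g) + (f - g) + 0 - ((a - g) + (b - g) + (c - g) + (d - g)) = 1 + (e + f + g) - (a + b + c + d)"
      by simp
    then show "(1 - g) + (e - g) + (f - g) + 0 - ((a - g) + (b - g) + (c - g) + (d - g)) = 2"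
      unfolding bal by simp
  qed (rule tendsto_const)+
  then show ?thesis
    by (simp only: bailey_factor_def div_by_1 divide_divide_eq_right mult_1)
qed

lemma bailey_factor_tendsto_1:
  assumes bal: "e + f + g = 1 + a + b + c + d"
  shows "bailey_factor a b c d e f g \<longlonglongrightarrow> 1"
proof (rule expansion_tendsto_1[OF lim_1_over_n _ bailey_factor_expansion[OF bal]])
  show "eventually (\<lambda>q. 1 / of_nat q \<noteq> (0 :: complex)) sequentially"
    using eventually_gt_at_top[of 0] by eventually_elim simp
qed

lemma bailey_factor_bound:
  assumes bal: "e + f + g = 1 + a + b + c + d"
  obtains Q where "\<And>q. q \<ge> Q \<Longrightarrow> norm (bailey_factor a b c d e f g q) \<le> 1 + 3 / real q"
proof -
  have "eventually (\<lambda>q. norm ((bailey_factor a b c d e f g q - 1) / (1 / of_nat q)) < 3) sequentially"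
    using tendsto_norm[OF bailey_factor_expansion[OF bal]] by (rule order_tendstoD) simp
  then have "eventually (\<lambda>q. norm (bailey_factor a b c d e f g q) \<le> 1 + 3 / real q) sequentially"
    using eventually_gt_at_top[of 0]
  proof eventually_elim
    case (elim q)
    then have "norm (bailey_factor a b c d e f g q - 1) < 3 / real q"
      by (simp only: divide_divide_eq_right norm_divide norm_mult norm_of_nat div_by_1) (simp add: field_simps)
    then show ?case
      using norm_triangle_sub[of "bailey_factor a b c d e f g q" 1] by simp
  qed
  then show ?thesis
    using that by (auto simp: eventually_at_top_linorder)
qed

text \<open>For \<open>n \<le> M\<close> only factors of index above \<open>M\<close> occur. Their
  expansion is \<open>1 + 2 / q\<close>, so eventually they are at most \<open>1 + 3 / q\<close>,
  and a product of at most \<open>M\<close> of them is at most \<open>exp 3\<close>. The constant 5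
  is a generous bound for the very well poised factor. The argument covers the first half of the
  terms; the second half is treated by reversal.\<close>

lemma bailey_term_bound:
  assumes bal: "e + f + g = 1 + a + b + c + d"
  obtains M0 where "\<And>M n. M \<ge> M0 \<Longrightarrow> n \<le> M \<Longrightarrow>
     norm (bailey_term a b c d e f g (2 * M + 1) n) \<le> 5 * exp 3 * norm (hyp4F3_term a b c d e f g n)"
proof -
  obtain Q where Q: "\<And>q. q \<ge> Q \<Longrightarrow> norm (bailey_factor a b c d e f g q) \<le> 1 + 3 / real q"
    using bailey_factor_bound[OF bal] by blast
  obtain R where R: "real R \<ge> norm (g - 1)" using real_arch_simple by blast
  show ?thesis
  proof (rule that[of "max Q R"])
    fix M n assume M: "M \<ge> max Q R" and n: "n \<le> M"
    define N where "N = 2 * M + 1"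
    define A where "A = g - 1 - of_nat N"
    have "g - 1 - A = of_nat N" by (simp add: A_def)
    then have "real N \<le> norm A + norm (g - 1)"
      using norm_triangle_ineq4[of "g - 1" A] by (metis add.commute norm_of_nat)
    moreover have "norm (g - 1) \<le> real M" using R M by linarith
    ultimately have A: "norm A \<ge> real M + 1" by (simp add: N_def)
    have "(A + 2 * of_nat n) / A = 1 + 2 * of_nat n / A"
      using A by (auto simp: add_divide_distrib)
    then have "norm ((A + 2 * of_nat n) / A) \<le> 1 + 2 * real n / norm A"
      using norm_triangle_ineq[of 1 "2 * of_nat n / A"] by (simp add: norm_divide norm_mult)
    also have "2 * real n / norm A \<le> 2"
      using A n by (subst divide_le_eq) (auto simp: not_less)
    finally have b1: "norm ((A + 2 * of_nat n) / A) \<le> 5" by simp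
    have "norm (\<Prod>k<n. bailey_factor a b c d e f g (N - k)) \<le> (\<Prod>k<n. 1 + 3 / (real M + 1))"
      unfolding prod_norm[symmetric]
    proof (rule prod_mono)
      fix k assume k: "k \<in> {..<n}"
      then have q: "N - k \<ge> M + 1" using n by (auto simp: N_def)
      then have "norm (bailey_factor a b c d e f g (N - k)) \<le> 1 + 3 / real (N - k)"
        using M by (intro Q) auto
      also have "3 / real (N - k) \<le> 3 / (real M + 1)"
        using q by (intro divide_left_mono) auto
      finally show "0 \<le> norm (bailey_factor a b c d e f g (N - k)) \<and> norm (bailey_factor a b c d e f g (N - k)) \<le> 1 + 3 / (real M + 1)"
        by simp
    qed
    also have "\<dots> = (1 + 3 / (real M + 1)) ^ n" by simp
    also have "\<dots> \<le> exp (3 / (real M + 1)) ^ n"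
      by (intro power_mono exp_ge_add_one_self) auto
    also have "\<dots> = exp (real n * (3 / (real M + 1)))"
      by (rule exp_of_nat_mult[symmetric])
    also have "\<dots> \<le> exp 3"
      using n by (simp add: field_simps)
    finally have b2: "norm (\<Prod>k<n. bailey_factor a b c d e f g (N - k)) \<le> exp 3" .
    have nN: "n \<le> N" using n by (simp add: N_def)
    have "norm (bailey_term a b c d e f g N n) = norm (hyp4F3_term a b c d e f g n) *
       (norm ((A + 2 * of_nat n) / A) * norm (\<Prod>k<n. bailey_factor a b c d e f g (N - k)))"
      unfolding A_def by (simp only: bailey_term_eq[OF nN] norm_mult)
    also have "\<dots> \<le> norm (hyp4F3_term a b c d e f g n) * (5 * exp 3)"
      by (intro mult_left_mono mult_mono b1 b2) auto
    finally show "norm (bailey_term a b c d e f g (2 * M + 1) n) \<le> 5 * exp 3 * norm (hyp4F3_term a b c d e f g n)"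
      by (simp add: N_def mult_ac)
  qed
qed

lemma bailey_half_limit:
  assumes bal: "e + f + g = 1 + a + b + c + d" and nz: "e \<notin> \<int>\<^sub>\<le>\<^sub>0" "f \<notin> \<int>\<^sub>\<le>\<^sub>0" "g \<notin> \<int>\<^sub>\<le>\<^sub>0"
  shows "(\<lambda>M. \<Sum>n\<le>M. bailey_term a b c d e f g (2 * M + 1) n) \<longlonglongrightarrow> hyp4F3_at_1 a b c d e f g"
proof -
  \<comment> \<open>Terms of the second half are replaced by 0, which turns the half sums into full
    series as Tannery's theorem requires.\<close>
  define t where "t = (\<lambda>n M. if n \<le> M then bailey_term a b c d e f g (2 * M + 1) n else 0)"
  define h where "h = hyp4F3_term a b c d e f g"
  obtain M0 where M0: "\<And>M n. M \<ge> M0 \<Longrightarrow> n \<le> M \<Longrightarrow> norm (bailey_term a b c d e f g (2 * M + 1) n) \<le> 5 * exp 3 * norm (h n)"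
    using bailey_term_bound[OF bal] unfolding h_def by blast
  have lim: "(\<lambda>M. t n M) \<longlonglongrightarrow> h n" for n
  proof -
    have s: "filterlim (\<lambda>M. 2 * M + 1 - k) sequentially sequentially" for k :: nat
      by (rule filterlim_at_top_mono[where f = "\<lambda>M. M - k"])
         (auto intro: filterlim_minus_const_nat_at_top always_eventually)
    have "(\<lambda>M. bailey_factor a b c d e f g (2 * M + 1 - k)) \<longlonglongrightarrow> 1" for k
      by (rule filterlim_compose[OF bailey_factor_tendsto_1[OF bal] s])
    then have p: "(\<lambda>M. \<Prod>k<n. bailey_factor a b c d e f g (2 * M + 1 - k)) \<longlonglongrightarrow> (\<Prod>k<n. 1)"
      by (intro tendsto_prod)
    have "filterlim (\<lambda>M. g - 1 - of_nat (2 * M + 1)) at_infinity sequentially"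
    proof -
      have "filterlim (\<lambda>M. of_nat (2 * M + 1) :: complex) at_infinity sequentially"
        by (rule filterlim_compose[OF tendsto_of_nat]) (use s[of 0] in simp)
      then have "filterlim (\<lambda>M. (g - 1) + - of_nat (2 * M + 1)) at_infinity sequentially"
        by (intro tendsto_add_filterlim_at_infinity[OF tendsto_const])
           (simp add: filterlim_at_infinity_conv_norm_at_top norm_minus_cancel del: of_nat_add of_nat_mult of_nat_Suc)
      then show ?thesis by simp
    qed
    note inf = this
    have "(\<lambda>M. 1 + 2 * of_nat n / (g - 1 - of_nat (2 * M + 1))) \<longlonglongrightarrow> 1 + 0"
      by (intro tendsto_add tendsto_const tendsto_divide_0[OF tendsto_const inf])
    moreover have "eventually (\<lambda>M. 1 + 2 * of_nat n / (g - 1 - of_nat (2 * M + 1)) =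
        (g - 1 - of_nat (2 * M + 1) + 2 * of_nat n) / (g - 1 - of_nat (2 * M + 1))) sequentially"
      using filterlim_at_infinity_imp_eventually_ne[OF inf, of 0]
      by eventually_elim (simp add: add_divide_distrib del: of_nat_add of_nat_mult of_nat_Suc)
    ultimately have A: "(\<lambda>M. (g - 1 - of_nat (2 * M + 1) + 2 * of_nat n) / (g - 1 - of_nat (2 * M + 1))) \<longlonglongrightarrow> 1 + 0"
      by (rule Lim_transform_eventually)
    have "(\<lambda>M. h n * ((g - 1 - of_nat (2 * M + 1) + 2 * of_nat n) / (g - 1 - of_nat (2 * M + 1)) *
        (\<Prod>k<n. bailey_factor a b c d e f g (2 * M + 1 - k)))) \<longlonglongrightarrow> h n * ((1 + 0) * (\<Prod>k<n. 1))"
      by (intro tendsto_mult tendsto_const A p)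
    moreover have "eventually (\<lambda>M. h n * ((g - 1 - of_nat (2 * M + 1) + 2 * of_nat n) / (g - 1 - of_nat (2 * M + 1)) *
        (\<Prod>k<n. bailey_factor a b c d e f g (2 * M + 1 - k))) = t n M) sequentially"
      using eventually_ge_at_top[of n]
      by eventually_elim (simp add: t_def bailey_term_eq h_def)
    ultimately have "t n \<longlonglongrightarrow> h n * ((1 + 0) * (\<Prod>k<n. 1))"
      by (rule Lim_transform_eventually)
    then show ?thesis by simp
  qed
  have bd: "eventually (\<lambda>(n, M). norm (t n M) \<le> 5 * exp 3 * norm (h n)) (at_top \<times>\<^sub>F sequentially)"
  proof -
    have "eventually (\<lambda>(n :: nat, M). M \<ge> M0) (at_top \<times>\<^sub>F sequentially)"
      by (subst eventually_prod2) (auto simp: eventually_ge_at_top)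
    then show ?thesis
      by eventually_elim (use M0 in \<open>auto simp: t_def\<close>)
  qed
  have sm: "summable (\<lambda>n. 5 * exp 3 * norm (h n))"
    unfolding h_def by (intro summable_mult summable_hyp4F3 bal nz)
  have "(\<lambda>M. \<Sum>n. t n M) \<longlonglongrightarrow> suminf h"
    using tannerys_theorem[OF lim bd sm] by auto
  moreover have "(\<Sum>n. t n M) = (\<Sum>n\<le>M. bailey_term a b c d e f g (2 * M + 1) n)" for M
  proof -
    have "(\<Sum>n. t n M) = (\<Sum>n\<le>M. t n M)"
      by (rule suminf_finite) (auto simp: t_def)
    then show ?thesis by (simp add: t_def)
  qed
  ultimately show ?thesis
    by (simp add: hyp4F3_at_1_eq h_def)
qed

section \<open>Reversal of the terminating series and the limit of the whole sum\<close>

lemma wp_reverse: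
  assumes "p \<notin> \<int>" "A - p \<notin> \<int>" "m \<le> N"
  shows "wp A p (N - m) = wp A p N * wp (- A - 2 * of_nat N) (p - A - of_nat N) m"
proof -
  have I: "1 + A - p \<notin> \<int>" by (rule not_Ints_shift[OF assms(2)]) simp
  have 1: "1 - (1 + A - p) - of_nat N = p - A - of_nat N" 
    "1 + (- A - 2 * of_nat N) - (p - A - of_nat N) = 1 - p - of_nat N" by (simp_all)
  show ?thesis
    unfolding wp_def 1 pochhammer_diff[OF assms(1,3)] pochhammer_diff[OF I assms(3)] by simp
qed

text \<open>The two factors have to be reversed jointly: \<open>fact (N - m)\<close> in the first
  becomes the symbol of \<open>- N\<close> in the reversed second factor. The linear factor only
  changes sign, since \<open>A + 2 (N - m) = - (A' + 2 m)\<close> for the new base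
  \<open>A'\<close>.\<close>

lemma vwp_reverse:
  assumes A: "A \<notin> \<int>" and m: "m \<le> N"
  shows "vwp A (N - m) * wp A (- of_nat N) (N - m) = vwp A N * wp A (- of_nat N) N *
    (vwp (- A - 2 * of_nat N) m * wp (- A - 2 * of_nat N) (- of_nat N) m)"
proof -
  define A' where "A' = - A - 2 * of_nat N"
  have I: "1 + A + of_nat N \<notin> \<int>" by (rule not_Ints_shift[OF A]) simp
  have nz: "A \<noteq> 0" "A' \<noteq> 0"
    using A not_Ints_nz[OF not_Ints_shift[OF A, of A']] by (auto simp: A'_def)
  have 1: "1 - (1 + A + of_nat N) - of_nat N = A'" "1 - A - of_nat N = 1 + A' + of_nat N"
    by (simp_all add: A'_def)
  define X where "X = A' + 2 * of_nat m"
  have 2: "A + 2 * of_nat (N - m) = - X" "A + 2 * of_nat N = - A'"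
    using m by (simp_all add: A'_def X_def of_nat_diff)
  have 7: "(-1) ^ m = (1 :: complex) \<or> (-1) ^ m = (-1 :: complex)"
    by (cases "even m") auto
  have 3: "pochhammer (- of_nat N :: complex) (N - m) = (-1) ^ (N - m) * fact N / fact m"
    using pochhammer_minus_of_nat[of "N - m" N] m by simp
  have 4: "pochhammer (- of_nat N :: complex) m = (-1) ^ m * fact N / fact (N - m)"
    using pochhammer_minus_of_nat[of m N] m by simp
  have 5: "pochhammer (- of_nat N :: complex) N = (-1) ^ N * fact N"
    using pochhammer_minus_of_nat[of N N] by simp
  have 6: "(-1) ^ N = (-1) ^ (N - m) * ((-1) ^ m :: complex)"
    using m by (simp flip: power_add)
  show ?thesis
    unfolding A'_def[symmetric] vwp_def wp_def diff_minus_eq_add 2 3 4 5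
      pochhammer_diff[OF A m] pochhammer_diff[OF I m] 1 6
    unfolding X_def[symmetric] using nz 7 by (elim disjE) (simp_all add: mult_ac)
qed

text \<open>The reversed base \<open>- A - 2 N\<close> equals \<open>(2 - g) - 1 - N\<close>, so the
  reversed series has the same shape with all parameters translated by \<open>1 - g\<close> and the
  roles of \<open>1\<close> and \<open>g\<close> exchanged. The upper half of the sum thus becomes a
  lower half for the exponent \<open>1 - g\<close>.\<close>

lemma bailey_term_reverse:
  assumes nI: "a \<notin> \<int>" "b \<notin> \<int>" "c \<notin> \<int>" "d \<notin> \<int>" "e \<notin> \<int>" "f \<notin> \<int>" "g \<notin> \<int>"
    "g - a \<notin> \<int>" "g - b \<notin> \<int>" "g - c \<notin> \<int>" "g - d \<notin> \<int>" "g - e \<notin> \<int>" "g - f \<notin> \<int>" and m: "m \<le> N"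
  shows "bailey_term a b c d e f g N (N - m) = bailey_term a b c d e f g N N *
     bailey_term (1 + a - g) (1 + b - g) (1 + c - g) (1 + d - g) (1 + e - g) (1 + f - g) (2 - g) N m"
proof -
  define A where "A = g - 1 - of_nat N"
  define A' where "A' = - A - 2 * of_nat N"
  have A': "2 - g - 1 - of_nat N = A'" by (simp add: A'_def A_def)
  have I: "A \<notin> \<int>" by (rule not_Ints_shift[OF nI(7)]) (simp add: A_def)
  have r: "wp A p (N - m) = wp A p N * wp A' (1 + p - g) m" if "p \<notin> \<int>" "g - p \<notin> \<int>" for p
  proof -
    have "A - p \<notin> \<int>" by (rule not_Ints_shift[OF that(2)]) (simp add: A_def)
    then show ?thesis
      using wp_reverse[OF that(1) _ m, of A] by (simp add: A'_def A_def algebra_simps)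
  qed
  have r': "wp A (A + 1 - p) (N - m) = wp A (A + 1 - p) N * wp A' (A' + 1 - (1 + p - g)) m" if "p \<notin> \<int>" "g - p \<notin> \<int>" for p
  proof -
    have "A - (A + 1 - p) \<notin> \<int>" by (rule not_Ints_shift[OF that(1)]) simp
    moreover have "A + 1 - p \<notin> \<int>" by (rule not_Ints_shift[OF that(2)]) (simp add: A_def)
    moreover have "A + 1 - p - A - of_nat N = A' + 1 - (1 + p - g)" by (simp add: A'_def A_def)
    ultimately show ?thesis
      using wp_reverse[OF _ _ m, of "A + 1 - p" A] by (simp only: A'_def not_False_eq_True simp_thms)
  qed
  have v: "vwp A (N - m) * wp A (- of_nat N) (N - m) = vwp A N * wp A (- of_nat N) N * (vwp A' m * wp A' (- of_nat N) m)"
    unfolding A'_def by (rule vwp_reverse[OF I m])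
  have s: "bailey_term a b c d e f g N n = (vwp A n * wp A (- of_nat N) n) * (wp A a n * wp A b n * wp A c n * wp A d n * wp A (A + 1 - e) n * wp A (A + 1 - f) n)" for n
    unfolding bailey_term_def Let_def A_def by (simp only: mult_ac)
  show ?thesis
    unfolding s unfolding v r[OF nI(1,8)] r[OF nI(2,9)] r[OF nI(3,10)] r[OF nI(4,11)] r'[OF nI(5,12)] r'[OF nI(6,13)]
    unfolding bailey_term_def Let_def A' by (simp only: mult_ac)
qed

lemma not_nonpos_Ints: "z \<notin> \<int> \<Longrightarrow> z \<notin> \<int>\<^sub>\<le>\<^sub>0"
  by (auto dest: nonpos_Ints_Int)

lemma Gamma_nz: "z \<notin> \<int> \<Longrightarrow> Gamma z \<noteq> (0 :: complex)"
  by (auto simp: Gamma_eq_zero_iff not_nonpos_Ints)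

text \<open>The limit of the complete terminating sum: the lower half gives the first series, the
  reversed upper half the second. The Gamma quotient subtracted with it is minus the limit of the
  last term.\<close>

definition hyp4F3_pair :: "complex \<Rightarrow> complex \<Rightarrow> complex \<Rightarrow> complex \<Rightarrow> complex \<Rightarrow> complex \<Rightarrow> complex \<Rightarrow> complex" where
  "hyp4F3_pair a b c d e f g = hyp4F3_at_1 a b c d e f g
     - Gamma e * Gamma f * Gamma g * Gamma (1 + a - g) * Gamma (1 + b - g) * Gamma (1 + c - g) * Gamma (1 + d - g)
       / (Gamma (2 - g) * Gamma (1 + e - g) * Gamma (1 + f - g) * Gamma a * Gamma b * Gamma c * Gamma d)
       * hyp4F3_at_1 (1 + a - g) (1 + b - g) (1 + c - g) (1 + d - g) (1 + e - g) (1 + f - g) (2 - g)"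

lemma pochhammer_reflect':
  fixes z w :: complex
  assumes "z = 1 - w - of_nat n"
  shows "pochhammer z n = (-1) ^ n * pochhammer w n"
  using pochhammer_reflect[of w n] assms by simp

text \<open>By balance the powers of \<open>N\<close> cancel, so the last term does not die out. The
  sign comes from the linear factor, as \<open>(A + 2 N) / A\<close> tends to
  \<open>-1\<close>.\<close>

lemma bailey_last_term:
  assumes bal: "e + f + g = 1 + a + b + c + d"
    and nI: "a \<notin> \<int>" "b \<notin> \<int>" "c \<notin> \<int>" "d \<notin> \<int>" "e \<notin> \<int>" "f \<notin> \<int>" "g \<notin> \<int>"
      "g - a \<notin> \<int>" "g - b \<notin> \<int>" "g - c \<notin> \<int>" "g - d \<notin> \<int>" "g - e \<notin> \<int>" "g - f \<notin> \<int>"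
  shows "(\<lambda>N. bailey_term a b c d e f g N N) \<longlonglongrightarrow>
     - (Gamma e * Gamma f * Gamma g * Gamma (1 + a - g) * Gamma (1 + b - g) * Gamma (1 + c - g) * Gamma (1 + d - g)
       / (Gamma (2 - g) * Gamma (1 + e - g) * Gamma (1 + f - g) * Gamma a * Gamma b * Gamma c * Gamma d))"
proof -
  define ps where "ps = [2 - g, 1 + e - g, 1 + f - g, a, b, c, d]"
  define qs where "qs = [e, f, g, 1 + a - g, 1 + b - g, 1 + c - g, 1 + d - g]"
  define r where "r = (\<lambda>N. (\<Prod>p\<leftarrow>ps. pochhammer p N) / (\<Prod>q\<leftarrow>qs. pochhammer q N))"
  have sub: "1 + z - g \<notin> \<int>" if "g - z \<notin> \<int>" for z
    by (rule not_Ints_shift[OF that]) simp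
  have g2: "2 - g \<notin> \<int>" by (rule not_Ints_shift[OF nI(7)]) simp
  have sums: "sum_list qs - sum_list ps = 0"
    using bal by (simp add: ps_def qs_def algebra_simps)
  have "(\<lambda>N. r N * exp ((sum_list qs - sum_list ps) * of_real (ln (of_nat N))))
      \<longlonglongrightarrow> (\<Prod>p\<leftarrow>ps. rGamma p) * (\<Prod>q\<leftarrow>qs. Gamma q)"
    unfolding r_def
    by (rule pochhammer_ratio_limit)
       (use nI sub[OF nI(8)] sub[OF nI(9)] sub[OF nI(10)] sub[OF nI(11)] in \<open>auto simp: ps_def qs_def not_nonpos_Ints\<close>)
  then have r: "r \<longlonglongrightarrow> (\<Prod>p\<leftarrow>ps. rGamma p) * (\<Prod>q\<leftarrow>qs. Gamma q)"
    unfolding sums by simp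
  have b: "bailey_term a b c d e f g N N = (g - 1 - of_nat N + 2 * of_nat N) / (g - 1 - of_nat N) * r N" for N
  proof -
    define A where "A = g - 1 - of_nat N"
    define s where "s = (-1 :: complex) ^ N"
    have s: "s * s = 1" by (simp add: s_def power_mult_distrib[symmetric])
    then have s0: "s \<noteq> 0" by auto
    have "pochhammer A N = s * pochhammer (2 - g) N"
      "pochhammer (A + 1 - e) N = s * pochhammer (1 + e - g) N"
      "pochhammer (A + 1 - f) N = s * pochhammer (1 + f - g) N"
      "pochhammer (1 + A - a) N = s * pochhammer (1 + a - g) N"
      "pochhammer (1 + A - b) N = s * pochhammer (1 + b - g) N"
      "pochhammer (1 + A - c) N = s * pochhammer (1 + c - g) N"
      "pochhammer (1 + A - d) N = s * pochhammer (1 + d - g) N"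
      unfolding s_def by (rule pochhammer_reflect'; simp add: A_def)+
    note p = this
    have q: "1 + A - (A + 1 - e) = e" "1 + A - (A + 1 - f) = f" "1 + A - (- of_nat N) = g"
      by (simp_all add: A_def)
    have t: "pochhammer (- of_nat N :: complex) N = s * fact N"
      using pochhammer_minus_of_nat[of N N] by (simp add: s_def)
    show ?thesis
      unfolding bailey_term_def Let_def A_def[symmetric] vwp_def wp_def q p t r_def ps_def qs_def
      using s s0 by (simp add: mult_ac)
  qed
  have "filterlim (\<lambda>N. of_nat N :: complex) at_infinity sequentially"
    by (rule tendsto_of_nat)
  then have "filterlim (\<lambda>N. (g - 1) + - of_nat N) at_infinity sequentially"
    by (intro tendsto_add_filterlim_at_infinity[OF tendsto_const])
       (simp add: filterlim_at_infinity_conv_norm_at_top)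
  then have inf: "filterlim (\<lambda>N. g - 1 - of_nat N) at_infinity sequentially" by simp
  have "(\<lambda>N. -1 + 2 * (g - 1) / (g - 1 - of_nat N)) \<longlonglongrightarrow> -1 + 0"
    by (intro tendsto_add tendsto_const tendsto_divide_0[OF tendsto_const inf])
  moreover have "eventually (\<lambda>N. -1 + 2 * (g - 1) / (g - 1 - of_nat N) =
      (g - 1 - of_nat N + 2 * of_nat N) / (g - 1 - of_nat N)) sequentially"
    using filterlim_at_infinity_imp_eventually_ne[OF inf, of 0]
  proof eventually_elim
    case (elim N)
    have "g - 1 - of_nat N + 2 * of_nat N = - (g - 1 - of_nat N) + 2 * (g - 1)" by simp
    then show ?case using elim by (metis add_divide_distrib divide_minus_left divide_self)
  qed
  ultimately have "(\<lambda>N. (g - 1 - of_nat N + 2 * of_nat N) / (g - 1 - of_nat N)) \<longlonglongrightarrow> -1 + 0"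
    by (rule Lim_transform_eventually)
  from tendsto_mult[OF this r] show ?thesis
    unfolding b by (simp add: ps_def qs_def rGamma_inverse_Gamma field_simps)
qed

lemma bailey_sum_limit:
  assumes bal: "e + f + g = 1 + a + b + c + d"
    and nI: "a \<notin> \<int>" "b \<notin> \<int>" "c \<notin> \<int>" "d \<notin> \<int>" "e \<notin> \<int>" "f \<notin> \<int>" "g \<notin> \<int>"
      "g - a \<notin> \<int>" "g - b \<notin> \<int>" "g - c \<notin> \<int>" "g - d \<notin> \<int>" "g - e \<notin> \<int>" "g - f \<notin> \<int>"
  shows "(\<lambda>M. \<Sum>n\<le>2 * M + 1. bailey_term a b c d e f g (2 * M + 1) n) \<longlonglongrightarrow> hyp4F3_pair a b c d e f g"
proof -
  define T where "T = bailey_term a b c d e f g"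
  define T' where "T' = bailey_term (1 + a - g) (1 + b - g) (1 + c - g) (1 + d - g) (1 + e - g) (1 + f - g) (2 - g)"
  have sp: "(\<Sum>n\<le>2 * M + 1. T (2 * M + 1) n) = (\<Sum>n\<le>M. T (2 * M + 1) n) + T (2 * M + 1) (2 * M + 1) * (\<Sum>n\<le>M. T' (2 * M + 1) n)" for M
  proof -
    \<comment> \<open>The odd value \<open>N = 2 M + 1\<close> gives two halves of
      \<open>M + 1\<close> terms each and no middle term.\<close>
    have "{..2 * M + 1} = {..M} \<union> {M + 1..2 * M + 1}" by auto
    then have "(\<Sum>n\<le>2 * M + 1. T (2 * M + 1) n) = (\<Sum>n\<le>M. T (2 * M + 1) n) + (\<Sum>n=M + 1..2 * M + 1. T (2 * M + 1) n)"
      by (simp add: sum.union_disjoint)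
    also have "(\<Sum>n=M + 1..2 * M + 1. T (2 * M + 1) n) = (\<Sum>m\<le>M. T (2 * M + 1) (2 * M + 1 - m))"
      by (rule sum.reindex_bij_witness[where i = "\<lambda>m. 2 * M + 1 - m" and j = "\<lambda>n. 2 * M + 1 - n"]) auto
    also have "\<dots> = (\<Sum>m\<le>M. T (2 * M + 1) (2 * M + 1) * T' (2 * M + 1) m)"
      unfolding T_def T'_def by (intro sum.cong refl bailey_term_reverse nI) simp
    finally show ?thesis by (simp add: sum_distrib_left)
  qed
  have "2 - g \<notin> \<int>" by (rule not_Ints_shift[OF nI(7)]) simp
  moreover have "1 + e - g \<notin> \<int>" by (rule not_Ints_shift[OF nI(12)]) simp
  moreover have "1 + f - g \<notin> \<int>" by (rule not_Ints_shift[OF nI(13)]) simp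
  ultimately have h2: "(\<lambda>M. \<Sum>n\<le>M. T' (2 * M + 1) n) \<longlonglongrightarrow>
      hyp4F3_at_1 (1 + a - g) (1 + b - g) (1 + c - g) (1 + d - g) (1 + e - g) (1 + f - g) (2 - g)"
    unfolding T'_def using bal by (intro bailey_half_limit not_nonpos_Ints) (simp_all add: algebra_simps)
  have h1: "(\<lambda>M. \<Sum>n\<le>M. T (2 * M + 1) n) \<longlonglongrightarrow> hyp4F3_at_1 a b c d e f g"
    unfolding T_def by (intro bailey_half_limit not_nonpos_Ints bal nI)
  have "filterlim (\<lambda>M::nat. 2 * M + 1) sequentially sequentially"
    by (rule filterlim_at_top_mono[where f = "\<lambda>M. M"]) (auto intro: filterlim_ident always_eventually)
  note l = filterlim_compose[OF bailey_last_term[OF bal nI] this, folded T_def]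
  show ?thesis
    using tendsto_add[OF h1 tendsto_mult[OF l h2]] unfolding T_def[symmetric] sp hyp4F3_pair_def by simp
qed

text \<open>Bailey's transformation with \<open>c, d, A + 1 - f\<close> as the triple that is
  transformed. The new base is then \<open>(f + g - c - d) - 1 - N\<close>, which has the special
  form again, so both sides have limits by \<open>bailey_sum_limit\<close>. The prefactor has equal
  parameter sums above and below and converges to a Gamma quotient.\<close>

lemma hyp4F3_pair_transform:
  assumes bal: "e + f + g = 1 + a + b + c + d"
    and nI: "a \<notin> \<int>" "b \<notin> \<int>" "c \<notin> \<int>" "d \<notin> \<int>" "e \<notin> \<int>" "f \<notin> \<int>" "g \<notin> \<int>"
      "g - a \<notin> \<int>" "g - b \<notin> \<int>" "g - c \<notin> \<int>" "g - d \<notin> \<int>" "g - e \<notin> \<int>" "g - f \<notin> \<int>"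
    and nI': "e - a \<notin> \<int>" "e - b \<notin> \<int>" "f - c \<notin> \<int>" "f - d \<notin> \<int>" "f - c - d \<notin> \<int>" "g - c - d \<notin> \<int>"
      "e + f - c - d \<notin> \<int>" "f + g - c - d \<notin> \<int>"
  shows "hyp4F3_pair a b c d e f g =
     Gamma (1 + a - g) * Gamma (1 + b - g) * Gamma e * Gamma (e - a - b)
       / (Gamma (1 - g) * Gamma (1 + a + b - g) * Gamma (e - a) * Gamma (e - b))
     * hyp4F3_pair a b (f - c) (f - d) (e + f - c - d) f (f + g - c - d)"
proof -
  define e' g' where "e' = e + f - c - d" and "g' = f + g - c - d"
  have eq: "e = 1 + a + b + c + d - f - g" using bal by (simp add: algebra_simps)
  have bal': "e' + f + g' = 1 + a + b + (f - c) + (f - d)"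
    by (simp add: e'_def g'_def eq)
  have ga: "g' - a \<notin> \<int>" by (rule not_Ints_shift[OF nI'(2)]) (simp add: g'_def eq)
  have gb: "g' - b \<notin> \<int>" by (rule not_Ints_shift[OF nI'(1)]) (simp add: g'_def eq)
  have eab: "e - a - b \<notin> \<int>" by (rule not_Ints_shift[OF nI'(8)]) (simp add: g'_def eq)
  have gab: "1 + a + b - g \<notin> \<int>" by (rule not_Ints_shift[OF nI'(7)]) (simp add: g'_def eq)
  have lim1: "(\<lambda>M. \<Sum>n\<le>2 * M + 1. bailey_term a b c d e f g (2 * M + 1) n) \<longlonglongrightarrow> hyp4F3_pair a b c d e f g"
    by (rule bailey_sum_limit[OF bal nI])
  have lim2: "(\<lambda>M. \<Sum>n\<le>2 * M + 1. bailey_term a b (f - c) (f - d) e' f g' (2 * M + 1) n)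
       \<longlonglongrightarrow> hyp4F3_pair a b (f - c) (f - d) e' f g'"
  proof (rule bailey_sum_limit[OF bal' nI(1,2) nI'(3,4) _ nI(6)])
    show "e' \<notin> \<int>" "g' \<notin> \<int>" using nI' by (simp_all add: e'_def g'_def)
    show "g' - a \<notin> \<int>" "g' - b \<notin> \<int>" by fact+
    show "g' - (f - c) \<notin> \<int>" by (rule not_Ints_shift[OF nI(11)]) (simp add: g'_def)
    show "g' - (f - d) \<notin> \<int>" by (rule not_Ints_shift[OF nI(10)]) (simp add: g'_def)
    show "g' - e' \<notin> \<int>" by (rule not_Ints_shift[OF nI(12)]) (simp add: g'_def e'_def)
    show "g' - f \<notin> \<int>" by (rule not_Ints_shift[OF nI'(6)]) (simp add: g'_def e'_def)
  qed
  define ps where "ps = [1 - g, 1 + a + b - g, e - a, e - b]"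
  define qs where "qs = [1 + a - g, 1 + b - g, e, e - a - b]"
  define r where "r = (\<lambda>N. (\<Prod>p\<leftarrow>ps. pochhammer p N) / (\<Prod>q\<leftarrow>qs. pochhammer q N))"
  have sums: "sum_list qs - sum_list ps = 0"
    by (simp add: ps_def qs_def)
  have I1: "1 + a - g \<notin> \<int>" by (rule not_Ints_shift[OF nI(8)]) simp
  have I2: "1 + b - g \<notin> \<int>" by (rule not_Ints_shift[OF nI(9)]) simp
  have "(\<lambda>N. r N * exp ((sum_list qs - sum_list ps) * of_real (ln (of_nat N))))
      \<longlonglongrightarrow> (\<Prod>p\<leftarrow>ps. rGamma p) * (\<Prod>q\<leftarrow>qs. Gamma q)"
    unfolding r_def
    by (rule pochhammer_ratio_limit) (use nI I1 I2 eab in \<open>auto simp: ps_def qs_def not_nonpos_Ints\<close>)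
  then have r: "r \<longlonglongrightarrow> (\<Prod>p\<leftarrow>ps. rGamma p) * (\<Prod>q\<leftarrow>qs. Gamma q)"
    unfolding sums by simp
  have fin: "(\<Sum>n\<le>N. bailey_term a b c d e f g N n) = r N * (\<Sum>n\<le>N. bailey_term a b (f - c) (f - d) e' f g' N n)" for N
  proof -
    define A l where "A = g - 1 - of_nat N" and "l = g' - 1 - of_nat N"
    have l: "l = 1 + 2 * A - c - d - (A + 1 - f)" by (simp add: A_def l_def g'_def)
    have "(\<Sum>n\<le>N. bailey_term a b c d e f g N n) =
       (\<Sum>n\<le>N. vwp A n * wp A c n * wp A d n * wp A (A + 1 - f) n * wp A a n * wp A b n * wp A (A + 1 - e) n * wp A (- of_nat N) n)"
      by (intro sum.cong refl) (simp add: bailey_term_def Let_def A_def[symmetric] mult_ac)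
    also have "\<dots> = pochhammer (1 + A) N * pochhammer (1 + A - a - b) N * pochhammer (1 + l - a) N * pochhammer (1 + l - b) N
      / (pochhammer (1 + A - a) N * pochhammer (1 + A - b) N * pochhammer (1 + l - a - b) N * pochhammer (1 + l) N)
      * (\<Sum>n\<le>N. vwp l n * wp l (l + c - A) n * wp l (l + d - A) n * wp l (l + (A + 1 - f) - A) n
           * wp l a n * wp l b n * wp l (A + 1 - e) n * wp l (- of_nat N) n)"
      unfolding l
    proof (rule bailey_9F8, unfold l[symmetric])
      show "A + 1 - e = 2 + 3 * A - c - d - (A + 1 - f) - a - b + of_nat N"
        by (simp add: A_def eq)
      show "A \<notin> \<int>" by (rule not_Ints_shift[OF nI(7)]) (simp add: A_def)
      show "l \<notin> \<int>" by (rule not_Ints_shift[OF nI'(8)]) (simp add: l_def g'_def)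
      show "A - c \<notin> \<int>" by (rule not_Ints_shift[OF nI(10)]) (simp add: A_def)
      show "A - d \<notin> \<int>" by (rule not_Ints_shift[OF nI(11)]) (simp add: A_def)
      show "A - (A + 1 - f) \<notin> \<int>" by (rule not_Ints_shift[OF nI(6)]) (simp add: A_def)
      show "A - l \<notin> \<int>" by (rule not_Ints_shift[OF nI'(5)]) (simp add: A_def l_def g'_def)
      show "A - a \<notin> \<int>" by (rule not_Ints_shift[OF nI(8)]) (simp add: A_def)
      show "A - b \<notin> \<int>" by (rule not_Ints_shift[OF nI(9)]) (simp add: A_def)
      show "A - (A + 1 - e) \<notin> \<int>" by (rule not_Ints_shift[OF nI(5)]) (simp add: A_def)
      show "l - a \<notin> \<int>" by (rule not_Ints_shift[OF ga]) (simp add: l_def)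
      show "l - b \<notin> \<int>" by (rule not_Ints_shift[OF gb]) (simp add: l_def)
      show "l - (A + 1 - e) \<notin> \<int>" by (rule not_Ints_shift[OF nI'(7)]) (simp add: A_def l_def g'_def)
    qed
    also have "(\<Sum>n\<le>N. vwp l n * wp l (l + c - A) n * wp l (l + d - A) n * wp l (l + (A + 1 - f) - A) n
           * wp l a n * wp l b n * wp l (A + 1 - e) n * wp l (- of_nat N) n) =
        (\<Sum>n\<le>N. bailey_term a b (f - c) (f - d) e' f g' N n)"
    proof (intro sum.cong refl)
      fix n
      have *: "l + c - A = f - d" "l + d - A = f - c" "l + (A + 1 - f) - A = l + 1 - f" "A + 1 - e = l + 1 - e'"
        by (simp_all add: l_def A_def g'_def e'_def)
      show "vwp l n * wp l (l + c - A) n * wp l (l + d - A) n * wp l (l + (A + 1 - f) - A) n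
           * wp l a n * wp l b n * wp l (A + 1 - e) n * wp l (- of_nat N) n = bailey_term a b (f - c) (f - d) e' f g' N n"
        unfolding * bailey_term_def Let_def l_def[symmetric] by (simp only: mult_ac)
    qed
    also have "pochhammer (1 + A) N * pochhammer (1 + A - a - b) N * pochhammer (1 + l - a) N * pochhammer (1 + l - b) N
      / (pochhammer (1 + A - a) N * pochhammer (1 + A - b) N * pochhammer (1 + l - a - b) N * pochhammer (1 + l) N) = r N"
    proof -
      \<comment> \<open>The parameters depend on \<open>N\<close>, so the symbols are reflected into
        ones with fixed parameters before the limit is taken; the eight signs cancel.\<close>
      define s where "s = (-1 :: complex) ^ N"
      have "s \<noteq> 0" by (simp add: s_def)
      moreover have "pochhammer (1 + A) N = s * pochhammer (1 - g) N"
        "pochhammer (1 + A - a - b) N = s * pochhammer (1 + a + b - g) N"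
        "pochhammer (1 + l - a) N = s * pochhammer (e - b) N"
        "pochhammer (1 + l - b) N = s * pochhammer (e - a) N"
        "pochhammer (1 + A - a) N = s * pochhammer (1 + a - g) N"
        "pochhammer (1 + A - b) N = s * pochhammer (1 + b - g) N"
        "pochhammer (1 + l - a - b) N = s * pochhammer e N"
        "pochhammer (1 + l) N = s * pochhammer (e - a - b) N"
        unfolding s_def by (rule pochhammer_reflect'; simp add: A_def l_def g'_def eq)+
      ultimately show ?thesis
        by (simp add: r_def ps_def qs_def mult_ac)
    qed
    finally show ?thesis .
  qed
  have "filterlim (\<lambda>M::nat. 2 * M + 1) sequentially sequentially"
    by (rule filterlim_at_top_mono[where f = "\<lambda>M. M"]) (auto intro: filterlim_ident always_eventually)
  note r' = filterlim_compose[OF r this]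
  have "hyp4F3_pair a b c d e f g = (\<Prod>p\<leftarrow>ps. rGamma p) * (\<Prod>q\<leftarrow>qs. Gamma q) * hyp4F3_pair a b (f - c) (f - d) e' f g'"
    using LIMSEQ_unique[OF lim1] tendsto_mult[OF r' lim2] unfolding fin by blast
  also have "(\<Prod>p\<leftarrow>ps. rGamma p) * (\<Prod>q\<leftarrow>qs. Gamma q) =
      Gamma (1 + a - g) * Gamma (1 + b - g) * Gamma e * Gamma (e - a - b)
       / (Gamma (1 - g) * Gamma (1 + a + b - g) * Gamma (e - a) * Gamma (e - b))"
    by (simp add: ps_def qs_def rGamma_inverse_Gamma field_simps)
  finally show ?thesis unfolding e'_def g'_def .
qed

lemma hyp4F3_pair_swap:
  "hyp4F3_pair a b c d e f g = hyp4F3_pair c d a b e f g"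
  by (simp add: hyp4F3_pair_def hyp4F3_at_1_def mult_ac)

text \<open>The transformation followed by itself with the two upper pairs exchanged. The conditions
  on sums such as \<open>f - a - b\<close> stem from the intermediate series; its Gamma factors at
  \<open>e - a - b\<close> and \<open>1 + a + b - g\<close> cancel in the composition.\<close>

lemma hyp4F3_pair_dual:
  assumes bal: "e + f + g = 1 + a + b + c + d"
    and nI: "a \<notin> \<int>" "b \<notin> \<int>" "c \<notin> \<int>" "d \<notin> \<int>" "e \<notin> \<int>" "f \<notin> \<int>" "g \<notin> \<int>"
      "g - a \<notin> \<int>" "g - b \<notin> \<int>" "g - c \<notin> \<int>" "g - d \<notin> \<int>" "g - e \<notin> \<int>" "g - f \<notin> \<int>" "e - f \<notin> \<int>"
    and nI2: "e - a \<notin> \<int>" "e - b \<notin> \<int>" "e - c \<notin> \<int>" "e - d \<notin> \<int>"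
      "f - a \<notin> \<int>" "f - b \<notin> \<int>" "f - c \<notin> \<int>" "f - d \<notin> \<int>"
      "f - a - b \<notin> \<int>" "f - c - d \<notin> \<int>" "g - c - d \<notin> \<int>" "e + f - c - d \<notin> \<int>" "f + g - c - d \<notin> \<int>"
  shows "hyp4F3_pair a b c d e f g =
     Gamma (1 + a - g) * Gamma (1 + b - g) * Gamma (1 + c - g) * Gamma (1 + d - g) * Gamma e * Gamma (e - f)
       / (Gamma (1 - g) * Gamma (1 + f - g) * Gamma (e - a) * Gamma (e - b) * Gamma (e - c) * Gamma (e - d))
     * hyp4F3_pair (f - a) (f - b) (f - c) (f - d) (1 + f - g) f (1 + f - e)"
proof -
  define e' g' where "e' = e + f - c - d" and "g' = f + g - c - d"
  have eq: "e = 1 + a + b + c + d - f - g" using bal by (simp add: algebra_simps)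
  have s1: "hyp4F3_pair a b c d e f g =
     Gamma (1 + a - g) * Gamma (1 + b - g) * Gamma e * Gamma (e - a - b)
       / (Gamma (1 - g) * Gamma (1 + a + b - g) * Gamma (e - a) * Gamma (e - b))
     * hyp4F3_pair a b (f - c) (f - d) e' f g'"
    unfolding e'_def g'_def by (rule hyp4F3_pair_transform) (use bal nI nI2 in auto)
  have "hyp4F3_pair (f - c) (f - d) a b e' f g' =
     Gamma (1 + (f - c) - g') * Gamma (1 + (f - d) - g') * Gamma e' * Gamma (e' - (f - c) - (f - d))
       / (Gamma (1 - g') * Gamma (1 + (f - c) + (f - d) - g') * Gamma (e' - (f - c)) * Gamma (e' - (f - d)))
     * hyp4F3_pair (f - c) (f - d) (f - a) (f - b) (e' + f - a - b) f (f + g' - a - b)"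
  proof (rule hyp4F3_pair_transform)
    show "e' + f + g' = 1 + (f - c) + (f - d) + a + b" by (simp add: e'_def g'_def eq)
    show "f - c \<notin> \<int>" "f - d \<notin> \<int>" "a \<notin> \<int>" "b \<notin> \<int>" "e' \<notin> \<int>" "f \<notin> \<int>" "g' \<notin> \<int>"
      "f - a \<notin> \<int>" "f - b \<notin> \<int>" "f - a - b \<notin> \<int>"
      using nI nI2 by (simp_all add: e'_def g'_def)
    show "g' - (f - c) \<notin> \<int>" by (rule not_Ints_shift[OF nI(11)]) (simp add: g'_def)
    show "g' - (f - d) \<notin> \<int>" by (rule not_Ints_shift[OF nI(10)]) (simp add: g'_def)
    show "g' - a \<notin> \<int>" by (rule not_Ints_shift[OF nI2(2)]) (simp add: g'_def eq)
    show "g' - b \<notin> \<int>" by (rule not_Ints_shift[OF nI2(1)]) (simp add: g'_def eq)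
    show "g' - e' \<notin> \<int>" by (rule not_Ints_shift[OF nI(12)]) (simp add: g'_def e'_def)
    show "g' - f \<notin> \<int>" by (rule not_Ints_shift[OF nI2(11)]) (simp add: g'_def e'_def)
    show "e' - (f - c) \<notin> \<int>" by (rule not_Ints_shift[OF nI2(4)]) (simp add: e'_def)
    show "e' - (f - d) \<notin> \<int>" by (rule not_Ints_shift[OF nI2(3)]) (simp add: e'_def)
    show "g' - a - b \<notin> \<int>" by (rule not_Ints_shift[OF nI(5)]) (simp add: g'_def eq)
    show "e' + f - a - b \<notin> \<int>" by (rule not_Ints_shift[OF nI(13)]) (simp add: e'_def eq)
    show "f + g' - a - b \<notin> \<int>" by (rule not_Ints_shift[OF nI(14)]) (simp add: g'_def eq)
  qed
  moreover have "1 + (f - c) - g' = 1 + d - g" "1 + (f - d) - g' = 1 + c - g" "e' - (f - c) - (f - d) = e - f"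
    "1 - g' = e - a - b" "1 + (f - c) + (f - d) - g' = 1 + f - g" "e' - (f - c) = e - d" "e' - (f - d) = e - c"
    "e' + f - a - b = 1 + f - g" "f + g' - a - b = 1 + f - e" "e' = 1 + a + b - g"
    by (simp_all add: e'_def g'_def eq)
  ultimately have s2: "hyp4F3_pair a b (f - c) (f - d) e' f g' =
     Gamma (1 + d - g) * Gamma (1 + c - g) * Gamma (1 + a + b - g) * Gamma (e - f)
       / (Gamma (e - a - b) * Gamma (1 + f - g) * Gamma (e - d) * Gamma (e - c))
     * hyp4F3_pair (f - a) (f - b) (f - c) (f - d) (1 + f - g) f (1 + f - e)"
    using hyp4F3_pair_swap[of a b "f - c" "f - d" e' f g']
      hyp4F3_pair_swap[of "f - a" "f - b" "f - c" "f - d" "1 + f - g" f "1 + f - e"]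
    by (simp only:)
  have "e - a - b \<notin> \<int>" by (rule not_Ints_shift[OF nI2(13)]) (simp add: eq)
  moreover have "1 + a + b - g \<notin> \<int>" by (rule not_Ints_shift[OF nI2(12)]) (simp add: eq)
  ultimately have "Gamma (e - a - b) \<noteq> 0" "Gamma (1 + a + b - g) \<noteq> 0"
    by (simp_all add: Gamma_nz)
  then show ?thesis
    unfolding s1 s2 by (simp add: mult_ac)
qed

text \<open>This is \<open>\<Sum>n. t n\<close> for the Gamma quotient \<open>t\<close> with upper parameters \<open>a, b, c, d\<close> and lower
  parameters \<open>1, e, f, g\<close>.\<close>

definition gamma_hyp :: "complex \<Rightarrow> complex \<Rightarrow> complex \<Rightarrow> complex \<Rightarrow> complex \<Rightarrow> complex \<Rightarrow> complex \<Rightarrow> complex" where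
  "gamma_hyp a b c d e f g =
     Gamma a * Gamma b * Gamma c * Gamma d / (Gamma e * Gamma f * Gamma g) * hyp4F3_at_1 a b c d e f g"

lemma hyp4F3_pair_eq:
  assumes "a \<notin> \<int>" "b \<notin> \<int>" "c \<notin> \<int>" "d \<notin> \<int>" "e \<notin> \<int>" "f \<notin> \<int>" "g \<notin> \<int>"
  shows "hyp4F3_pair a b c d e f g = Gamma e * Gamma f * Gamma g / (Gamma a * Gamma b * Gamma c * Gamma d) *
     (gamma_hyp a b c d e f g - gamma_hyp (1 + a - g) (1 + b - g) (1 + c - g) (1 + d - g) (1 + e - g) (1 + f - g) (2 - g))"
  using assms[THEN Gamma_nz] by (simp add: hyp4F3_pair_def gamma_hyp_def right_diff_distrib mult_ac)

lemma Gamma_sin: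
  fixes z :: complex
  assumes "z \<notin> \<int>"
  shows "Gamma z * Gamma (1 - z) * sin (of_real pi * z) = of_real pi"
proof -
  have "sin (of_real pi * z) \<noteq> 0"
    using assms by (auto simp: sin_eq_0 Ints_def)
  then show ?thesis
    by (simp add: Gamma_reflection_complex)
qed

text \<open>In the normalization of \<open>gamma_hyp\<close> the factors at single lower parameters
  drop out of the duality. What is left at \<open>g, 1 - g\<close> and at
  \<open>e - f, 1 + f - e\<close> combines to sines by the reflection formula.\<close>

lemma gamma_hyp_dual:
  assumes bal: "e + f + g = 1 + a + b + c + d"
    and nI: "a \<notin> \<int>" "b \<notin> \<int>" "c \<notin> \<int>" "d \<notin> \<int>" "e \<notin> \<int>" "f \<notin> \<int>" "g \<notin> \<int>"
      "g - a \<notin> \<int>" "g - b \<notin> \<int>" "g - c \<notin> \<int>" "g - d \<notin> \<int>" "g - e \<notin> \<int>" "g - f \<notin> \<int>" "e - f \<notin> \<int>"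
    and nI2: "e - a \<notin> \<int>" "e - b \<notin> \<int>" "e - c \<notin> \<int>" "e - d \<notin> \<int>"
      "f - a \<notin> \<int>" "f - b \<notin> \<int>" "f - c \<notin> \<int>" "f - d \<notin> \<int>"
      "f - a - b \<notin> \<int>" "f - c - d \<notin> \<int>" "g - c - d \<notin> \<int>" "e + f - c - d \<notin> \<int>" "f + g - c - d \<notin> \<int>"
  shows "(gamma_hyp a b c d e f g - gamma_hyp (1 + a - g) (1 + b - g) (1 + c - g) (1 + d - g) (1 + e - g) (1 + f - g) (2 - g))
      * sin (of_real pi * (e - f)) *
      (Gamma (e - a) * Gamma (e - b) * Gamma (e - c) * Gamma (e - d) * (Gamma (f - a) * Gamma (f - b) * Gamma (f - c) * Gamma (f - d)))
    = (gamma_hyp (f - a) (f - b) (f - c) (f - d) f (1 + f - g) (1 + f - e)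
        - gamma_hyp (e - a) (e - b) (e - c) (e - d) e (1 + e - g) (1 + e - f))
      * sin (of_real pi * g) *
      (Gamma a * Gamma b * Gamma c * Gamma d * (Gamma (1 + a - g) * Gamma (1 + b - g) * Gamma (1 + c - g) * Gamma (1 + d - g)))"
proof -
  define X where "X = gamma_hyp a b c d e f g - gamma_hyp (1 + a - g) (1 + b - g) (1 + c - g) (1 + d - g) (1 + e - g) (1 + f - g) (2 - g)"
  define Y where "Y = gamma_hyp (f - a) (f - b) (f - c) (f - d) (1 + f - g) f (1 + f - e)
        - gamma_hyp (e - a) (e - b) (e - c) (e - d) (1 + e - g) e (1 + e - f)"
  have I: "1 + f - g \<notin> \<int>" by (rule not_Ints_shift[OF nI(13)]) simp
  have I2: "1 + f - e \<notin> \<int>" by (rule not_Ints_shift[OF nI(14)]) simp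
  have "hyp4F3_pair (f - a) (f - b) (f - c) (f - d) (1 + f - g) f (1 + f - e) =
     Gamma (1 + f - g) * Gamma f * Gamma (1 + f - e) / (Gamma (f - a) * Gamma (f - b) * Gamma (f - c) * Gamma (f - d)) * Y"
    using hyp4F3_pair_eq[OF nI2(5-8) I nI(6) I2] by (simp add: Y_def add_diff_eq)
  with hyp4F3_pair_dual[OF bal nI nI2]
  have "Gamma e * Gamma f * Gamma g / (Gamma a * Gamma b * Gamma c * Gamma d) * X =
     Gamma (1 + a - g) * Gamma (1 + b - g) * Gamma (1 + c - g) * Gamma (1 + d - g) * Gamma e * Gamma (e - f)
       / (Gamma (1 - g) * Gamma (1 + f - g) * Gamma (e - a) * Gamma (e - b) * Gamma (e - c) * Gamma (e - d))
     * (Gamma (1 + f - g) * Gamma f * Gamma (1 + f - e) / (Gamma (f - a) * Gamma (f - b) * Gamma (f - c) * Gamma (f - d)) * Y)"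
    unfolding hyp4F3_pair_eq[OF nI(1-7)] X_def by simp
  note main = this
  define Ga Ge Gf Gg where "Ga = Gamma a * Gamma b * Gamma c * Gamma d" and "Ge = Gamma (e - a) * Gamma (e - b) * Gamma (e - c) * Gamma (e - d)"
    and "Gf = Gamma (f - a) * Gamma (f - b) * Gamma (f - c) * Gamma (f - d)"
    and "Gg = Gamma (1 + a - g) * Gamma (1 + b - g) * Gamma (1 + c - g) * Gamma (1 + d - g)"
  have nz: "Ga \<noteq> 0" "Ge \<noteq> 0" "Gf \<noteq> 0" "Gamma e \<noteq> 0" "Gamma f \<noteq> 0" "Gamma (1 + f - g) \<noteq> 0"
    using nI nI2 I by (simp_all add: Ga_def Ge_def Gf_def Gamma_nz)
  have g1: "1 - g \<notin> \<int>" by (rule not_Ints_shift[OF nI(7)]) simp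
  have "Gamma e * Gamma f * Gamma g / Ga * X =
     Gg * Gamma e * Gamma (e - f) / (Gamma (1 - g) * Gamma (1 + f - g) * Ge)
     * (Gamma (1 + f - g) * Gamma f * Gamma (1 + f - e) / Gf * Y)"
    using main unfolding Ga_def Ge_def Gf_def Gg_def by (simp only: mult.assoc)
  then have "X * (Gamma g * Gamma (1 - g)) * (Ge * Gf) = Y * (Gamma (e - f) * Gamma (1 - (e - f))) * (Ga * Gg)"
    using nz Gamma_nz[OF g1] by (simp add: field_simps)
  from arg_cong[OF this, of "\<lambda>z. z * (sin (of_real pi * g) * sin (of_real pi * (e - f)))"]
  have "X * (Gamma g * Gamma (1 - g) * sin (of_real pi * g)) * sin (of_real pi * (e - f)) * (Ge * Gf)
    = Y * (Gamma (e - f) * Gamma (1 - (e - f)) * sin (of_real pi * (e - f))) * sin (of_real pi * g) * (Ga * Gg)"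
    by (simp only: mult_ac)
  then have "X * sin (of_real pi * (e - f)) * (Ge * Gf) = Y * sin (of_real pi * g) * (Ga * Gg)"
    unfolding Gamma_sin[OF nI(7)] Gamma_sin[OF nI(14)] by (simp add: mult.assoc)
  moreover have "gamma_hyp p q r s x y z = gamma_hyp p q r s y x z" for p q r s x y z
    by (simp add: gamma_hyp_def hyp4F3_at_1_def mult_ac)
  ultimately show ?thesis
    unfolding X_def Y_def Ga_def Ge_def Gf_def Gg_def by metis
qed

section \<open>Partial fractions of Gamma quotients\<close>

text \<open>One induction proves both claims: the residue at a new pole \<open>x k\<close> is the
  old product evaluated there, to which the first claim applies. The second claim compares the
  coefficients of \<open>1 / s\<close> at infinity.\<close>

lemma partial_fractions:
  fixes x y :: "'b \<Rightarrow> 'a::field"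
  assumes "finite J" "inj_on x J"
  defines "r \<equiv> \<lambda>J i. (x i - y i) * (\<Prod>j\<in>J - {i}. (x i - y j) / (x i - x j))"
  shows "s \<notin> x ` J \<Longrightarrow> (\<Prod>i\<in>J. (s - y i) / (s - x i)) = 1 + (\<Sum>i\<in>J. r J i / (s - x i))"
    and "(\<Sum>i\<in>J. r J i) = (\<Sum>i\<in>J. x i - y i)"
proof -
  have "(\<forall>s. s \<notin> x ` J \<longrightarrow> (\<Prod>i\<in>J. (s - y i) / (s - x i)) = 1 + (\<Sum>i\<in>J. r J i / (s - x i)))
    \<and> (\<Sum>i\<in>J. r J i) = (\<Sum>i\<in>J. x i - y i)"
    using assms(1,2)
  proof (induction J)
    case empty
    then show ?case by simp
  next
    case (insert k J)
    then have IH1: "\<And>s. s \<notin> x ` J \<Longrightarrow> (\<Prod>i\<in>J. (s - y i) / (s - x i)) = 1 + (\<Sum>i\<in>J. r J i / (s - x i))"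
      and IH2: "(\<Sum>i\<in>J. r J i) = (\<Sum>i\<in>J. x i - y i)"
      by auto
    have kJ: "k \<notin> J" "x k \<notin> x ` J" using insert by auto
    have ne: "x i \<noteq> x k" if "i \<in> J" for i using kJ(2) imageI[OF that, of x] by force
    have rk: "r (insert k J) k = (x k - y k) * (1 + (\<Sum>i\<in>J. r J i / (x k - x i)))"
    proof -
      have "r (insert k J) k = (x k - y k) * (\<Prod>j\<in>J. (x k - y j) / (x k - x j))"
        using kJ(1) by (simp add: r_def)
      then show ?thesis unfolding IH1[OF kJ(2)] .
    qed
    have ri: "r (insert k J) i = r J i * ((x i - y k) / (x i - x k))" if "i \<in> J" for i
    proof -
      have "insert k J - {i} = insert k (J - {i})" using that kJ by auto
      then show ?thesis using insert.hyps kJ by (simp add: r_def mult_ac)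
    qed
    have 1: "(\<Prod>i\<in>insert k J. (s - y i) / (s - x i)) = 1 + (\<Sum>i\<in>insert k J. r (insert k J) i / (s - x i))"
      if s: "s \<notin> x ` insert k J" for s
    proof -
      have sk: "s - x k \<noteq> 0" and si: "s \<notin> x ` J" using s by auto
      have "(\<Prod>i\<in>insert k J. (s - y i) / (s - x i)) = (s - y k) / (s - x k) * (1 + (\<Sum>i\<in>J. r J i / (s - x i)))"
        using insert.hyps IH1[OF si] by simp
      also have "(s - y k) / (s - x k) = 1 + (x k - y k) / (s - x k)"
        using sk by (simp add: field_simps)
      also have "(1 + (x k - y k) / (s - x k)) * (1 + (\<Sum>i\<in>J. r J i / (s - x i))) =
         1 + (x k - y k) / (s - x k) + (\<Sum>i\<in>J. (1 + (x k - y k) / (s - x k)) * (r J i / (s - x i)))"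
        by (simp only: distrib_left sum_distrib_left mult_1_right add.assoc)
      also have "(\<Sum>i\<in>J. (1 + (x k - y k) / (s - x k)) * (r J i / (s - x i))) =
        (\<Sum>i\<in>J. r (insert k J) i / (s - x i) + (x k - y k) / (s - x k) * (r J i / (x k - x i)))"
      proof (rule sum.cong[OF refl])
        fix i assume i: "i \<in> J"
        then have nz: "s - x i \<noteq> 0" "x i - x k \<noteq> 0" "x k - x i \<noteq> 0" using si ne[OF i] by auto
        have "(x k - y k) / (s - x k) * (r J i / (s - x i)) =
           (x k - y k) / (s - x k) * (r J i / (x k - x i)) - (x k - y k) * r J i / ((x k - x i) * (s - x i))"
          using nz sk by (simp add: divide_simps) (simp add: algebra_simps)
        moreover have "r (insert k J) i / (s - x i) = r J i / (s - x i) - (x k - y k) * r J i / ((x k - x i) * (s - x i))"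
          unfolding ri[OF i] using nz by (simp add: divide_simps) (simp add: algebra_simps)
        ultimately show "(1 + (x k - y k) / (s - x k)) * (r J i / (s - x i)) =
           r (insert k J) i / (s - x i) + (x k - y k) / (s - x k) * (r J i / (x k - x i))"
          unfolding distrib_right mult_1_left by simp
      qed
      also have "1 + (x k - y k) / (s - x k) + \<dots> = 1 + (\<Sum>i\<in>insert k J. r (insert k J) i / (s - x i))"
        using insert.hyps by (simp add: rk sum.distrib sum_distrib_left distrib_left add_divide_distrib sum_divide_distrib mult_ac)
      finally show ?thesis .
    qed
    have "(\<Sum>i\<in>insert k J. r (insert k J) i) = (x k - y k) + (\<Sum>i\<in>J. r (insert k J) i + (x k - y k) * (r J i / (x k - x i)))"
      using insert.hyps by (simp add: rk sum.distrib sum_distrib_left distrib_left)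
    also have "(\<Sum>i\<in>J. r (insert k J) i + (x k - y k) * (r J i / (x k - x i))) = (\<Sum>i\<in>J. r J i)"
    proof (rule sum.cong[OF refl])
      fix i assume i: "i \<in> J"
      then have nz: "x i - x k \<noteq> 0" "x k - x i \<noteq> 0" using ne[OF i] by auto
      show "r (insert k J) i + (x k - y k) * (r J i / (x k - x i)) = r J i"
        unfolding ri[OF i] using nz by (simp add: divide_simps) (simp add: algebra_simps)
    qed
    finally have 2: "(\<Sum>i\<in>insert k J. r (insert k J) i) = (\<Sum>i\<in>insert k J. x i - y i)"
      using insert.hyps by (simp add: IH2)
    from 1 2 show ?case by blast
  qed
  then show "s \<notin> x ` J \<Longrightarrow> (\<Prod>i\<in>J. (s - y i) / (s - x i)) = 1 + (\<Sum>i\<in>J. r J i / (s - x i))"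
    and "(\<Sum>i\<in>J. r J i) = (\<Sum>i\<in>J. x i - y i)"
    by auto
qed

section \<open>Residues of the rational approximations\<close>

lemma pochhammer_shift_down:
  fixes z :: complex
  assumes "m \<le> N"
  shows "pochhammer (z - of_nat m) N * (\<Prod>l<m. z + of_nat (N - m + l)) = (-1) ^ m * pochhammer (1 - z) m * pochhammer z N"
proof -
  have "pochhammer (z - of_nat m) N = pochhammer (z - of_nat m) m * pochhammer z (N - m)"
    using pochhammer_product[OF assms, of "z - of_nat m"] by simp
  also have "pochhammer (z - of_nat m) m = (-1) ^ m * pochhammer (1 - z) m"
    by (rule pochhammer_reflect') simp
  finally have 1: "pochhammer (z - of_nat m) N = (-1) ^ m * pochhammer (1 - z) m * pochhammer z (N - m)" .
  have "pochhammer z N = pochhammer z (N - m) * pochhammer (z + of_nat (N - m)) m"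
    using pochhammer_product'[of z "N - m" m] assms by simp
  also have "pochhammer (z + of_nat (N - m)) m = (\<Prod>l<m. z + of_nat (N - m + l))"
    by (simp add: pochhammer_prod atLeast0LessThan add.assoc)
  finally show ?thesis unfolding 1 by (simp only: mult_ac)
qed

text \<open>The counterpart of \<open>pochhammer_shift_down\<close> at \<open>z = 0\<close>, where
  the symbol of \<open>- m\<close> contains a zero factor. Removing that factor is what forming the
  residue at a simple pole does.\<close>

lemma prod_diff_of_nat:
  assumes "m < N"
  shows "(\<Prod>k\<in>{..<N} - {m}. of_nat k - of_nat m :: complex) * (\<Prod>l<m. of_nat (N - m + l)) = (-1) ^ m * fact m * fact (N - 1)"
proof -
  have "(\<Prod>k\<in>{..<N} - {m}. of_nat k - of_nat m :: complex) = (\<Prod>k<m. of_nat k - of_nat m) * (\<Prod>k\<in>{m<..<N}. of_nat k - of_nat m)"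
  proof -
    have "{..<N} - {m} = {..<m} \<union> {m<..<N}" "{..<m} \<inter> {m<..<N} = {}" using assms by auto
    then show ?thesis by (simp only: prod.union_disjoint finite_lessThan finite_greaterThanLessThan)
  qed
  also have "(\<Prod>k<m. of_nat k - of_nat m :: complex) = pochhammer (- of_nat m) m"
    by (simp add: pochhammer_prod atLeast0LessThan)
  also have "\<dots> = (-1) ^ m * fact m"
    using pochhammer_minus_of_nat[of m m] by simp
  also have "(\<Prod>k\<in>{m<..<N}. of_nat k - of_nat m :: complex) = (\<Prod>k\<in>{1..N - 1 - m}. of_nat k)"
    by (rule prod.reindex_bij_witness[where i = "\<lambda>k. k + m" and j = "\<lambda>k. k - m"]) (auto simp: of_nat_diff)
  also have "\<dots> = fact (N - 1 - m)"
    by (simp add: fact_prod)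
  finally have 1: "(\<Prod>k\<in>{..<N} - {m}. of_nat k - of_nat m :: complex) = (-1) ^ m * fact m * fact (N - 1 - m)" .
  have "fact (N - 1) = (pochhammer 1 (N - 1 - m + m) :: complex)"
    using assms by (simp add: pochhammer_fact)
  also have "\<dots> = fact (N - 1 - m) * pochhammer (1 + of_nat (N - 1 - m)) m"
    by (simp add: pochhammer_product' pochhammer_fact)
  also have "pochhammer (1 + of_nat (N - 1 - m)) m = (\<Prod>l<m. of_nat (N - m + l) :: complex)"
    unfolding pochhammer_prod atLeast0LessThan
  proof (rule prod.cong[OF refl])
    fix l assume "l \<in> {..<m}"
    have "N - m = Suc (N - 1 - m)" using assms by simp
    then show "1 + of_nat (N - 1 - m) + of_nat l = (of_nat (N - m + l) :: complex)"
      by simp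
  qed
  finally have "fact (N - 1) = fact (N - 1 - m) * (\<Prod>l<m. of_nat (N - m + l) :: complex)" .
  then show ?thesis unfolding 1 by (simp only: mult_ac)
qed

abbreviation "idx \<equiv> {0, 1, 2, 3 :: nat}"

lemma pochhammer_ratio_limit_idx:
  fixes p q :: "nat \<Rightarrow> complex"
  assumes "\<And>j. j \<in> idx \<Longrightarrow> q j \<notin> \<int>\<^sub>\<le>\<^sub>0"
  shows "(\<lambda>n. (\<Prod>j\<in>idx. pochhammer (p j) n) / (\<Prod>j\<in>idx. pochhammer (q j) n)
           * exp ((sum q idx - sum p idx) * of_real (ln (of_nat n))))
    \<longlonglongrightarrow> (\<Prod>j\<in>idx. rGamma (p j)) * (\<Prod>j\<in>idx. Gamma (q j))"
proof -
  have l: "(\<Prod>x\<leftarrow>map p [0,1,2,3]. h x) = (\<Prod>j\<in>idx. h (p j))" "sum_list (map p [0,1,2,3]) = sum p idx"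
    for p :: "nat \<Rightarrow> complex" and h :: "complex \<Rightarrow> complex"
    by simp_all
  have "x \<notin> \<int>\<^sub>\<le>\<^sub>0" if "x \<in> set (map q [0,1,2,3])" for x
    using that assms by auto
  from pochhammer_ratio_limit[of "map p [0,1,2,3]" "map q [0,1,2,3]", OF _ this]
  show ?thesis unfolding l by simp
qed

lemma exp_ln_powers:
  assumes "n > 0"
  shows "exp (2 * of_real (ln (real n))) = (of_nat n ^ 2 :: complex)"
    "exp (- (2 * of_real (ln (real n)))) = (1 / of_nat n ^ 2 :: complex)"
    "exp (- of_real (ln (real n))) = (1 / of_nat n :: complex)"
  using exp_ln_of_nat[OF assms] by (simp_all add: exp_double exp_minus inverse_eq_divide)

text \<open>The function \<open>t\<close> of the overview. With \<open>rGamma\<close> it vanishes,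
  instead of being undefined, where a lower Gamma function has a pole, as long as no upper one
  does.\<close>

definition gratio :: "(nat \<Rightarrow> complex) \<Rightarrow> (nat \<Rightarrow> complex) \<Rightarrow> complex \<Rightarrow> complex" where
  "gratio a e s = (\<Prod>j\<in>idx. Gamma (a j + s)) * (\<Prod>j\<in>idx. rGamma (e j + s))"

text \<open>The residue of \<open>gratio\<close> at \<open>- a i - m\<close> divided by that at
  \<open>- a i\<close>. Each of the eight Gamma factors contributes the sign
  \<open>(-1) ^ m\<close>, and these cancel; the index \<open>j = i\<close> contributes the
  factorial.\<close>

definition res_ratio :: "(nat \<Rightarrow> complex) \<Rightarrow> (nat \<Rightarrow> complex) \<Rightarrow> nat \<Rightarrow> nat \<Rightarrow> complex" where
  "res_ratio a e i m = (\<Prod>j\<in>idx. pochhammer (1 + a i - e j) m) / (\<Prod>j\<in>idx. pochhammer (1 + a i - a j) m)"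

definition res0 :: "(nat \<Rightarrow> complex) \<Rightarrow> (nat \<Rightarrow> complex) \<Rightarrow> nat \<Rightarrow> complex" where
  "res0 a e i = (\<Prod>j\<in>idx. if j = i then 1 else Gamma (a j - a i)) * (\<Prod>j\<in>idx. rGamma (e j - a i))"

text \<open>The residue at \<open>- a i - m\<close> of the rational function of \<open>s\<close>
  formed by the symbols of \<open>e j + s\<close> over those of \<open>a j + s\<close>, all of
  length \<open>N\<close>.\<close>

definition fin_res :: "(nat \<Rightarrow> complex) \<Rightarrow> (nat \<Rightarrow> complex) \<Rightarrow> nat \<Rightarrow> nat \<Rightarrow> nat \<Rightarrow> complex" where
  "fin_res a e N i m = (\<Prod>j\<in>idx. pochhammer (e j - a i - of_nat m) N)
     / (\<Prod>j\<in>idx. if j = i then \<Prod>k\<in>{..<N} - {m}. of_nat k - of_nat m else pochhammer (a j - a i - of_nat m) N)"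

definition res_factor :: "(nat \<Rightarrow> complex) \<Rightarrow> (nat \<Rightarrow> complex) \<Rightarrow> nat \<Rightarrow> nat \<Rightarrow> complex" where
  "res_factor a e i q = (\<Prod>j\<in>idx. a j - a i + of_nat q) / (\<Prod>j\<in>idx. e j - a i + of_nat q)"

text \<open>Splits off the part that already has its limiting value. The dependence on
  \<open>N\<close> is confined to the residue at \<open>m = 0\<close> and a product of factors
  tending to 1, which gives both the termwise limit and a bound uniform in \<open>N\<close>.\<close>

lemma fin_res_eq:
  assumes i: "i \<in> idx" and m: "m < N" and ae: "\<And>j. j \<in> idx \<Longrightarrow> e j - a i \<notin> \<int>"
    and aa: "\<And>j. j \<in> idx \<Longrightarrow> j \<noteq> i \<Longrightarrow> a j - a i \<notin> \<int>"
  shows "fin_res a e N i m = fin_res a e N i 0 * res_ratio a e i m * (\<Prod>l<m. res_factor a e i (N - m + l))"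
proof -
  define P where "P = (\<lambda>z. \<Prod>l<m. z + of_nat (N - m + l) :: complex)"
  define D where "D = (\<lambda>m j. if j = i then \<Prod>k\<in>{..<N} - {m}. of_nat k - of_nat m else pochhammer (a j - a i - of_nat m) N :: complex)"
  have mN: "m \<le> N" using m by simp
  have PS: "pochhammer (z - of_nat m) N * P z = (-1) ^ m * pochhammer (1 - z) m * pochhammer z N" for z
    unfolding P_def by (rule pochhammer_shift_down[OF mN])
  have Pnz: "P z \<noteq> 0" if "z \<notin> \<int>" for z
    unfolding P_def using not_Ints_nz[OF not_Ints_shift[OF that]] by auto
  have Pnz': "P 0 \<noteq> 0"
    using m by (auto simp: P_def simp del: of_nat_add)
  have num: "pochhammer (e j - a i - of_nat m) N = (-1) ^ m * pochhammer (1 + a i - e j) m * pochhammer (e j - a i) N / P (e j - a i)"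
    if "j \<in> idx" for j
    using PS[of "e j - a i"] Pnz[OF ae[OF that]] by (simp add: nonzero_eq_divide_eq diff_diff_eq2)
  have den: "D m j = (-1) ^ m * pochhammer (1 + a i - a j) m * D 0 j / P (a j - a i)" if "j \<in> idx" for j
  proof (cases "j = i")
    case True
    have "(\<Prod>k\<in>{..<N} - {0}. of_nat k :: complex) = fact (N - 1)"
    proof -
      have "{..<N} - {0} = {1..N - 1}" using m by auto
      then show ?thesis by (simp add: fact_prod)
    qed
    then show ?thesis
      using True prod_diff_of_nat[OF m] Pnz' unfolding P_def
      by (simp add: D_def nonzero_eq_divide_eq pochhammer_fact)
  next
    case False
    then show ?thesis
      using PS[of "a j - a i"] Pnz[OF aa[OF that False]] by (simp add: nonzero_eq_divide_eq D_def diff_diff_eq2)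
  qed
  have th: "(\<Prod>l<m. res_factor a e i (N - m + l)) = (\<Prod>j\<in>idx. P (a j - a i)) / (\<Prod>j\<in>idx. P (e j - a i))"
    unfolding P_def res_factor_def prod_dividef prod.swap[of _ idx] ..
  have "fin_res a e N i m = (\<Prod>j\<in>idx. pochhammer (e j - a i - of_nat m) N) / (\<Prod>j\<in>idx. D m j)"
    by (simp only: fin_res_def D_def)
  also have "(\<Prod>j\<in>idx. pochhammer (e j - a i - of_nat m) N) =
     (\<Prod>j\<in>idx. (-1) ^ m * pochhammer (1 + a i - e j) m * pochhammer (e j - a i) N / P (e j - a i))"
    by (rule prod.cong[OF refl num])
  also have "(\<Prod>j\<in>idx. D m j) = (\<Prod>j\<in>idx. (-1) ^ m * pochhammer (1 + a i - a j) m * D 0 j / P (a j - a i))"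
    by (rule prod.cong[OF refl den])
  also have "(\<Prod>j\<in>idx. (-1) ^ m * pochhammer (1 + a i - e j) m * pochhammer (e j - a i) N / P (e j - a i)) / \<dots>
     = (\<Prod>j\<in>idx. pochhammer (e j - a i) N) / (\<Prod>j\<in>idx. D 0 j) * res_ratio a e i m * (\<Prod>l<m. res_factor a e i (N - m + l))"
    unfolding th res_ratio_def prod.distrib prod_dividef by (simp add: mult_ac)
  also have "(\<Prod>j\<in>idx. pochhammer (e j - a i) N) / (\<Prod>j\<in>idx. D 0 j) = fin_res a e N i 0"
    by (simp only: fin_res_def D_def of_nat_0 diff_0_right)
  finally show ?thesis .
qed

lemma res_factor_expansion:
  assumes bal: "sum e idx - sum a idx = 2"
  shows "((\<lambda>q. (res_factor a e i q - 1) / (1 / of_nat q)) \<longlongrightarrow> -2) sequentially"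
proof -
  have "((\<lambda>q. (((1 / (1 / of_nat q) + (a 0 - a i)) * (1 / (1 / of_nat q) + (a 1 - a i)) * (1 / (1 / of_nat q) + (a 2 - a i)) * (1 / (1 / of_nat q) + (a 3 - a i)))
     / ((1 / (1 / of_nat q) + (e 0 - a i)) * (1 / (1 / of_nat q) + (e 1 - a i)) * (1 / (1 / of_nat q) + (e 2 - a i)) * (1 / (1 / of_nat q) + (e 3 - a i))) - 1) / (1 / of_nat q)) \<longlongrightarrow> -2) sequentially"
  proof (rule expansion_quotient4)
    show "((\<lambda>q. 1 / of_nat q :: complex) \<longlongrightarrow> 0) sequentially" by (rule lim_1_over_n)
    show "eventually (\<lambda>q. 1 / of_nat q \<noteq> (0 :: complex)) sequentially"
      using eventually_gt_at_top[of 0] by eventually_elim simp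
    have "(a 0 - a i) + (a 1 - a i) + (a 2 - a i) + (a 3 - a i) - ((e 0 - a i) + (e 1 - a i) + (e 2 - a i) + (e 3 - a i))
      = - (sum e idx - sum a idx)"
      by simp
    then show "(a 0 - a i) + (a 1 - a i) + (a 2 - a i) + (a 3 - a i) - ((e 0 - a i) + (e 1 - a i) + (e 2 - a i) + (e 3 - a i)) = -2"
      unfolding bal by simp
  qed (rule tendsto_const)+
  moreover have "res_factor a e i q = ((1 / (1 / of_nat q) + (a 0 - a i)) * (1 / (1 / of_nat q) + (a 1 - a i)) * (1 / (1 / of_nat q) + (a 2 - a i)) * (1 / (1 / of_nat q) + (a 3 - a i)))
     / ((1 / (1 / of_nat q) + (e 0 - a i)) * (1 / (1 / of_nat q) + (e 1 - a i)) * (1 / (1 / of_nat q) + (e 2 - a i)) * (1 / (1 / of_nat q) + (e 3 - a i)))" for q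
    by (simp add: res_factor_def add.commute mult.assoc)
  ultimately show ?thesis by (simp only:)
qed

lemma res_factor_tendsto_1:
  assumes bal: "sum e idx - sum a idx = 2"
  shows "res_factor a e i \<longlonglongrightarrow> 1"
proof (rule expansion_tendsto_1[OF lim_1_over_n _ res_factor_expansion[OF bal]])
  show "eventually (\<lambda>q. 1 / of_nat q \<noteq> (0 :: complex)) sequentially"
    using eventually_gt_at_top[of 0] by eventually_elim simp
qed

text \<open>The expansion \<open>1 - 2 / q\<close> shows that factors of large index have norm at
  most 1. Only a fixed finite set of indices can push the product above 1, whatever \<open>N\<close>
  and \<open>m\<close> are.\<close>

lemma res_factor_prod_bound:
  assumes bal: "sum e idx - sum a idx = 2"
  obtains K where "\<And>N m. m \<le> N \<Longrightarrow> norm (\<Prod>l<m. res_factor a e i (N - m + l)) \<le> K"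
proof -
  define t where "t = res_factor a e i"
  have "eventually (\<lambda>q. dist ((t q - 1) / (1 / of_nat q)) (-2) < 1) sequentially"
    using res_factor_expansion[OF bal] unfolding t_def by (rule tendstoD) simp
  then have "eventually (\<lambda>q. norm (t q) \<le> 1) sequentially"
    using eventually_ge_at_top[of 2]
  proof eventually_elim
    case (elim q)
    define w where "w = (t q - 1) * of_nat q + 2"
    have "norm w < 1"
      using elim(1) by (simp add: dist_norm w_def)
    have q0: "(of_nat q :: complex) \<noteq> 0" using elim(2) by simp
    have "t q = (of_nat q - 2 + w) / of_nat q"
      using q0 by (simp add: w_def field_simps)
    moreover have "norm (of_nat q - 2 + w) \<le> real q"
    proof -
      have "(of_nat q - 2 :: complex) = of_nat (q - 2)" using elim(2) by (simp add: of_nat_diff)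
      then have "norm (of_nat q - 2 :: complex) = real (q - 2)" by (simp only: norm_of_nat)
      then show ?thesis using norm_triangle_ineq[of "of_nat q - 2" w] \<open>norm w < 1\<close> elim(2) by simp
    qed
    ultimately show ?case
      using elim(2) by (simp add: norm_divide)
  qed
  then obtain Q where Q: "\<And>q. q \<ge> Q \<Longrightarrow> norm (t q) \<le> 1"
    by (auto simp: eventually_at_top_linorder)
  show ?thesis
  proof (rule that)
    fix N m :: nat assume m: "m \<le> N"
    have "(\<Prod>l<m. norm (t (N - m + l))) = (\<Prod>q\<in>{N - m..<N}. norm (t q))"
      using m by (intro prod.reindex_bij_witness[where i = "\<lambda>q. q - (N - m)" and j = "\<lambda>l. N - m + l"]) auto
    also have "\<dots> \<le> (\<Prod>q\<in>{N - m..<N}. max 1 (norm (t q)))"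
      by (intro prod_mono) auto
    also have "\<dots> \<le> (\<Prod>q<N + Q. max 1 (norm (t q)))"
      by (intro prod_mono2) auto
    also have "\<dots> = (\<Prod>q<Q. max 1 (norm (t q)))"
      using Q by (intro prod.mono_neutral_right) (auto simp: max_absorb1)
    finally show "norm (\<Prod>l<m. res_factor a e i (N - m + l)) \<le> (\<Prod>q<Q. max 1 (norm (t q)))"
      by (simp add: prod_norm t_def)
  qed
qed

text \<open>The conditions on differences keep the poles simple and uncancelled; \<open>aI\<close>
  keeps them off the integers, over which \<open>gratio\<close> is summed later. Balance and
  differences survive a common translation of all parameters, so the locale can be entered again at
  translated parameters.\<close>

locale balanced_gratio =
  fixes a e :: "nat \<Rightarrow> complex"
  assumes bal: "sum e idx - sum a idx = 2"
    and aI: "\<And>i. i \<in> idx \<Longrightarrow> a i \<notin> \<int>"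
    and ae: "\<And>i j. i \<in> idx \<Longrightarrow> j \<in> idx \<Longrightarrow> e j - a i \<notin> \<int>"
    and aa: "\<And>i j. i \<in> idx \<Longrightarrow> j \<in> idx \<Longrightarrow> i \<noteq> j \<Longrightarrow> a j - a i \<notin> \<int>"
begin

definition res where "res i m = res0 a e i * res_ratio a e i m"

lemma fin_res_0_limit:
  assumes i: "i \<in> idx"
  shows "(\<lambda>N. fin_res a e N i 0 / of_nat N ^ 2) \<longlonglongrightarrow> res0 a e i"
proof -
  define p where "p = (\<lambda>j. e j - a i)"
  \<comment> \<open>At \<open>j = i\<close> the zero factor is missing and
    \<open>fact (N - 1)\<close> remains. Using the parameter 1 there costs one factor
    \<open>N\<close>, which together with the exponent \<open>-1\<close> accounts for the division
    by \<open>N ^ 2\<close>.\<close>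
  define q where "q = (\<lambda>j. if j = i then 1 else a j - a i)"
  have sq: "sum q idx = 1 + (\<Sum>j\<in>idx. a j - a i)"
  proof -
    have "sum q idx = (\<Sum>j\<in>idx. (a j - a i) + (if j = i then 1 else 0))"
      by (rule sum.cong) (auto simp: q_def)
    also have "\<dots> = (\<Sum>j\<in>idx. a j - a i) + 1"
      using i unfolding sum.distrib by (subst sum.delta) auto
    finally show ?thesis by simp
  qed
  have s: "sum q idx - sum p idx = -1"
  proof -
    have "sum q idx - sum p idx = 1 - (sum e idx - sum a idx)"
      unfolding sq p_def sum_subtractf by simp
    then show ?thesis unfolding bal by simp
  qed
  have A: "(\<lambda>n. (\<Prod>j\<in>idx. pochhammer (p j) n) / (\<Prod>j\<in>idx. pochhammer (q j) n)
           * exp ((sum q idx - sum p idx) * of_real (ln (of_nat n))))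
    \<longlonglongrightarrow> (\<Prod>j\<in>idx. rGamma (p j)) * (\<Prod>j\<in>idx. Gamma (q j))"
    by (rule pochhammer_ratio_limit_idx) (use aa[OF i] in \<open>auto simp: q_def not_nonpos_Ints\<close>)
  have B: "(\<Prod>j\<in>idx. rGamma (p j)) * (\<Prod>j\<in>idx. Gamma (q j)) = res0 a e i"
  proof -
    have "Gamma (q j) = (if j = i then 1 else Gamma (a j - a i))" for j by (simp add: q_def)
    then show ?thesis unfolding res0_def p_def by (simp only: mult.commute)
  qed
  have C: "eventually (\<lambda>n. (\<Prod>j\<in>idx. pochhammer (p j) n) / (\<Prod>j\<in>idx. pochhammer (q j) n)
           * exp ((sum q idx - sum p idx) * of_real (ln (of_nat n))) = fin_res a e n i 0 / of_nat n ^ 2) sequentially"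
    using eventually_gt_at_top[of 0]
  proof eventually_elim
    case (elim n)
    define D where "D = (\<lambda>j. if j = i then \<Prod>k\<in>{..<n} - {0}. of_nat k - of_nat 0 else pochhammer (a j - a i - of_nat 0) n :: complex)"
    have "(\<Prod>k\<in>{..<n} - {0}. of_nat k :: complex) = fact (n - 1)"
    proof -
      have "{..<n} - {0} = {1..n - 1}" using elim by auto
      then show ?thesis by (simp add: fact_prod)
    qed
    moreover have "fact n = of_nat n * (fact (n - 1) :: complex)"
      using elim by (rule fact_reduce)
    ultimately have "pochhammer (q j) n = D j * (if j = i then of_nat n else 1)" for j
      by (simp add: q_def D_def pochhammer_fact[symmetric])
    then have "(\<Prod>j\<in>idx. pochhammer (q j) n) = (\<Prod>j\<in>idx. D j) * (\<Prod>j\<in>idx. if j = i then of_nat n else 1)"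
      by (simp only: prod.distrib)
    also have "(\<Prod>j\<in>idx. if j = i then of_nat n else 1) = (of_nat n :: complex)"
      using i by (subst prod.delta) auto
    finally have pq: "(\<Prod>j\<in>idx. pochhammer (q j) n) = (\<Prod>j\<in>idx. D j) * of_nat n" .
    have ex: "exp ((sum q idx - sum p idx) * of_real (ln (of_nat n))) = (1 / of_nat n :: complex)"
      unfolding s using exp_ln_powers(3)[OF elim] by simp
    have fr: "fin_res a e n i 0 = (\<Prod>j\<in>idx. pochhammer (p j) n) / (\<Prod>j\<in>idx. D j)"
      by (simp only: fin_res_def D_def p_def of_nat_0 diff_0_right)
    show ?case unfolding pq ex fr by (simp add: power2_eq_square mult_ac)
  qed
  show ?thesis
    using Lim_transform_eventually[OF A C] unfolding B .
qed

lemma fin_res_ratio: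
  assumes i: "i \<in> idx" and m: "m < N"
  shows "fin_res a e N i m = fin_res a e N i 0 * res_ratio a e i m * (\<Prod>l<m. res_factor a e i (N - m + l))"
proof (rule fin_res_eq[OF i m])
  fix j
  assume j: "j \<in> idx"
  show "e j - a i \<notin> \<int>" by (rule ae[OF i j])
  assume "j \<noteq> i"
  then show "a j - a i \<notin> \<int>" by (intro aa[OF i j]) (rule not_sym)
qed

lemma fin_res_limit:
  assumes i: "i \<in> idx"
  shows "(\<lambda>N. fin_res a e N i m / of_nat N ^ 2) \<longlonglongrightarrow> res i m"
proof -
  have "(\<lambda>N. res_factor a e i (N - m + l)) \<longlonglongrightarrow> 1" for l
  proof (rule filterlim_compose[OF res_factor_tendsto_1[OF bal]])
    show "filterlim (\<lambda>N. N - m + l) sequentially sequentially"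
      by (rule filterlim_at_top_mono[where f = "\<lambda>N. N - m"])
         (auto intro: filterlim_minus_const_nat_at_top always_eventually)
  qed
  then have "(\<lambda>N. fin_res a e N i 0 / of_nat N ^ 2 * res_ratio a e i m * (\<Prod>l<m. res_factor a e i (N - m + l)))
     \<longlonglongrightarrow> res0 a e i * res_ratio a e i m * (\<Prod>l<m. 1)"
    by (intro tendsto_mult fin_res_0_limit[OF i] tendsto_const tendsto_prod)
  moreover have "eventually (\<lambda>N. fin_res a e N i 0 / of_nat N ^ 2 * res_ratio a e i m * (\<Prod>l<m. res_factor a e i (N - m + l))
      = fin_res a e N i m / of_nat N ^ 2) sequentially"
    using eventually_gt_at_top[of m]
  proof eventually_elim
    case (elim N)
    show ?case
      unfolding fin_res_ratio[OF i elim] by (simp add: mult_ac)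
  qed
  ultimately have "(\<lambda>N. fin_res a e N i m / of_nat N ^ 2) \<longlonglongrightarrow> res0 a e i * res_ratio a e i m * (\<Prod>l<m. 1)"
    by (rule Lim_transform_eventually)
  then show ?thesis by (simp add: res_def)
qed

lemma res_ratio_bound:
  assumes i: "i \<in> idx"
  obtains K where "\<And>m. norm (res_ratio a e i m) \<le> K / (real m + 1) ^ 2"
proof -
  define p q where "p = (\<lambda>j. 1 + a i - e j)" and "q = (\<lambda>j. 1 + a i - a j)"
  have s: "sum q idx - sum p idx = 2"
  proof -
    have "sum q idx - sum p idx = sum e idx - sum a idx"
      unfolding p_def q_def sum_subtractf sum.distrib by simp
    then show ?thesis unfolding bal .
  qed
  have qI: "q j \<notin> \<int>\<^sub>\<le>\<^sub>0" if "j \<in> idx" for j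
  proof (cases "j = i")
    case False
    then have "q j \<notin> \<int>" using not_Ints_shift[OF aa[OF i that], of "q j"] by (auto simp: q_def)
    then show ?thesis by (rule not_nonpos_Ints)
  qed (simp add: q_def)
  have "(\<lambda>n. (\<Prod>j\<in>idx. pochhammer (p j) n) / (\<Prod>j\<in>idx. pochhammer (q j) n)
           * exp ((sum q idx - sum p idx) * of_real (ln (of_nat n))))
    \<longlonglongrightarrow> (\<Prod>j\<in>idx. rGamma (p j)) * (\<Prod>j\<in>idx. Gamma (q j))" (is "?t \<longlonglongrightarrow> _")
    by (rule pochhammer_ratio_limit_idx) (rule qI)
  then have "Bseq ?t" by (intro convergent_imp_Bseq) (auto simp only: convergent_def)
  then obtain K where K: "K > 0" "\<And>n. norm (?t n) \<le> K"
    unfolding Bseq_def by blast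
  have t: "?t m = res_ratio a e i m * of_nat m ^ 2" if "m > 0" for m
    unfolding s using exp_ln_powers(1)[OF that] by (simp only: res_ratio_def p_def q_def)
  have 0: "res_ratio a e i 0 = 1" by (simp add: res_ratio_def)
  show ?thesis
  proof (rule that[of "4 * K + 1"])
    fix m
    show "norm (res_ratio a e i m) \<le> (4 * K + 1) / (real m + 1) ^ 2"
    proof (cases "m = 0")
      case True
      then show ?thesis using K(1) 0 by simp
    next
      case False
      then have "norm (res_ratio a e i m) * real m ^ 2 \<le> K"
        using K(2)[of m] t[of m] by (simp add: norm_mult norm_power)
      moreover have "(real m + 1) ^ 2 \<le> 4 * real m ^ 2"
      proof -
        have "(real m + 1) ^ 2 \<le> (2 * real m) ^ 2" using False by (intro power_mono) auto
        then show ?thesis by (simp add: power2_eq_square)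
      qed
      ultimately have "norm (res_ratio a e i m) * (real m + 1) ^ 2 \<le> 4 * K"
        using mult_left_mono[of "(real m + 1) ^ 2" "4 * real m ^ 2" "norm (res_ratio a e i m)"] by simp
      then show ?thesis by (simp add: pos_le_divide_eq)
    qed
  qed
qed

lemma fin_res_bound:
  assumes i: "i \<in> idx"
  obtains K where "K \<ge> 0" "\<And>N m. m < N \<Longrightarrow> norm (fin_res a e N i m / of_nat N ^ 2) \<le> K / (real m + 1) ^ 2"
proof -
  obtain K1 where K1: "\<And>m. norm (res_ratio a e i m) \<le> K1 / (real m + 1) ^ 2"
    using res_ratio_bound[OF i] by blast
  obtain K2 where K2: "\<And>N m. m \<le> N \<Longrightarrow> norm (\<Prod>l<m. res_factor a e i (N - m + l)) \<le> K2"
    using res_factor_prod_bound[OF bal] by blast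
  have "Bseq (\<lambda>N. fin_res a e N i 0 / of_nat N ^ 2)"
    using fin_res_0_limit[OF i] by (intro convergent_imp_Bseq) (auto simp only: convergent_def)
  then obtain K3 where K3: "K3 > 0" "\<And>N. norm (fin_res a e N i 0 / of_nat N ^ 2) \<le> K3"
    unfolding Bseq_def by blast
  have K10: "K1 \<ge> 0" using order_trans[OF norm_ge_zero K1[of 0]] by simp
  have K20: "K2 \<ge> 0" using K2[of 0 0] by simp
  show ?thesis
  proof (rule that[of "K3 * K1 * K2"])
    show "0 \<le> K3 * K1 * K2" using K10 K20 K3(1) by simp
    fix N m :: nat assume m: "m < N"
    have "norm (fin_res a e N i m / of_nat N ^ 2) =
       norm (fin_res a e N i 0 / of_nat N ^ 2) * norm (res_ratio a e i m) * norm (\<Prod>l<m. res_factor a e i (N - m + l))"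
      unfolding fin_res_ratio[OF i m] by (simp add: norm_mult norm_divide mult_ac)
    also have "\<dots> \<le> K3 * (K1 / (real m + 1) ^ 2) * K2"
      using K10 K3(1) m by (intro mult_mono K3(2) K1 K2) auto
    finally show "norm (fin_res a e N i m / of_nat N ^ 2) \<le> K3 * K1 * K2 / (real m + 1) ^ 2"
      by (simp add: mult_ac)
  qed
qed

lemma summable_inverse_Suc_square: "summable (\<lambda>m. K / (real m + 1) ^ 2)"
proof -
  have "summable (\<lambda>m. inverse (real (Suc m) ^ 2))"
    using inverse_power_summable[of 2, where ?'a = real] by (subst summable_Suc_iff) simp
  then have "summable (\<lambda>m. K * inverse (real (Suc m) ^ 2))"
    by (rule summable_mult)
  then show ?thesis
    by (simp add: divide_inverse add.commute)
qed

text \<open>Tannery's theorem for the residues. The weights will be \<open>1 / (s + a i + m)\<close>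
  for the expansion itself and \<open>1\<close> for the sum of the residues.\<close>

lemma weighted_fin_res_limit:
  assumes i: "i \<in> idx" and w: "\<And>m. norm (w m) \<le> D"
  shows "(\<lambda>N. \<Sum>m<N. fin_res a e N i m / of_nat N ^ 2 * w m) \<longlonglongrightarrow> (\<Sum>m. res i m * w m)"
proof -
  obtain K where K0: "K \<ge> 0" and K: "\<And>N m. m < N \<Longrightarrow> norm (fin_res a e N i m / of_nat N ^ 2) \<le> K / (real m + 1) ^ 2"
    using fin_res_bound[OF i] by blast
  have D0: "D \<ge> 0" using w[of 0] norm_ge_zero[of "w 0"] by linarith
  define t where "t = (\<lambda>m N. if m < N then fin_res a e N i m / of_nat N ^ 2 * w m else 0)"
  have lim: "t m \<longlonglongrightarrow> res i m * w m" for m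
  proof -
    have "(\<lambda>N. fin_res a e N i m / of_nat N ^ 2 * w m) \<longlonglongrightarrow> res i m * w m"
      by (intro tendsto_mult fin_res_limit[OF i] tendsto_const)
    moreover have "eventually (\<lambda>N. fin_res a e N i m / of_nat N ^ 2 * w m = t m N) sequentially"
      using eventually_gt_at_top[of m] by eventually_elim (simp add: t_def)
    ultimately show ?thesis by (rule Lim_transform_eventually)
  qed
  have "norm (t m N) \<le> K * D / (real m + 1) ^ 2" for m N
  proof (cases "m < N")
    case True
    then have "norm (t m N) = norm (fin_res a e N i m / of_nat N ^ 2) * norm (w m)"
      by (simp add: t_def norm_mult norm_divide)
    also have "\<dots> \<le> K / (real m + 1) ^ 2 * D"
      using K0 by (intro mult_mono K True w) auto
    finally show ?thesis by (simp add: mult_ac)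
  next
    case False
    then show ?thesis using K0 D0 by (simp add: t_def)
  qed
  then have bd: "eventually (\<lambda>(m, N). norm (t m N) \<le> K * D / (real m + 1) ^ 2) (at_top \<times>\<^sub>F sequentially)"
    by (intro always_eventually) auto
  have "(\<lambda>N. \<Sum>m. t m N) \<longlonglongrightarrow> (\<Sum>m. res i m * w m)"
    using tannerys_theorem[OF lim bd summable_inverse_Suc_square] by auto
  moreover have "(\<Sum>m. t m N) = (\<Sum>m<N. fin_res a e N i m / of_nat N ^ 2 * w m)" for N
  proof -
    have "(\<Sum>m. t m N) = (\<Sum>m<N. t m N)"
      by (rule suminf_finite) (auto simp: t_def)
    then show ?thesis by (simp add: t_def)
  qed
  ultimately show ?thesis by simp
qed

lemma res_bound:
  assumes i: "i \<in> idx"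
  obtains K where "K \<ge> 0" "\<And>m. norm (res i m) \<le> K / (real m + 1) ^ 2"
proof -
  obtain K1 where K1: "\<And>m. norm (res_ratio a e i m) \<le> K1 / (real m + 1) ^ 2"
    using res_ratio_bound[OF i] by blast
  have K10: "K1 \<ge> 0" using order_trans[OF norm_ge_zero K1[of 0]] by simp
  show ?thesis
  proof (rule that[of "norm (res0 a e i) * K1"])
    show "0 \<le> norm (res0 a e i) * K1" using K10 by simp
    fix m
    have "norm (res i m) \<le> norm (res0 a e i) * (K1 / (real m + 1) ^ 2)"
      unfolding res_def norm_mult by (intro mult_left_mono K1) auto
    then show "norm (res i m) \<le> norm (res0 a e i) * K1 / (real m + 1) ^ 2" by simp
  qed
qed

lemma fin_res_residue:
  assumes i: "i \<in> idx" and m: "m < N"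
  shows "((- a i - of_nat m) - (- e i - of_nat m)) *
      (\<Prod>(j, k)\<in>idx \<times> {..<N} - {(i, m)}. ((- a i - of_nat m) - (- e j - of_nat k)) / ((- a i - of_nat m) - (- a j - of_nat k)))
    = fin_res a e N i m"
proof -
  define X Y where "X = (\<lambda>(j, k). e j - a i - of_nat m + of_nat k)" and "Y = (\<lambda>(j, k). a j - a i - of_nat m + of_nat k)"
  have fin: "finite (idx \<times> {..<N})" and mem: "(i, m) \<in> idx \<times> {..<N}" using i m by auto
  have "((- a i - of_nat m) - (- e i - of_nat m)) = X (i, m)"
    by (simp add: X_def)
  moreover have "(\<Prod>(j, k)\<in>idx \<times> {..<N} - {(i, m)}. ((- a i - of_nat m) - (- e j - of_nat k)) / ((- a i - of_nat m) - (- a j - of_nat k)))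
    = (\<Prod>z\<in>idx \<times> {..<N} - {(i, m)}. X z / Y z)"
    by (rule prod.cong) (auto simp: X_def Y_def algebra_simps)
  ultimately have "((- a i - of_nat m) - (- e i - of_nat m)) *
      (\<Prod>(j, k)\<in>idx \<times> {..<N} - {(i, m)}. ((- a i - of_nat m) - (- e j - of_nat k)) / ((- a i - of_nat m) - (- a j - of_nat k)))
    = (\<Prod>z\<in>idx \<times> {..<N}. X z) / (\<Prod>z\<in>idx \<times> {..<N} - {(i, m)}. Y z)"
    using prod.remove[OF fin mem, of X] by (simp only: prod_dividef) simp
  also have "(\<Prod>z\<in>idx \<times> {..<N}. X z) = (\<Prod>j\<in>idx. \<Prod>k<N. X (j, k))"
    by (simp add: prod.cartesian_product split_def)
  also have "(\<Prod>j\<in>idx. \<Prod>k<N. X (j, k)) = (\<Prod>j\<in>idx. pochhammer (e j - a i - of_nat m) N)"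
    by (simp only: X_def split_conv pochhammer_prod atLeast0LessThan)
  also have "(\<Prod>z\<in>idx \<times> {..<N} - {(i, m)}. Y z) =
     (\<Prod>j\<in>idx. if j = i then \<Prod>k\<in>{..<N} - {m}. of_nat k - of_nat m else pochhammer (a j - a i - of_nat m) N)"
  proof -
    have "idx \<times> {..<N} - {(i, m)} = (SIGMA j:idx. if j = i then {..<N} - {m} else {..<N})"
      by (auto split: if_splits)
    then have "(\<Prod>z\<in>idx \<times> {..<N} - {(i, m)}. Y z) = (\<Prod>z\<in>(SIGMA j:idx. if j = i then {..<N} - {m} else {..<N}). case z of (j, k) \<Rightarrow> Y (j, k))"
      by (simp only: split_def prod.collapse)
    also have "\<dots> = (\<Prod>j\<in>idx. \<Prod>k\<in>(if j = i then {..<N} - {m} else {..<N}). Y (j, k))"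
      by (rule prod.Sigma[symmetric]) auto
    also have "\<dots> = (\<Prod>j\<in>idx. if j = i then \<Prod>k\<in>{..<N} - {m}. of_nat k - of_nat m else pochhammer (a j - a i - of_nat m) N)"
      by (rule prod.cong[OF refl]) (simp add: Y_def pochhammer_prod atLeast0LessThan add.commute)
    finally show ?thesis .
  qed
  finally show ?thesis unfolding fin_res_def .
qed

text \<open>The poles \<open>- a i - m\<close> are pairwise distinct because differences of the
  \<open>a i\<close> are not integers. Each of the \<open>N\<close> layers contributes the excess 2
  to the sum of residues.\<close>

lemma finite_partial_fractions:
  shows "(\<And>j. j \<in> idx \<Longrightarrow> a j + s \<notin> \<int>) \<Longrightarrow>
      (\<Prod>j\<in>idx. pochhammer (e j + s) N) / (\<Prod>j\<in>idx. pochhammer (a j + s) N)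
        = 1 + (\<Sum>i\<in>idx. \<Sum>m<N. fin_res a e N i m / (s + a i + of_nat m))"
    and "(\<Sum>i\<in>idx. \<Sum>m<N. fin_res a e N i m) = 2 * of_nat N"
proof -
  define J where "J = idx \<times> {..<N}"
  define x where "x = (\<lambda>(i, m). - a i - of_nat m)"
  define y where "y = (\<lambda>(i, m). - e i - of_nat m)"
  have fin: "finite J" by (simp add: J_def)
  have inj: "inj_on x J"
  proof (rule inj_onI)
    fix u v assume u: "u \<in> J" and v: "v \<in> J" and eq: "x u = x v"
    obtain i m j k where uv: "u = (i, m)" "v = (j, k)" by (cases u; cases v)
    have d: "a j - a i = of_nat m - of_nat k" using eq by (simp add: uv x_def algebra_simps)
    have "i = j"
    proof (rule ccontr)
      assume "i \<noteq> j"
      then have "a j - a i \<notin> \<int>" using aa[of i j] u v by (auto simp: uv J_def)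
      then show False unfolding d by simp
    qed
    then show "u = v" using d by (simp add: uv)
  qed
  define r where "r = (\<lambda>z. (x z - y z) * (\<Prod>w\<in>J - {z}. (x z - y w) / (x z - x w)))"
  have r: "r (i, m) = fin_res a e N i m" if "i \<in> idx" "m < N" for i m
    using fin_res_residue[OF that] by (simp only: r_def x_def y_def J_def split_def fst_conv snd_conv)
  show "(\<Prod>j\<in>idx. pochhammer (e j + s) N) / (\<Prod>j\<in>idx. pochhammer (a j + s) N)
        = 1 + (\<Sum>i\<in>idx. \<Sum>m<N. fin_res a e N i m / (s + a i + of_nat m))"
    if "\<And>j. j \<in> idx \<Longrightarrow> a j + s \<notin> \<int>"
  proof -
    have s: "s \<notin> x ` J"
    proof
      assume "s \<in> x ` J"
      then obtain i m where "i \<in> idx" "s = - a i - of_nat m" by (auto simp: J_def x_def)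
      then show False using that[of i] by simp
    qed
    have "(\<Prod>z\<in>J. (s - y z) / (s - x z)) = (\<Prod>j\<in>idx. \<Prod>m<N. (e j + s + of_nat m) / (a j + s + of_nat m))"
      unfolding J_def prod.cartesian_product by (rule prod.cong) (auto simp: x_def y_def algebra_simps)
    also have "\<dots> = (\<Prod>j\<in>idx. pochhammer (e j + s) N) / (\<Prod>j\<in>idx. pochhammer (a j + s) N)"
      by (simp only: pochhammer_prod atLeast0LessThan prod_dividef)
    finally have "(\<Prod>j\<in>idx. pochhammer (e j + s) N) / (\<Prod>j\<in>idx. pochhammer (a j + s) N) = 1 + (\<Sum>z\<in>J. r z / (s - x z))"
      using partial_fractions(1)[OF fin inj s, of y] unfolding r_def by simp
    also have "(\<Sum>z\<in>J. r z / (s - x z)) = (\<Sum>i\<in>idx. \<Sum>m<N. r (i, m) / (s - x (i, m)))"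
      unfolding J_def sum.cartesian_product by (rule sum.cong) auto
    also have "\<dots> = (\<Sum>i\<in>idx. \<Sum>m<N. fin_res a e N i m / (s + a i + of_nat m))"
      by (intro sum.cong refl) (simp only: lessThan_iff r, simp add: x_def add.assoc)
    finally show ?thesis .
  qed
  have "(\<Sum>z\<in>J. r z) = (\<Sum>i\<in>idx. \<Sum>m<N. r (i, m))"
    unfolding J_def sum.cartesian_product by (rule sum.cong) auto
  also have "\<dots> = (\<Sum>i\<in>idx. \<Sum>m<N. fin_res a e N i m)"
    by (intro sum.cong refl) (simp only: lessThan_iff r)
  finally have 1: "(\<Sum>z\<in>J. r z) = (\<Sum>i\<in>idx. \<Sum>m<N. fin_res a e N i m)" .
  have "(\<Sum>z\<in>J. x z - y z) = (\<Sum>i\<in>idx. \<Sum>m<N. e i - a i)"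
    unfolding J_def sum.cartesian_product by (rule sum.cong) (auto simp: x_def y_def)
  also have "\<dots> = of_nat N * (sum e idx - sum a idx)"
    by (simp add: algebra_simps)
  finally have 2: "(\<Sum>z\<in>J. x z - y z) = 2 * of_nat N" unfolding bal by simp
  show "(\<Sum>i\<in>idx. \<Sum>m<N. fin_res a e N i m) = 2 * of_nat N"
    using partial_fractions(2)[OF fin inj, of y] unfolding r_def[symmetric] 1 2 .
qed

text \<open>Division by \<open>N ^ 2\<close> turns the quotient of Pochhammer symbols into an
  approximation of \<open>gratio\<close>; at the same time it removes the constant 1 and normalizes
  the residues to their limits.\<close>

lemma gratio_partial_fractions:
  assumes s: "\<And>j. j \<in> idx \<Longrightarrow> a j + s \<notin> \<int>"
  shows "gratio a e s = (\<Sum>i\<in>idx. \<Sum>m. res i m * (1 / (s + a i + of_nat m)))"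
proof -
  have "(\<lambda>n. (\<Prod>j\<in>idx. pochhammer (e j + s) n) / (\<Prod>j\<in>idx. pochhammer (a j + s) n)
           * exp (((\<Sum>j\<in>idx. a j + s) - (\<Sum>j\<in>idx. e j + s)) * of_real (ln (of_nat n))))
    \<longlonglongrightarrow> (\<Prod>j\<in>idx. rGamma (e j + s)) * (\<Prod>j\<in>idx. Gamma (a j + s))"
    by (rule pochhammer_ratio_limit_idx) (rule not_nonpos_Ints, rule s)
  moreover have "eventually (\<lambda>n. (\<Prod>j\<in>idx. pochhammer (e j + s) n) / (\<Prod>j\<in>idx. pochhammer (a j + s) n)
           * exp (((\<Sum>j\<in>idx. a j + s) - (\<Sum>j\<in>idx. e j + s)) * of_real (ln (of_nat n)))
     = 1 / of_nat n ^ 2 + (\<Sum>i\<in>idx. \<Sum>m<n. fin_res a e n i m / of_nat n ^ 2 * (1 / (s + a i + of_nat m)))) sequentially"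
    using eventually_gt_at_top[of 0]
  proof eventually_elim
    case (elim n)
    have "(\<Sum>j\<in>idx. a j + s) - (\<Sum>j\<in>idx. e j + s) = - (sum e idx - sum a idx)"
      by (simp only: sum.distrib) simp
    then have ex: "exp (((\<Sum>j\<in>idx. a j + s) - (\<Sum>j\<in>idx. e j + s)) * of_real (ln (of_nat n))) = (1 / of_nat n ^ 2 :: complex)"
      unfolding bal using exp_ln_powers(2)[OF elim] by simp
    have "(\<Sum>i\<in>idx. \<Sum>m<n. fin_res a e n i m / of_nat n ^ 2 * (1 / (s + a i + of_nat m)))
       = (\<Sum>i\<in>idx. \<Sum>m<n. fin_res a e n i m / (s + a i + of_nat m)) * (1 / of_nat n ^ 2)"
      by (simp only: sum_distrib_right) (intro sum.cong refl, simp add: mult_ac)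
    moreover have "(\<Prod>j\<in>idx. pochhammer (e j + s) n) / (\<Prod>j\<in>idx. pochhammer (a j + s) n)
        = 1 + (\<Sum>i\<in>idx. \<Sum>m<n. fin_res a e n i m / (s + a i + of_nat m))"
      by (rule finite_partial_fractions(1)) (rule s)
    ultimately show ?case
      unfolding ex by (simp only: distrib_right mult_1_left)
  qed
  ultimately have "(\<lambda>n. 1 / of_nat n ^ 2 + (\<Sum>i\<in>idx. \<Sum>m<n. fin_res a e n i m / of_nat n ^ 2 * (1 / (s + a i + of_nat m))))
     \<longlonglongrightarrow> (\<Prod>j\<in>idx. rGamma (e j + s)) * (\<Prod>j\<in>idx. Gamma (a j + s))"
    by (rule Lim_transform_eventually)
  moreover have "(\<lambda>n. 1 / of_nat n ^ 2 + (\<Sum>i\<in>idx. \<Sum>m<n. fin_res a e n i m / of_nat n ^ 2 * (1 / (s + a i + of_nat m))))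
     \<longlonglongrightarrow> 0 + (\<Sum>i\<in>idx. \<Sum>m. res i m * (1 / (s + a i + of_nat m)))"
  proof (intro tendsto_add tendsto_sum)
    have "(\<lambda>n. (1 / of_nat n) ^ 2 :: complex) \<longlonglongrightarrow> 0 ^ 2"
      by (intro tendsto_power lim_1_over_n)
    then show "(\<lambda>n. 1 / of_nat n ^ 2 :: complex) \<longlonglongrightarrow> 0" by (simp add: power_divide)
    fix i assume i: "i \<in> idx"
    have "(\<lambda>m. 1 / (s + a i + of_nat m)) \<longlonglongrightarrow> 0"
      by (intro tendsto_divide_0[OF tendsto_const] tendsto_add_filterlim_at_infinity[OF tendsto_const] tendsto_of_nat)
    then have "Bseq (\<lambda>m. 1 / (s + a i + of_nat m))"
      by (intro convergent_imp_Bseq) (auto simp only: convergent_def)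
    then obtain D where "\<And>m. norm (1 / (s + a i + of_nat m)) \<le> D"
      unfolding Bseq_def by blast
    then show "(\<lambda>n. \<Sum>m<n. fin_res a e n i m / of_nat n ^ 2 * (1 / (s + a i + of_nat m))) \<longlonglongrightarrow> (\<Sum>m. res i m * (1 / (s + a i + of_nat m)))"
      by (rule weighted_fin_res_limit[OF i])
  qed
  ultimately have "(\<Prod>j\<in>idx. rGamma (e j + s)) * (\<Prod>j\<in>idx. Gamma (a j + s))
      = 0 + (\<Sum>i\<in>idx. \<Sum>m. res i m * (1 / (s + a i + of_nat m)))"
    by (rule LIMSEQ_unique)
  then show ?thesis
    unfolding gratio_def by (simp only: mult.commute add_0)
qed

text \<open>The finite residues add up to \<open>2 N\<close>, which is negligible against the
  normalization by \<open>N ^ 2\<close>.\<close>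

lemma sum_res_eq_0: "(\<Sum>i\<in>idx. \<Sum>m. res i m) = 0"
proof -
  have A: "(\<lambda>n. \<Sum>i\<in>idx. \<Sum>m<n. fin_res a e n i m / of_nat n ^ 2 * 1) \<longlonglongrightarrow> (\<Sum>i\<in>idx. \<Sum>m. res i m * 1)"
    by (intro tendsto_sum weighted_fin_res_limit[where D = 1]) auto
  have B: "(\<lambda>n. \<Sum>i\<in>idx. \<Sum>m<n. fin_res a e n i m / of_nat n ^ 2 * 1) = (\<lambda>n. 2 * (1 / of_nat n))"
  proof
    fix n
    have "(\<Sum>i\<in>idx. \<Sum>m<n. fin_res a e n i m / of_nat n ^ 2 * 1) = (\<Sum>i\<in>idx. \<Sum>m<n. fin_res a e n i m) / of_nat n ^ 2"
      by (simp only: sum_divide_distrib mult_1_right)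
    then show "(\<Sum>i\<in>idx. \<Sum>m<n. fin_res a e n i m / of_nat n ^ 2 * 1) = 2 * (1 / of_nat n)"
      unfolding finite_partial_fractions(2) by (simp add: power2_eq_square)
  qed
  have C: "(\<lambda>n. 2 * (1 / of_nat n) :: complex) \<longlonglongrightarrow> 2 * 0"
    by (intro tendsto_mult tendsto_const lim_1_over_n)
  have "(\<Sum>i\<in>idx. \<Sum>m. res i m * 1) = 2 * 0"
    by (rule LIMSEQ_unique[OF A[unfolded B] C])
  then show ?thesis by (simp only: mult_1_right mult_zero_right)
qed

end

section \<open>Summation over the integers\<close>

lemma sin_pi_nz: "z \<notin> \<int> \<Longrightarrow> sin (of_real pi * z) \<noteq> (0 :: complex)"
  by (auto simp: sin_eq_0 Ints_def)

text \<open>Differentiate the reflection formula: \<open>G\<close> is constantly \<pi> off the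
  integers, so its derivative vanishes, and the common Gamma product can be cancelled.\<close>

lemma Digamma_reflection:
  fixes z :: complex
  assumes z: "z \<notin> \<int>"
  shows "Digamma (1 - z) - Digamma z = of_real pi * cot (of_real pi * z)"
proof -
  define G where "G = (\<lambda>w. Gamma w * Gamma (1 - w) * sin (of_real pi * w) :: complex)"
  have z1: "1 - z \<notin> \<int>" by (rule not_Ints_shift[OF z]) simp
  note nn = not_nonpos_Ints[OF z] not_nonpos_Ints[OF z1]
  have "(G has_field_derivative
      (Gamma z * Digamma z * Gamma (1 - z) + Gamma z * (Gamma (1 - z) * Digamma (1 - z) * (-1))) * sin (of_real pi * z)
        + Gamma z * Gamma (1 - z) * (cos (of_real pi * z) * of_real pi)) (at z)"
    unfolding G_def using nn by (auto intro!: derivative_eq_intros)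
  moreover have "(G has_field_derivative 0) (at z)"
  proof (rule has_field_derivative_transform_within_open[where S = "- \<int>" and f = "\<lambda>_. of_real pi"])
    show "open (- \<int> :: complex set)" by (intro open_Compl closed_Ints)
    show "complex_of_real pi = G w" if "w \<in> - \<int>" for w
      using Gamma_sin[of w] that by (simp add: G_def)
  qed (use z in auto)
  ultimately have "(Gamma z * Digamma z * Gamma (1 - z) + Gamma z * (Gamma (1 - z) * Digamma (1 - z) * (-1))) * sin (of_real pi * z)
        + Gamma z * Gamma (1 - z) * (cos (of_real pi * z) * of_real pi) = 0"
    by (rule DERIV_unique)
  then have "Gamma z * Gamma (1 - z) * ((Digamma (1 - z) - Digamma z) * sin (of_real pi * z)) =
      Gamma z * Gamma (1 - z) * (of_real pi * cos (of_real pi * z))"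
    by (simp add: algebra_simps)
  then have "(Digamma (1 - z) - Digamma z) * sin (of_real pi * z) = of_real pi * cos (of_real pi * z)"
    using Gamma_nz[OF z] Gamma_nz[OF z1] by simp
  then show ?thesis
    using sin_pi_nz[OF z] by (simp add: cot_def field_simps)
qed

text \<open>The symmetric truncation of the conditionally convergent expansion of the
  cotangent.\<close>

definition sym_sum :: "nat \<Rightarrow> complex \<Rightarrow> complex" where
  "sym_sum M z = (\<Sum>k=-int M..int M. 1 / (of_int k + z))"

lemma sym_sum_shift: "sym_sum M (z + 1) = sym_sum M z + (1 / (of_nat M + 1 + z) - 1 / (z - of_nat M))"
proof -
  have "sym_sum M (z + 1) = (\<Sum>k=-int M + 1..int M + 1. 1 / (of_int k + z))"
    unfolding sym_sum_def
    by (rule sum.reindex_bij_witness[where i = "\<lambda>k. k - 1" and j = "\<lambda>k. k + 1"]) (auto simp: add_ac)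
  moreover have "{-int M..int M + 1} = insert (- int M) {-int M + 1..int M + 1}"
    "{-int M..int M + 1} = insert (int M + 1) {-int M..int M}" by auto
  then have "insert (- int M) {-int M + 1..int M + 1} = insert (int M + 1) {-int M..int M}" by simp
  then have "(\<Sum>k\<in>insert (- int M) {-int M + 1..int M + 1}. 1 / (of_int k + z)) = (\<Sum>k\<in>insert (int M + 1) {-int M..int M}. 1 / (of_int k + z))"
    by simp
  then have "1 / (z - of_nat M) + (\<Sum>k=-int M + 1..int M + 1. 1 / (of_int k + z)) = 1 / (of_nat M + 1 + z) + sym_sum M z"
    unfolding sym_sum_def by simp
  ultimately show ?thesis by (simp add: algebra_simps)
qed

lemma inverse_of_nat_add_tendsto: "(\<lambda>n. 1 / (of_nat n + z :: complex)) \<longlonglongrightarrow> 0"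
  using tendsto_divide_0[OF tendsto_const[of 1] tendsto_add_filterlim_at_infinity[OF tendsto_const[of z] tendsto_of_nat]]
  by (simp add: add.commute)

text \<open>Nonnegative and negative indices give the approximants of \<open>Digamma\<close> at
  \<open>z\<close> and \<open>1 - z\<close>. The logarithms cancel, and the single unmatched term at
  \<open>k = M\<close> tends to 0.\<close>

lemma sym_sum_tendsto:
  fixes z :: complex
  assumes z: "z \<notin> \<int>"
  shows "(\<lambda>M. sym_sum M z) \<longlonglongrightarrow> of_real pi * cot (of_real pi * z)"
proof -
  have z0: "z \<noteq> 0" "1 - z \<noteq> 0" using z by auto
  have eq: "sym_sum M z = ((of_real (ln (real M)) - (\<Sum>n<M. inverse (1 - z + of_nat n))) - (of_real (ln (real M)) - (\<Sum>n<M. inverse (z + of_nat n))))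
      + 1 / (of_nat M + z)" for M
  proof -
    have "sym_sum M z = (\<Sum>k\<in>{-int M..-1} \<union> {0..<int M} \<union> {int M}. 1 / (of_int k + z))"
      unfolding sym_sum_def by (rule sum.cong) auto
    also have "\<dots> = (\<Sum>k\<in>{-int M..-1}. 1 / (of_int k + z)) + (\<Sum>k\<in>{0..<int M}. 1 / (of_int k + z)) + 1 / (of_nat M + z)"
      by (subst sum.union_disjoint, simp, simp, force, subst sum.union_disjoint) auto
    also have "(\<Sum>k\<in>{0..<int M}. 1 / (of_int k + z)) = (\<Sum>n<M. inverse (z + of_nat n))"
      by (rule sum.reindex_bij_witness[where i = int and j = nat]) (auto simp: inverse_eq_divide add.commute)
    also have "(\<Sum>k\<in>{-int M..-1}. 1 / (of_int k + z)) = (\<Sum>n<M. - inverse (1 - z + of_nat n))"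
    proof (rule sum.reindex_bij_witness[where i = "\<lambda>n. - int n - 1" and j = "\<lambda>k. nat (- k - 1)"])
      fix k assume k: "k \<in> {-int M..-1}"
      then have "int (nat (- k - 1)) = - k - 1" by simp
      from arg_cong[OF this, of "of_int :: int \<Rightarrow> complex"]
      have "of_nat (nat (- k - 1)) = (of_int (- k - 1) :: complex)"
        by (simp only: of_int_of_nat_eq)
      then have e: "1 - z + of_nat (nat (- k - 1)) = - (of_int k + z)" by simp
      show "- inverse (1 - z + of_nat (nat (- k - 1))) = 1 / (of_int k + z)"
        unfolding e by (simp only: inverse_minus_eq minus_minus inverse_eq_divide[symmetric])
    qed auto
    finally show ?thesis by (simp add: sum_negf)
  qed
  have "(\<lambda>M. ((of_real (ln (real M)) - (\<Sum>n<M. inverse (1 - z + of_nat n))) - (of_real (ln (real M)) - (\<Sum>n<M. inverse (z + of_nat n))))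
      + 1 / (of_nat M + z)) \<longlonglongrightarrow> (Digamma (1 - z) - Digamma z) + 0"
    by (intro tendsto_add tendsto_diff Digamma_LIMSEQ z0 inverse_of_nat_add_tendsto)
  then show ?thesis
    unfolding eq Digamma_reflection[OF z] by simp
qed

lemma inverse_of_nat_add_bound:
  fixes z :: complex
  assumes z: "z \<notin> \<int>"
  obtains D where "D > 0" "\<And>n. norm (1 / (of_nat n + z)) \<le> D / (real n + 1)"
proof -
  have "Bseq (\<lambda>n. 1 / (of_nat n + z))"
    using inverse_of_nat_add_tendsto[of z] by (intro convergent_imp_Bseq) (auto simp only: convergent_def)
  then obtain D where D: "D > 0" "\<And>n. norm (1 / (of_nat n + z)) \<le> D"
    unfolding Bseq_def by blast
  show ?thesis
  proof (rule that[of "1 + norm (1 - z) * D"])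
    show "1 + norm (1 - z) * D > 0" using D(1) by (simp add: add_pos_nonneg)
    fix n :: nat
    have nz: "of_nat n + z \<noteq> 0" by (rule not_Ints_nz, rule not_Ints_shift[OF z]) simp
    have "1 / (of_nat n + z) * (of_nat n + 1) = 1 + (1 - z) * (1 / (of_nat n + z))"
      using nz by (simp add: field_simps)
    then have "norm (1 / (of_nat n + z)) * norm (of_nat n + 1 :: complex) = norm (1 + (1 - z) * (1 / (of_nat n + z)))"
      by (metis norm_mult)
    also have "\<dots> \<le> 1 + norm (1 - z) * norm (1 / (of_nat n + z))"
      using norm_triangle_ineq[of 1 "(1 - z) * (1 / (of_nat n + z))"] by (simp only: norm_mult norm_one)
    also have "\<dots> \<le> 1 + norm (1 - z) * D"
      by (intro add_left_mono mult_left_mono D) auto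
    also have "norm (of_nat n + 1 :: complex) = real n + 1"
      using norm_of_nat[of "Suc n", where ?'a = complex] by (simp add: add.commute)
    finally show "norm (1 / (of_nat n + z)) \<le> (1 + norm (1 - z) * D) / (real n + 1)"
      by (simp only: pos_le_divide_eq)
  qed
qed

lemma inverse_of_int_add_bound:
  fixes z :: complex
  assumes z: "z \<notin> \<int>"
  obtains D where "D > 0" "\<And>k. norm (1 / (of_int k + z)) \<le> D / (real_of_int \<bar>k\<bar> + 1)"
proof -
  obtain D1 where D1: "D1 > 0" "\<And>n. norm (1 / (of_nat n + z)) \<le> D1 / (real n + 1)"
    using inverse_of_nat_add_bound[OF z] by blast
  have "- z \<notin> \<int>" by (rule not_Ints_shift[OF z]) simp
  then obtain D2 where D2: "D2 > 0" "\<And>n. norm (1 / (of_nat n + - z)) \<le> D2 / (real n + 1)"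
    using inverse_of_nat_add_bound by blast
  show ?thesis
  proof (rule that[of "D1 + D2"])
    show "D1 + D2 > 0" using D1 D2 by simp
    fix k :: int
    show "norm (1 / (of_int k + z)) \<le> (D1 + D2) / (real_of_int \<bar>k\<bar> + 1)"
    proof (cases "k \<ge> 0")
      case True
      then obtain n where k: "k = int n" using nonneg_int_cases by blast
      have "D1 / (real n + 1) \<le> (D1 + D2) / (real n + 1)" using D2(1) by (intro divide_right_mono) auto
      then show ?thesis using D1(2)[of n] by (simp add: k)
    next
      case False
      then obtain n where k: "k = - int n" by (metis int_cases neg_int_cases not_le)
      have "of_int k + z = - (of_nat n + - z)" by (simp add: k)
      then have "norm (1 / (of_int k + z)) = norm (1 / (of_nat n + - z))" by (simp only: norm_divide norm_minus_cancel)
      moreover have "D2 / (real n + 1) \<le> (D1 + D2) / (real n + 1)" using D1(1) by (intro divide_right_mono) auto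
      ultimately show ?thesis using D2(2)[of n] by (simp add: k)
    qed
  qed
qed

text \<open>With \<^term>\<open>sqrt (- x) = - sqrt x\<close>, the following bound telescopes over any interval of integers.\<close>

lemma inverse_le_sqrt_diff_nonneg:
  fixes x :: real
  assumes "x \<ge> 0"
  shows "1 / (x + 1) \<le> 2 * (sqrt (x + 1) - sqrt x)"
proof -
  have s: "sqrt x \<le> sqrt (x + 1)" "sqrt (x + 1) > 0" using assms by auto
  have "sqrt (x + 1) * 1 \<le> sqrt (x + 1) * sqrt (x + 1)"
    using assms by (intro mult_left_mono) auto
  then have s1: "sqrt (x + 1) \<le> x + 1" using assms by simp
  have "(sqrt (x + 1) - sqrt x) * (sqrt (x + 1) + sqrt x) = 1"
    using assms by (simp add: algebra_simps)
  moreover have pos: "0 < sqrt (x + 1) + sqrt x" using s assms by (simp add: add_pos_nonneg)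
  ultimately have "sqrt (x + 1) - sqrt x = 1 / (sqrt (x + 1) + sqrt x)"
    by (simp add: field_simps)
  also have "\<dots> \<ge> 1 / (2 * (x + 1))"
  proof (rule divide_left_mono)
    show "sqrt (x + 1) + sqrt x \<le> 2 * (x + 1)" using add_mono[OF s1 order_trans[OF s(1) s1]] by simp
  qed (use pos assms in auto)
  finally have "2 * (1 / (2 * (x + 1))) \<le> 2 * (sqrt (x + 1) - sqrt x)"
    by (rule mult_left_mono) simp
  moreover have "2 * (1 / (2 * y)) = 1 / y" for y :: real
    by simp
  ultimately show ?thesis by (simp only:)
qed

lemma inverse_le_sqrt_diff:
  fixes k :: int
  shows "1 / (real_of_int \<bar>k\<bar> + 1) \<le> 2 * (sqrt (real_of_int k + 1) - sqrt (real_of_int k))"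
proof (cases "k \<ge> 0")
  case True
  then show ?thesis using inverse_le_sqrt_diff_nonneg[of "real_of_int k"] by simp
next
  case False
  define x where "x = real_of_int (- k) - 1"
  have x: "x \<ge> 0" using False by (simp add: x_def)
  have "1 / (real_of_int \<bar>k\<bar> + 1) \<le> 1 / (x + 1)"
    using False by (intro frac_le) (auto simp: x_def)
  also have "\<dots> \<le> 2 * (sqrt (x + 1) - sqrt x)" by (rule inverse_le_sqrt_diff_nonneg[OF x])
  also have "sqrt (x + 1) = - sqrt (real_of_int k)"
    by (simp add: x_def flip: real_sqrt_minus)
  also have "sqrt x = - sqrt (real_of_int k + 1)"
  proof -
    have "x = - (real_of_int k + 1)" by (simp add: x_def)
    then show ?thesis by (simp only: real_sqrt_minus)
  qed
  finally show ?thesis by simp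
qed

text \<open>The point is uniformity in \<open>M\<close>. The growth is in fact logarithmic, but the
  square root telescopes through zero without a case distinction in the sum and leaves a summable
  majorant.\<close>

lemma sum_inverse_le_sqrt:
  "(\<Sum>l<m. 1 / (real_of_int \<bar>int l - int M\<bar> + 1)) \<le> 4 * sqrt (real m)"
proof -
  have "(\<Sum>l<m. 1 / (real_of_int \<bar>int l - int M\<bar> + 1)) \<le> (\<Sum>l<m. 2 * (sqrt (real (Suc l) - real M) - sqrt (real l - real M)))"
  proof (rule sum_mono)
    fix l
    have "real_of_int (int l - int M) + 1 = real (Suc l) - real M" "real_of_int (int l - int M) = real l - real M"
      by simp_all
    then show "1 / (real_of_int \<bar>int l - int M\<bar> + 1) \<le> 2 * (sqrt (real (Suc l) - real M) - sqrt (real l - real M))"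
      using inverse_le_sqrt_diff[of "int l - int M"] by (simp only:)
  qed
  also have "\<dots> = 2 * (sqrt (real m - real M) - sqrt (real 0 - real M))"
    unfolding sum_distrib_left[symmetric] by (subst sum_lessThan_telescope) (rule refl)
  also have "\<dots> = 2 * (sqrt (real m - real M) + sqrt (real M))"
    by (simp add: real_sqrt_minus)
  also have "\<dots> \<le> 4 * sqrt (real m)"
  proof (cases "M \<le> m")
    case True
    then have "sqrt (real m - real M) \<le> sqrt (real m)" "sqrt (real M) \<le> sqrt (real m)" by auto
    moreover have "p \<le> r \<Longrightarrow> q \<le> r \<Longrightarrow> 2 * (p + q) \<le> 4 * r" for p q r :: real by simp
    ultimately show ?thesis by blast
  next
    case False
    then have "sqrt (real M) \<le> sqrt (real M - real m) + sqrt (real m)"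
      using sqrt_add_le_add_sqrt[of "real M - real m" "real m"] by simp
    moreover have "sqrt (real m - real M) = - sqrt (real M - real m)"
      by (simp flip: real_sqrt_minus)
    moreover have "sqrt (real m) \<ge> 0" by simp
    moreover have "q \<le> p + r \<Longrightarrow> p' = - p \<Longrightarrow> 0 \<le> r \<Longrightarrow> 2 * (p' + q) \<le> 4 * r" for p p' q r :: real by simp
    ultimately show ?thesis by blast
  qed
  finally show ?thesis .
qed

text \<open>Replacing \<open>z\<close> by \<open>z + 1\<close> only exchanges one end term for
  another. After \<open>m\<close> shifts the accumulated error is a sum of reciprocals over two
  stretches of \<open>m\<close> consecutive integers, hence of order \<open>sqrt m\<close> for every
  \<open>M\<close>. Against residues of order \<open>1 / m ^ 2\<close> this is summable.\<close>

lemma sym_sum_bound: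
  fixes z :: complex
  assumes z: "z \<notin> \<int>"
  obtains D where "D \<ge> 0" "\<And>M m. norm (sym_sum M (z + of_nat m)) \<le> D * sqrt (real m + 1)"
proof -
  obtain D where D: "D > 0" "\<And>k. norm (1 / (of_int k + z)) \<le> D / (real_of_int \<bar>k\<bar> + 1)"
    using inverse_of_int_add_bound[OF z] by blast
  have "Bseq (\<lambda>M. sym_sum M z)"
    using sym_sum_tendsto[OF z] by (intro convergent_imp_Bseq) (auto simp only: convergent_def)
  then obtain E where E: "E > 0" "\<And>M. norm (sym_sum M z) \<le> E"
    unfolding Bseq_def by blast
  have step: "norm (sym_sum M (z + of_nat m)) \<le> E + D * (\<Sum>l<m. 1 / (real_of_int \<bar>int l - int 0\<bar> + 1) + 1 / (real_of_int \<bar>int l - int M\<bar> + 1))" for M m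
  proof (induction m)
    case 0
    then show ?case using E by simp
  next
    case (Suc m)
    have 1: "norm (1 / (of_nat M + 1 + (z + of_nat m))) \<le> D * (1 / (real_of_int \<bar>int m - int 0\<bar> + 1))"
    proof -
      have "of_nat M + 1 + (z + of_nat m) = of_int (int (M + 1 + m)) + z" by simp
      then have "norm (1 / (of_nat M + 1 + (z + of_nat m))) \<le> D / (real_of_int \<bar>int (M + 1 + m)\<bar> + 1)"
        using D(2)[of "int (M + 1 + m)"] by (simp only:)
      also have "\<dots> \<le> D / (real_of_int \<bar>int m - int 0\<bar> + 1)"
        using D(1) by (intro divide_left_mono) auto
      finally show ?thesis by simp
    qed
    have 2: "norm (1 / (z + of_nat m - of_nat M)) \<le> D * (1 / (real_of_int \<bar>int m - int M\<bar> + 1))"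
    proof -
      have "z + of_nat m - of_nat M = of_int (int m - int M) + z" by simp
      then show ?thesis using D(2)[of "int m - int M"] by (simp only: times_divide_eq_right mult_1_right)
    qed
    have "sym_sum M (z + of_nat (Suc m)) = sym_sum M (z + of_nat m) + (1 / (of_nat M + 1 + (z + of_nat m)) - 1 / (z + of_nat m - of_nat M))"
      using sym_sum_shift[of M "z + of_nat m"] by (simp add: add_ac)
    then have "norm (sym_sum M (z + of_nat (Suc m))) \<le> norm (sym_sum M (z + of_nat m)) +
        (norm (1 / (of_nat M + 1 + (z + of_nat m))) + norm (1 / (z + of_nat m - of_nat M)))"
      by (metis add_left_mono norm_triangle_ineq norm_triangle_ineq4 order_trans)
    then show ?case
      using Suc.IH 1 2 unfolding sum.lessThan_Suc distrib_left by linarith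
  qed
  show ?thesis
  proof (rule that[of "E + 8 * D"])
    show "E + 8 * D \<ge> 0" using D(1) E(1) by simp
    fix M m
    have "(\<Sum>l<m. 1 / (real_of_int \<bar>int l - int 0\<bar> + 1) + 1 / (real_of_int \<bar>int l - int M\<bar> + 1)) \<le> 8 * sqrt (real m)"
      unfolding sum.distrib using sum_inverse_le_sqrt[of 0 m] sum_inverse_le_sqrt[of M m] by linarith
    also have "8 * sqrt (real m) \<le> 8 * sqrt (real m + 1)" by simp
    finally have "D * (\<Sum>l<m. 1 / (real_of_int \<bar>int l - int 0\<bar> + 1) + 1 / (real_of_int \<bar>int l - int M\<bar> + 1)) \<le> D * (8 * sqrt (real m + 1))"
      using D(1) by (intro mult_left_mono) auto
    moreover have "E * 1 \<le> E * sqrt (real m + 1)"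
      using E(1) by (intro mult_left_mono) auto
    ultimately show "norm (sym_sum M (z + of_nat m)) \<le> (E + 8 * D) * sqrt (real m + 1)"
      using step[of M m] by (simp add: algebra_simps)
  qed
qed

lemma summable_powr_Suc: "summable (\<lambda>m. K * (sqrt (real m + 1) / (real m + 1) ^ 2))"
proof -
  have "summable (\<lambda>m. real (Suc m) powr (- 3 / 2))"
    by (subst summable_Suc_iff[where f = "\<lambda>m. real m powr (- 3 / 2)"]) (simp add: summable_real_powr_iff)
  moreover have "real (Suc m) powr (- 3 / 2) = sqrt (real m + 1) / (real m + 1) ^ 2" for m
  proof -
    have "real (Suc m) powr (- 3 / 2) = (real m + 1) powr (1 / 2 - 2)" by (simp add: add.commute)
    also have "\<dots> = (real m + 1) powr (1 / 2) / (real m + 1) powr 2" by (rule powr_diff)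
    finally show ?thesis by (simp add: powr_half_sqrt)
  qed
  ultimately show ?thesis by (intro summable_mult) simp
qed

lemma cot_add_of_nat: "cot (of_real pi * (z + of_nat m)) = cot (of_real pi * z :: complex)"
proof (induction m)
  case (Suc m)
  have "of_real pi * (z + of_nat (Suc m)) = of_real pi * (z + of_nat m) + complex_of_real pi"
    by (simp add: algebra_simps)
  then have "cot (of_real pi * (z + of_nat (Suc m))) = cot (of_real pi * (z + of_nat m) + complex_of_real pi)"
    by (simp only:)
  also have "\<dots> = cot (of_real pi * (z + of_nat m))"
    by (simp add: cot_def sin_add cos_add del: of_nat_Suc)
  finally show ?case using Suc by simp
qed simp

section \<open>Summing the partial fractions over the integers\<close>

context balanced_gratio
begin

definition rho where "rho i = (\<Sum>m. res i m)"

text \<open>By periodicity the limiting weight is the same cotangent for all \<open>m\<close>, so it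
  comes out of the series and leaves the total residue.\<close>

lemma weighted_res_sym_sum_limit:
  assumes i: "i \<in> idx"
  shows "(\<lambda>M. \<Sum>m. res i m * sym_sum M (a i + of_nat m)) \<longlonglongrightarrow> of_real pi * cot (of_real pi * a i) * rho i"
proof -
  obtain K where K: "K \<ge> 0" "\<And>m. norm (res i m) \<le> K / (real m + 1) ^ 2"
    using res_bound[OF i] by blast
  obtain D where D: "D \<ge> 0" "\<And>M m. norm (sym_sum M (a i + of_nat m)) \<le> D * sqrt (real m + 1)"
    using sym_sum_bound[OF aI[OF i]] by blast
  have lim: "(\<lambda>M. res i m * sym_sum M (a i + of_nat m)) \<longlonglongrightarrow> res i m * (of_real pi * cot (of_real pi * a i))" for m
  proof -
    have "a i + of_nat m \<notin> \<int>" by (rule not_Ints_shift[OF aI[OF i]]) simp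
    from sym_sum_tendsto[OF this] show ?thesis
      unfolding cot_add_of_nat by (intro tendsto_mult tendsto_const)
  qed
  have "norm (res i m * sym_sum M (a i + of_nat m)) \<le> K * D * (sqrt (real m + 1) / (real m + 1) ^ 2)" for m M
  proof -
    have "norm (res i m * sym_sum M (a i + of_nat m)) \<le> (K / (real m + 1) ^ 2) * (D * sqrt (real m + 1))"
      unfolding norm_mult using K(1) by (intro mult_mono K D) auto
    then show ?thesis by (simp add: mult_ac)
  qed
  then have bd: "eventually (\<lambda>(m, M). norm (res i m * sym_sum M (a i + of_nat m)) \<le> K * D * (sqrt (real m + 1) / (real m + 1) ^ 2)) (at_top \<times>\<^sub>F sequentially)"
    by (intro always_eventually) auto
  have "(\<lambda>M. \<Sum>m. res i m * sym_sum M (a i + of_nat m)) \<longlonglongrightarrow> (\<Sum>m. res i m * (of_real pi * cot (of_real pi * a i)))"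
    using tannerys_theorem[OF lim bd summable_powr_Suc] by auto
  moreover have "summable (\<lambda>m. res i m)"
    by (rule summable_comparison_test'[OF summable_inverse_Suc_square[of K], of 0]) (rule K(2))
  ultimately show ?thesis
    unfolding rho_def by (simp add: suminf_mult2[symmetric] mult.commute)
qed

lemma summable_res_weighted:
  assumes i: "i \<in> idx" and w: "\<And>m. norm (w m) \<le> D"
  shows "summable (\<lambda>m. res i m * w m)"
proof -
  obtain K where K: "K \<ge> 0" "\<And>m. norm (res i m) \<le> K / (real m + 1) ^ 2"
    using res_bound[OF i] by blast
  show ?thesis
  proof (rule summable_comparison_test'[OF summable_inverse_Suc_square[of "K * D"]])
    fix m
    have "norm (res i m * w m) \<le> K / (real m + 1) ^ 2 * D"
      unfolding norm_mult using K(1) by (intro mult_mono K w) auto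
    then show "norm (res i m * w m) \<le> K * D / (real m + 1) ^ 2" by (simp add: mult_ac)
  qed
qed

text \<open>The lower parameter 1 makes \<open>gratio\<close> vanish at the negative integers, so a
  sum from 0 to \<open>M\<close> equals the symmetric sum from \<open>- M\<close> to
  \<open>M\<close>. Inserting the partial fractions and exchanging the sums produces
  \<open>sym_sum\<close>.\<close>

lemma gratio_sum_cot:
  assumes j0: "j0 \<in> idx" "e j0 = 1"
  shows "(\<lambda>M. \<Sum>n\<le>M. gratio a e (of_nat n)) \<longlonglongrightarrow> (\<Sum>i\<in>idx. of_real pi * cot (of_real pi * a i) * rho i)"
proof -
  have "(\<lambda>M. \<Sum>i\<in>idx. \<Sum>m. res i m * sym_sum M (a i + of_nat m)) \<longlonglongrightarrow> (\<Sum>i\<in>idx. of_real pi * cot (of_real pi * a i) * rho i)"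
    by (intro tendsto_sum weighted_res_sym_sum_limit)
  moreover have "(\<Sum>i\<in>idx. \<Sum>m. res i m * sym_sum M (a i + of_nat m)) = (\<Sum>n\<le>M. gratio a e (of_nat n))" for M
  proof -
    have "(\<Sum>i\<in>idx. \<Sum>m. res i m * sym_sum M (a i + of_nat m)) = (\<Sum>i\<in>idx. \<Sum>k=-int M..int M. \<Sum>m. res i m * (1 / (of_int k + a i + of_nat m)))"
    proof (rule sum.cong[OF refl])
      fix i assume i: "i \<in> idx"
      have "(\<Sum>m. res i m * sym_sum M (a i + of_nat m)) = (\<Sum>m. \<Sum>k=-int M..int M. res i m * (1 / (of_int k + a i + of_nat m)))"
        unfolding sym_sum_def sum_distrib_left by (simp only: add.assoc)
      also have "\<dots> = (\<Sum>k=-int M..int M. \<Sum>m. res i m * (1 / (of_int k + a i + of_nat m)))"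
      proof (rule suminf_sum)
        fix k
        have "(\<lambda>m. 1 / (of_nat m + (of_int k + a i))) \<longlonglongrightarrow> 0" by (rule inverse_of_nat_add_tendsto)
        then have "Bseq (\<lambda>m. 1 / (of_nat m + (of_int k + a i)))"
          by (intro convergent_imp_Bseq) (auto simp only: convergent_def)
        then obtain D where "\<And>m. norm (1 / (of_nat m + (of_int k + a i))) \<le> D"
          unfolding Bseq_def by blast
        from summable_res_weighted[OF i this]
        show "summable (\<lambda>m. res i m * (1 / (of_int k + a i + of_nat m)))"
          by (simp only: add.commute)
      qed
      finally show "(\<Sum>m. res i m * sym_sum M (a i + of_nat m)) = (\<Sum>k=-int M..int M. \<Sum>m. res i m * (1 / (of_int k + a i + of_nat m)))" .
    qed
    also have "\<dots> = (\<Sum>k=-int M..int M. \<Sum>i\<in>idx. \<Sum>m. res i m * (1 / (of_int k + a i + of_nat m)))"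
      by (rule sum.swap)
    also have "\<dots> = (\<Sum>k=-int M..int M. gratio a e (of_int k))"
    proof (rule sum.cong[OF refl])
      fix k
      show "(\<Sum>i\<in>idx. \<Sum>m. res i m * (1 / (of_int k + a i + of_nat m))) = gratio a e (of_int k)"
      proof (rule gratio_partial_fractions[symmetric])
        fix j assume j: "j \<in> idx"
        show "a j + of_int k \<notin> \<int>" by (rule not_Ints_shift[OF aI[OF j]]) simp
      qed
    qed
    also have "\<dots> = (\<Sum>k=0..int M. gratio a e (of_int k))"
    proof (rule sum.mono_neutral_right)
      show "\<forall>k\<in>{-int M..int M} - {0..int M}. gratio a e (of_int k) = 0"
      proof
        fix k assume k: "k \<in> {-int M..int M} - {0..int M}"
        then have "e j0 + of_int k = of_int (1 + k)" "1 + k \<le> 0" using j0 by auto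
        then have "e j0 + of_int k \<in> \<int>\<^sub>\<le>\<^sub>0" by (simp only: of_int_in_nonpos_Ints_iff)
        then have "rGamma (e j0 + of_int k) = 0" by (simp add: rGamma_eq_zero_iff)
        then have "(\<Prod>j\<in>idx. rGamma (e j + of_int k)) = 0"
          using j0(1) by (intro prod_zero) auto
        then show "gratio a e (of_int k) = 0" unfolding gratio_def by (simp only: mult_zero_right)
      qed
    qed auto
    also have "\<dots> = (\<Sum>n\<le>M. gratio a e (of_nat n))"
      by (rule sum.reindex_bij_witness[where i = int and j = nat]) auto
    finally show ?thesis .
  qed
  ultimately show ?thesis by (simp only:)
qed

end

section \<open>Trigonometric relations\<close>

text \<open>The single source of the sine relations used below: both the cotangent expansion and the
  identities \<open>I1\<close> to \<open>I4\<close> of the final elimination are instances of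
  it.\<close>

lemma trig_identity:
  fixes x y b c d :: complex
  shows "sin x * (sin (y - b) * sin (y - c) * sin (y - d)) - sin y * (sin (x - b) * sin (x - c) * sin (x - d))
    = - (sin (x - y) * (sin b * sin c * sin d - sin (b + c + d - x - y) * sin x * sin y))"
proof -
  have x: "sin x ^ 2 + cos x ^ 2 = 1" and y: "sin y ^ 2 + cos y ^ 2 = 1" by simp_all
  have 1: "b + c + d - x - y = (b + c + d) - (x + y)" by simp
  show ?thesis
    unfolding 1 sin_diff sin_add cos_add using x y by algebra
qed

definition sp :: "complex \<Rightarrow> complex" where "sp z = sin (of_real pi * z)"

lemma sp_identity:
  "sp x * (sp (y - b) * sp (y - c) * sp (y - d)) - sp y * (sp (x - b) * sp (x - c) * sp (x - d))
    = - (sp (x - y) * (sp b * sp c * sp d - sp (b + c + d - x - y) * sp x * sp y))"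
  using trig_identity[of "of_real pi * x" "of_real pi * y" "of_real pi * b" "of_real pi * c" "of_real pi * d"]
  unfolding sp_def right_diff_distrib distrib_left .

lemma sp_minus: "sp (- z) = - sp z"
  by (simp add: sp_def)

lemma sp_diff_commute: "sp (x - y) = - sp (y - x)"
  using sp_minus[of "y - x"] by simp

lemma sp_add_1: "sp (1 + z) = - sp z"
  by (simp add: sp_def distrib_left sin_add)

lemma sp_1_minus: "sp (1 - z) = sp z"
  by (simp add: sp_def right_diff_distrib sin_diff)

lemma sp_2_minus: "sp (2 - z) = - sp z"
  using sp_add_1[of "1 - z"] by (simp add: sp_1_minus)

lemma sp_nz: "z \<notin> \<int> \<Longrightarrow> sp z \<noteq> 0"
  by (simp add: sp_def sin_pi_nz)

lemma Gamma_sp: "z \<notin> \<int> \<Longrightarrow> Gamma z * sp z = of_real pi * rGamma (1 - z)"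
proof -
  assume z: "z \<notin> \<int>"
  have "1 - z \<notin> \<int>" by (rule not_Ints_shift[OF z]) simp
  then have "Gamma (1 - z) \<noteq> 0" by (rule Gamma_nz)
  then show ?thesis
    using Gamma_sin[OF z] by (simp add: sp_def rGamma_inverse_Gamma field_simps)
qed

lemma rGamma_sp: "rGamma z * rGamma (1 - z) = sp z / of_real pi"
  by (simp add: sp_def rGamma_reflection_complex)

section \<open>Cotangent formulas for the Gamma series\<close>

lemma gratio_hyp4F3:
  assumes nI: "p \<notin> \<int>" "q \<notin> \<int>" "r \<notin> \<int>" "s \<notin> \<int>" "x \<notin> \<int>" "y \<notin> \<int>" "z \<notin> \<int>"
  shows "Gamma (p + of_nat n) * Gamma (q + of_nat n) * Gamma (r + of_nat n) * Gamma (s + of_nat n)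
     * (rGamma (1 + of_nat n) * rGamma (x + of_nat n) * rGamma (y + of_nat n) * rGamma (z + of_nat n))
    = Gamma p * Gamma q * Gamma r * Gamma s / (Gamma x * Gamma y * Gamma z) * hyp4F3_term p q r s x y z n"
proof -
  have G: "Gamma (w + of_nat n) = Gamma w * pochhammer w n" if "w \<notin> \<int>" for w :: complex
    using pochhammer_Gamma[OF not_nonpos_Ints[OF that], of n] Gamma_nz[OF that] by simp
  have R: "rGamma (w + of_nat n) = 1 / (Gamma w * pochhammer w n)" if "w \<notin> \<int>" for w :: complex
    by (simp add: rGamma_inverse_Gamma G[OF that] inverse_eq_divide)
  have 1: "rGamma (1 + of_nat n) = (1 / fact n :: complex)"
    by (simp add: rGamma_inverse_Gamma Gamma_fact inverse_eq_divide)
  show ?thesis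
    unfolding G[OF nI(1)] G[OF nI(2)] G[OF nI(3)] G[OF nI(4)] R[OF nI(5)] R[OF nI(6)] R[OF nI(7)] 1 hyp4F3_term_def
    by (simp add: mult_ac)
qed

lemma gamma_hyp_limit:
  assumes bal: "x + y + z = 1 + p + q + r + s"
    and nI: "p \<notin> \<int>" "q \<notin> \<int>" "r \<notin> \<int>" "s \<notin> \<int>" "x \<notin> \<int>" "y \<notin> \<int>" "z \<notin> \<int>"
  shows "(\<lambda>M. \<Sum>n\<le>M. Gamma (p + of_nat n) * Gamma (q + of_nat n) * Gamma (r + of_nat n) * Gamma (s + of_nat n)
     * (rGamma (1 + of_nat n) * rGamma (x + of_nat n) * rGamma (y + of_nat n) * rGamma (z + of_nat n)))
   \<longlonglongrightarrow> gamma_hyp p q r s x y z"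
proof -
  have "summable (hyp4F3_term p q r s x y z)"
    using summable_norm_cancel[OF summable_hyp4F3[OF bal]] nI(5-7)[THEN not_nonpos_Ints] by simp
  from summable_LIMSEQ'[OF this]
  have "(\<lambda>M. Gamma p * Gamma q * Gamma r * Gamma s / (Gamma x * Gamma y * Gamma z) * (\<Sum>n\<le>M. hyp4F3_term p q r s x y z n))
     \<longlonglongrightarrow> gamma_hyp p q r s x y z"
    unfolding gamma_hyp_def hyp4F3_at_1_eq by (intro tendsto_mult tendsto_const)
  then show ?thesis
    unfolding gratio_hyp4F3[OF nI] sum_distrib_left .
qed

definition vec4 :: "complex \<Rightarrow> complex \<Rightarrow> complex \<Rightarrow> complex \<Rightarrow> nat \<Rightarrow> complex" where
  "vec4 p q r s j = (if j = 0 then p else if j = 1 then q else if j = 2 then r else s)"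

lemma vec4_simps [simp]: "vec4 p q r s 0 = p" "vec4 p q r s (Suc 0) = q" "vec4 p q r s 2 = r" "vec4 p q r s 3 = s"
  by (simp_all add: vec4_def)

text \<open>The total residue at the poles \<open>- a - m\<close>, for the lower parameters
  \<open>1, e, f, g\<close>, in closed form.\<close>

definition res_a :: "complex \<Rightarrow> complex \<Rightarrow> complex \<Rightarrow> complex \<Rightarrow> complex \<Rightarrow> complex \<Rightarrow> complex \<Rightarrow> complex" where
  "res_a a b c d e f g = Gamma (b - a) * Gamma (c - a) * Gamma (d - a) * rGamma (1 - a) * rGamma (e - a) * rGamma (f - a) * rGamma (g - a)
     * hyp4F3_at_1 a (1 + a - e) (1 + a - f) (1 + a - g) (1 + a - b) (1 + a - c) (1 + a - d)"

definition generic :: "complex \<Rightarrow> complex \<Rightarrow> complex \<Rightarrow> complex \<Rightarrow> complex \<Rightarrow> complex \<Rightarrow> complex \<Rightarrow> bool" where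
  "generic a b c d e f g \<longleftrightarrow>
     (\<forall>z\<in>{a, b, c, d, e, f, g, e - f, e - g, f - g, a - b, a - c, a - d, b - c, b - d, c - d}. z \<notin> \<int>) \<and>
     (\<forall>x\<in>{e, f, g}. \<forall>y\<in>{a, b, c, d}. x - y \<notin> \<int>)"

lemma not_Ints_minus: "x - y \<notin> \<int> \<Longrightarrow> y - x \<notin> (\<int> :: complex set)"
  by (erule not_Ints_shift) simp

lemma not_Ints_1_add: "x - y \<notin> \<int> \<Longrightarrow> 1 + x - y \<notin> (\<int> :: complex set)"
  "x - y \<notin> \<int> \<Longrightarrow> 1 + y - x \<notin> (\<int> :: complex set)" "x \<notin> \<int> \<Longrightarrow> 2 - x \<notin> (\<int> :: complex set)"
  "x \<notin> \<int> \<Longrightarrow> 1 - x \<notin> (\<int> :: complex set)"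
  by (erule not_Ints_shift, simp)+

text \<open>Translating the variable by \<open>1 - e\<close> or \<open>1 - f\<close> makes another
  lower parameter equal to 1, so \<open>gratio_sum_cot\<close> applies again. Residues depend on
  parameter differences only; hence all three series are expressed by the same four numbers
  \<open>r i\<close>, and just the arguments of the cotangents change.\<close>

lemma cot_relation:
  assumes eq: "e + f + g = 1 + a + b + c + d" and gen: "generic a b c d e f g"
  obtains r :: "nat \<Rightarrow> complex"
  where "r 0 + r 1 + r 2 + r 3 = 0" "r 0 = res_a a b c d e f g"
    "gamma_hyp a b c d e f g =
       of_real pi * (cot (of_real pi * a) * r 0 + cot (of_real pi * b) * r 1 + cot (of_real pi * c) * r 2 + cot (of_real pi * d) * r 3)"
    "gamma_hyp (1 + a - e) (1 + b - e) (1 + c - e) (1 + d - e) (1 + f - e) (1 + g - e) (2 - e) =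
       of_real pi * (cot (of_real pi * (a - e)) * r 0 + cot (of_real pi * (b - e)) * r 1 + cot (of_real pi * (c - e)) * r 2 + cot (of_real pi * (d - e)) * r 3)"
    "gamma_hyp (1 + a - f) (1 + b - f) (1 + c - f) (1 + d - f) (1 + e - f) (1 + g - f) (2 - f) =
       of_real pi * (cot (of_real pi * (a - f)) * r 0 + cot (of_real pi * (b - f)) * r 1 + cot (of_real pi * (c - f)) * r 2 + cot (of_real pi * (d - f)) * r 3)"
proof -
  define A where "A = (\<lambda>t. vec4 (a + t) (b + t) (c + t) (d + t))"
  define E where "E = (\<lambda>t. vec4 (1 + t) (e + t) (f + t) (g + t))"
  have nI: "a \<notin> \<int>" "b \<notin> \<int>" "c \<notin> \<int>" "d \<notin> \<int>" "e \<notin> \<int>" "f \<notin> \<int>" "g \<notin> \<int>"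
    "e - f \<notin> \<int>" "e - g \<notin> \<int>" "f - g \<notin> \<int>" "a - b \<notin> \<int>" "a - c \<notin> \<int>" "a - d \<notin> \<int>" "b - c \<notin> \<int>" "b - d \<notin> \<int>" "c - d \<notin> \<int>"
    using gen by (auto simp: generic_def)
  have nI2: "e - a \<notin> \<int>" "e - b \<notin> \<int>" "e - c \<notin> \<int>" "e - d \<notin> \<int>"
      "f - a \<notin> \<int>" "f - b \<notin> \<int>" "f - c \<notin> \<int>" "f - d \<notin> \<int>" "g - a \<notin> \<int>" "g - b \<notin> \<int>" "g - c \<notin> \<int>" "g - d \<notin> \<int>"
    using gen by (auto simp: generic_def)
  have loc: "balanced_gratio (A t) (E t)" if t: "a + t \<notin> \<int>" "b + t \<notin> \<int>" "c + t \<notin> \<int>" "d + t \<notin> \<int>" for t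
  proof
    have "sum (E t) idx - sum (A t) idx = 1 + (e + f + g) - (a + b + c + d)"
      by (simp add: A_def E_def)
    then show "sum (E t) idx - sum (A t) idx = 2"
      unfolding eq by simp
    show "A t i \<notin> \<int>" if "i \<in> idx" for i
      using that t by (auto simp: A_def)
    show "E t j - A t i \<notin> \<int>" if "i \<in> idx" "j \<in> idx" for i j
      using that nI2 not_Ints_1_add(4)[OF nI(1)] not_Ints_1_add(4)[OF nI(2)] not_Ints_1_add(4)[OF nI(3)] not_Ints_1_add(4)[OF nI(4)]
      by (auto simp: A_def E_def)
    show "A t j - A t i \<notin> \<int>" if "i \<in> idx" "j \<in> idx" "i \<noteq> j" for i j
      using that nI(11-16) nI(11-16)[THEN not_Ints_minus]
      by (auto simp: A_def)
  qed
  define r where "r = (\<lambda>i. \<Sum>m. res0 (A 0) (E 0) i * res_ratio (A 0) (E 0) i m)"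
  have rho: "balanced_gratio.rho (A t) (E t) i = r i" if t: "a + t \<notin> \<int>" "b + t \<notin> \<int>" "c + t \<notin> \<int>" "d + t \<notin> \<int>" and i: "i \<in> idx" for t i
  proof -
    interpret balanced_gratio "A t" "E t" by (rule loc[OF t])
    have d1: "A t j - A t i = A 0 j - A 0 i" "E t j - A t i = E 0 j - A 0 i" if "j \<in> idx" for j
      using that i by (auto simp: A_def E_def)
    have d2: "1 + A t i - A t j = 1 + A 0 i - A 0 j" "1 + A t i - E t j = 1 + A 0 i - E 0 j" if "j \<in> idx" for j
      using that i by (auto simp: A_def E_def)
    have "res0 (A t) (E t) i = res0 (A 0) (E 0) i"
      unfolding res0_def by (intro arg_cong2[where f = times] prod.cong refl) (simp_all only: d1)
    moreover have "res_ratio (A t) (E t) i m = res_ratio (A 0) (E 0) i m" for m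
      unfolding res_ratio_def by (intro arg_cong2[where f = divide] prod.cong refl) (simp_all only: d2)
    ultimately show ?thesis
      unfolding rho_def res_def r_def by (simp only:)
  qed
  have cot: "(\<lambda>M. \<Sum>n\<le>M. gratio (A t) (E t) (of_nat n)) \<longlonglongrightarrow>
      of_real pi * (cot (of_real pi * (a + t)) * r 0 + cot (of_real pi * (b + t)) * r 1 + cot (of_real pi * (c + t)) * r 2 + cot (of_real pi * (d + t)) * r 3)"
    if t: "a + t \<notin> \<int>" "b + t \<notin> \<int>" "c + t \<notin> \<int>" "d + t \<notin> \<int>" and j0: "j0 \<in> idx" "E t j0 = 1" for t j0
  proof -
    interpret balanced_gratio "A t" "E t" by (rule loc[OF t])
    have "(\<Sum>i\<in>idx. of_real pi * cot (of_real pi * A t i) * rho i) = (\<Sum>i\<in>idx. of_real pi * cot (of_real pi * A t i) * r i)"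
      by (rule sum.cong[OF refl]) (simp only: rho[OF t])
    also have "\<dots> =
       of_real pi * (cot (of_real pi * (a + t)) * r 0 + cot (of_real pi * (b + t)) * r 1 + cot (of_real pi * (c + t)) * r 2 + cot (of_real pi * (d + t)) * r 3)"
      by (simp add: A_def distrib_left mult.assoc add.assoc)
    finally show ?thesis using gratio_sum_cot[OF j0] by simp
  qed
  have cp: "cot (of_real pi * (z + (1 - w))) = cot (of_real pi * (z - w))" for z w :: complex
    using cot_add_of_nat[of "z - w" 1] by (simp add: algebra_simps)
  show ?thesis
  proof (rule that[of r])
    have t0: "a + 0 \<notin> \<int>" "b + 0 \<notin> \<int>" "c + 0 \<notin> \<int>" "d + 0 \<notin> \<int>" using nI by auto
    show "r 0 + r 1 + r 2 + r 3 = 0"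
    proof -
      interpret balanced_gratio "A 0" "E 0" by (rule loc[OF t0])
      show ?thesis
        using sum_res_eq_0 unfolding rho_def[symmetric] by (simp add: rho[OF t0] add_ac)
    qed
    show "r 0 = res_a a b c d e f g"
    proof -
      interpret balanced_gratio "A 0" "E 0" by (rule loc[OF t0])
      define K where "K = Gamma (b - a) * Gamma (c - a) * Gamma (d - a) * rGamma (1 - a) * rGamma (e - a) * rGamma (f - a) * rGamma (g - a)"
      have 1: "res0 (A 0) (E 0) 0 = K"
        by (simp add: res0_def A_def E_def K_def)
      have 2: "res_ratio (A 0) (E 0) 0 m = hyp4F3_term a (1 + a - e) (1 + a - f) (1 + a - g) (1 + a - b) (1 + a - c) (1 + a - d) m" for m
        by (simp add: res_ratio_def A_def E_def hyp4F3_term_def pochhammer_fact mult_ac)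
      have "summable (\<lambda>m. norm (hyp4F3_term a (1 + a - e) (1 + a - f) (1 + a - g) (1 + a - b) (1 + a - c) (1 + a - d) m))"
      proof (rule summable_hyp4F3)
        have "e = 1 + a + b + c + d - f - g" using eq by (simp add: algebra_simps)
        then show "1 + a - b + (1 + a - c) + (1 + a - d) = 1 + a + (1 + a - e) + (1 + a - f) + (1 + a - g)"
          by simp
      qed (use nI(11-13)[THEN not_Ints_1_add(1), THEN not_nonpos_Ints] in auto)
      then have "summable (hyp4F3_term a (1 + a - e) (1 + a - f) (1 + a - g) (1 + a - b) (1 + a - c) (1 + a - d))"
        by (rule summable_norm_cancel)
      then show ?thesis
        unfolding r_def 1 2 res_a_def K_def[symmetric] hyp4F3_at_1_eq by (rule suminf_mult)
    qed
    show "gamma_hyp a b c d e f g =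
       of_real pi * (cot (of_real pi * a) * r 0 + cot (of_real pi * b) * r 1 + cot (of_real pi * c) * r 2 + cot (of_real pi * d) * r 3)"
    proof -
      have "gratio (A 0) (E 0) s = Gamma (a + s) * Gamma (b + s) * Gamma (c + s) * Gamma (d + s)
         * (rGamma (1 + s) * rGamma (e + s) * rGamma (f + s) * rGamma (g + s))" for s
        by (simp add: gratio_def A_def E_def mult_ac)
      from cot[OF t0, of 0, unfolded this] gamma_hyp_limit[OF eq nI(1-7)]
      show ?thesis by (simp add: E_def LIMSEQ_unique)
    qed
    have t: "a + (1 - e) \<notin> \<int>" "b + (1 - e) \<notin> \<int>" "c + (1 - e) \<notin> \<int>" "d + (1 - e) \<notin> \<int>"
      "a + (1 - f) \<notin> \<int>" "b + (1 - f) \<notin> \<int>" "c + (1 - f) \<notin> \<int>" "d + (1 - f) \<notin> \<int>"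
      using nI2[THEN not_Ints_1_add(2)] by (simp_all add: algebra_simps)
    show "gamma_hyp (1 + a - e) (1 + b - e) (1 + c - e) (1 + d - e) (1 + f - e) (1 + g - e) (2 - e) =
       of_real pi * (cot (of_real pi * (a - e)) * r 0 + cot (of_real pi * (b - e)) * r 1 + cot (of_real pi * (c - e)) * r 2 + cot (of_real pi * (d - e)) * r 3)"
    proof (rule LIMSEQ_unique)
      have g: "gratio (A (1 - e)) (E (1 - e)) s = Gamma (1 + a - e + s) * Gamma (1 + b - e + s) * Gamma (1 + c - e + s) * Gamma (1 + d - e + s)
         * (rGamma (1 + s) * rGamma (1 + f - e + s) * rGamma (1 + g - e + s) * rGamma (2 - e + s))" for s
        by (simp add: gratio_def A_def E_def algebra_simps)
      show "(\<lambda>M. \<Sum>n\<le>M. gratio (A (1 - e)) (E (1 - e)) (of_nat n)) \<longlonglongrightarrow>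
         of_real pi * (cot (of_real pi * (a - e)) * r 0 + cot (of_real pi * (b - e)) * r 1 + cot (of_real pi * (c - e)) * r 2 + cot (of_real pi * (d - e)) * r 3)"
        using cot[OF t(1-4), of 1] unfolding cp by (simp add: E_def)
      show "(\<lambda>M. \<Sum>n\<le>M. gratio (A (1 - e)) (E (1 - e)) (of_nat n)) \<longlonglongrightarrow>
        gamma_hyp (1 + a - e) (1 + b - e) (1 + c - e) (1 + d - e) (1 + f - e) (1 + g - e) (2 - e)"
        unfolding g
      proof (rule gamma_hyp_limit)
        have "1 + f - e + (1 + g - e) + (2 - e) = 4 - 4 * e + (e + f + g)" by simp
        then show "1 + f - e + (1 + g - e) + (2 - e) = 1 + (1 + a - e) + (1 + b - e) + (1 + c - e) + (1 + d - e)"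
          unfolding eq by simp
      qed (use nI2[THEN not_Ints_1_add(2)] nI(8,9)[THEN not_Ints_1_add(2)] not_Ints_1_add(3)[OF nI(5)] in auto)
    qed
    show "gamma_hyp (1 + a - f) (1 + b - f) (1 + c - f) (1 + d - f) (1 + e - f) (1 + g - f) (2 - f) =
       of_real pi * (cot (of_real pi * (a - f)) * r 0 + cot (of_real pi * (b - f)) * r 1 + cot (of_real pi * (c - f)) * r 2 + cot (of_real pi * (d - f)) * r 3)"
    proof (rule LIMSEQ_unique)
      have g: "gratio (A (1 - f)) (E (1 - f)) s = Gamma (1 + a - f + s) * Gamma (1 + b - f + s) * Gamma (1 + c - f + s) * Gamma (1 + d - f + s)
         * (rGamma (1 + s) * rGamma (1 + e - f + s) * rGamma (1 + g - f + s) * rGamma (2 - f + s))" for s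
        by (simp add: gratio_def A_def E_def algebra_simps)
      show "(\<lambda>M. \<Sum>n\<le>M. gratio (A (1 - f)) (E (1 - f)) (of_nat n)) \<longlonglongrightarrow>
         of_real pi * (cot (of_real pi * (a - f)) * r 0 + cot (of_real pi * (b - f)) * r 1 + cot (of_real pi * (c - f)) * r 2 + cot (of_real pi * (d - f)) * r 3)"
        using cot[OF t(5-8), of 2] unfolding cp by (simp add: E_def)
      show "(\<lambda>M. \<Sum>n\<le>M. gratio (A (1 - f)) (E (1 - f)) (of_nat n)) \<longlonglongrightarrow>
        gamma_hyp (1 + a - f) (1 + b - f) (1 + c - f) (1 + d - f) (1 + e - f) (1 + g - f) (2 - f)"
        unfolding g
      proof (rule gamma_hyp_limit)
        have "1 + e - f + (1 + g - f) + (2 - f) = 4 - 4 * f + (e + f + g)" by simp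
        then show "1 + e - f + (1 + g - f) + (2 - f) = 1 + (1 + a - f) + (1 + b - f) + (1 + c - f) + (1 + d - f)"
          unfolding eq by simp
      qed (use nI2[THEN not_Ints_1_add(2)] nI(8)[THEN not_Ints_1_add(1)] nI(10)[THEN not_Ints_1_add(2)] not_Ints_1_add(3)[OF nI(6)] in auto)
    qed
  qed
qed

section \<open>Elimination of the residues and the link to the K functions\<close>

lemma cot_sp: "cot (of_real pi * z) = cos (of_real pi * z) / sp z"
  by (simp add: cot_def sp_def)

text \<open>As a function of \<open>s\<close> the quotient has period 1, is bounded towards both
  imaginary ends, and has simple poles at \<open>0, x, y\<close> modulo the integers; such a
  function is a constant plus a combination of cotangents. The coefficients come from
  \<open>sp_identity\<close> with all arguments translated by \<open>- s\<close>.\<close>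

lemma cot_partial_fractions:
  assumes nz: "sp s \<noteq> 0" "sp (s - x) \<noteq> 0" "sp (s - y) \<noteq> 0" "sp x \<noteq> 0" "sp y \<noteq> 0" "sp (x - y) \<noteq> 0"
  shows "sp (s - b) * sp (s - c) * sp (s - d) / (sp s * sp (s - x) * sp (s - y)) =
     cos (of_real pi * (b + c + d - x - y)) - sp (b + c + d - x - y) * cot (of_real pi * s)
      + (sp (y - b) * sp (y - c) * sp (y - d) / sp y * (cot (of_real pi * s) - cot (of_real pi * (s - y)))
         - sp (x - b) * sp (x - c) * sp (x - d) / sp x * (cot (of_real pi * s) - cot (of_real pi * (s - x)))) / sp (x - y)"
proof -
  define Px Py \<sigma> where "Px = sp (x - b) * sp (x - c) * sp (x - d)" and "Py = sp (y - b) * sp (y - c) * sp (y - d)"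
    and "\<sigma> = b + c + d - x - y"
  define T where "T = sp (s - b) * sp (s - c) * sp (s - d)"
  have "sp (x - s) * Py - sp (y - s) * Px = - (sp (x - y) * (sp (b - s) * sp (c - s) * sp (d - s) - sp (\<sigma> - s) * sp (x - s) * sp (y - s)))"
  proof -
    have "y - s - (b - s) = y - b" "y - s - (c - s) = y - c" "y - s - (d - s) = y - d"
      "x - s - (b - s) = x - b" "x - s - (c - s) = x - c" "x - s - (d - s) = x - d" "x - s - (y - s) = x - y"
      "b - s + (c - s) + (d - s) - (x - s) - (y - s) = \<sigma> - s"
      by (simp_all add: \<sigma>_def)
    then show ?thesis
      using sp_identity[of "x - s" "y - s" "b - s" "c - s" "d - s"] by (simp only: Px_def Py_def)
  qed
  also have "sp (b - s) * sp (c - s) * sp (d - s) = - T"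
    using sp_diff_commute[of b s] sp_diff_commute[of c s] sp_diff_commute[of d s] by (simp add: T_def)
  finally have 1: "sp (s - y) * Px - sp (s - x) * Py = sp (x - y) * (T + sp (\<sigma> - s) * sp (s - x) * sp (s - y))"
    using sp_diff_commute[of x s] sp_diff_commute[of y s] by (simp add: algebra_simps)
  have c1: "cot (of_real pi * s) - cot (of_real pi * (s - z)) = - sp z / (sp s * sp (s - z))"
    if "sp (s - z) \<noteq> 0" for z
  proof -
    have "sp (s - (s - z)) = sp s * cos (of_real pi * (s - z)) - cos (of_real pi * s) * sp (s - z)"
      unfolding sp_def right_diff_distrib[of _ s "s - z"] sin_diff ..
    then have "sp z = sp s * cos (of_real pi * (s - z)) - cos (of_real pi * s) * sp (s - z)" by simp
    then have "cos (of_real pi * s) * sp (s - z) - cos (of_real pi * (s - z)) * sp s = - sp z"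
      by (simp add: mult.commute)
    then show ?thesis
      unfolding cot_sp diff_frac_eq[OF nz(1) that] by (simp only:)
  qed
  have c2: "sp (\<sigma> - s) = sp \<sigma> * cos (of_real pi * s) - cos (of_real pi * \<sigma>) * sp s"
    unfolding sp_def right_diff_distrib sin_diff ..
  have "T / (sp s * sp (s - x) * sp (s - y)) =
     (- sp (\<sigma> - s) * (sp (s - x) * sp (s - y)) + (sp (s - y) * Px - sp (s - x) * Py) / sp (x - y)) / (sp s * sp (s - x) * sp (s - y))"
    unfolding 1 using nz by (simp add: mult.assoc)
  also have "\<dots> = - sp (\<sigma> - s) / sp s + (Px / (sp s * sp (s - x)) - Py / (sp s * sp (s - y))) / sp (x - y)"
    using nz by (simp add: divide_simps)
  also have "- sp (\<sigma> - s) / sp s = cos (of_real pi * \<sigma>) - sp \<sigma> * cot (of_real pi * s)"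
    unfolding c2 cot_sp using nz by (simp add: field_simps)
  also have "Px / (sp s * sp (s - x)) - Py / (sp s * sp (s - y)) =
     Py / sp y * (cot (of_real pi * s) - cot (of_real pi * (s - y))) - Px / sp x * (cot (of_real pi * s) - cot (of_real pi * (s - x)))"
    unfolding c1[OF nz(2)] c1[OF nz(3)] using nz by simp
  finally show ?thesis unfolding T_def Px_def Py_def \<sigma>_def .
qed

text \<open>The trigonometric quotient is the \<open>Q\<close> of the overview, so this is a K
  function up to Gamma factors and one sine.\<close>

definition supp_pair :: "complex \<Rightarrow> complex \<Rightarrow> complex \<Rightarrow> complex \<Rightarrow> complex \<Rightarrow> complex \<Rightarrow> complex \<Rightarrow> complex" where
  "supp_pair a b c d e f g = gamma_hyp a b c d e f g + of_real pi * res_a a b c d e f g *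
      (sp (b - a) * sp (c - a) * sp (d - a) / (sp a * sp (e - a) * sp (f - a) * sp (g - a)))"

text \<open>Take the quotient of \<open>cot_partial_fractions\<close> with poles at
  \<open>0, e, f\<close>. It vanishes at \<open>s = b, c, d\<close>, so weighting its values at
  \<open>a, b, c, d\<close> with the four residues leaves only \<open>res_a\<close>. On the other
  side the cotangents add up to the Gamma series, and the constant disappears because the residues
  sum to 0.\<close>

lemma supp_pair_relation:
  assumes bal: "e + f + g = 1 + a + b + c + d" and gen: "generic a b c d e f g"
  shows "sp (g - a) * supp_pair a b c d e f g =
     (sp (e - b) * sp (e - c) * sp (e - d) / sp e *
        (gamma_hyp a b c d e f g - gamma_hyp (1 + a - e) (1 + b - e) (1 + c - e) (1 + d - e) (1 + f - e) (1 + g - e) (2 - e))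
      - sp (f - b) * sp (f - c) * sp (f - d) / sp f *
        (gamma_hyp a b c d e f g - gamma_hyp (1 + a - f) (1 + b - f) (1 + c - f) (1 + d - f) (1 + e - f) (1 + g - f) (2 - f))) / sp (e - f)"
proof -
  obtain r :: "nat \<Rightarrow> complex" where r:
    "r 0 + r 1 + r 2 + r 3 = 0" "r 0 = res_a a b c d e f g"
    "gamma_hyp a b c d e f g =
       of_real pi * (cot (of_real pi * a) * r 0 + cot (of_real pi * b) * r 1 + cot (of_real pi * c) * r 2 + cot (of_real pi * d) * r 3)"
    "gamma_hyp (1 + a - e) (1 + b - e) (1 + c - e) (1 + d - e) (1 + f - e) (1 + g - e) (2 - e) =
       of_real pi * (cot (of_real pi * (a - e)) * r 0 + cot (of_real pi * (b - e)) * r 1 + cot (of_real pi * (c - e)) * r 2 + cot (of_real pi * (d - e)) * r 3)"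
    "gamma_hyp (1 + a - f) (1 + b - f) (1 + c - f) (1 + d - f) (1 + e - f) (1 + g - f) (2 - f) =
       of_real pi * (cot (of_real pi * (a - f)) * r 0 + cot (of_real pi * (b - f)) * r 1 + cot (of_real pi * (c - f)) * r 2 + cot (of_real pi * (d - f)) * r 3)"
    using cot_relation[OF bal gen] by blast
  have nI: "a \<notin> \<int>" "b \<notin> \<int>" "c \<notin> \<int>" "d \<notin> \<int>" "e \<notin> \<int>" "f \<notin> \<int>" "g \<notin> \<int>" "e - f \<notin> \<int>"
      "e - a \<notin> \<int>" "e - b \<notin> \<int>" "e - c \<notin> \<int>" "e - d \<notin> \<int>"
      "f - a \<notin> \<int>" "f - b \<notin> \<int>" "f - c \<notin> \<int>" "f - d \<notin> \<int>" "g - a \<notin> \<int>"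
    using gen by (auto simp: generic_def)
  define Pe Pf where "Pe = sp (e - b) * sp (e - c) * sp (e - d)" and "Pf = sp (f - b) * sp (f - c) * sp (f - d)"
  \<comment> \<open>Balance enters here: it makes \<open>sp (g - a)\<close> the coefficient of the
    unshifted cotangent, the same sine that stands in the denominator of \<open>Q\<close>.\<close>
  have \<sigma>: "sp (b + c + d - e - f) = - sp (g - a)"
  proof -
    have "b + c + d - e - f = (1 + a + b + c + d) - (e + f) - 1 - a" by simp
    also have "\<dots> = - (1 - (g - a))" unfolding bal[symmetric] by simp
    finally show ?thesis using sp_minus sp_1_minus by metis
  qed
  define k where "k = cos (of_real pi * (b + c + d - e - f))"
  define P where "P = (\<lambda>s. sp (s - b) * sp (s - c) * sp (s - d) / (sp s * sp (s - e) * sp (s - f)))"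
  define C where "C = (\<lambda>z. cot (of_real pi * z) :: complex)"
  have pf: "P s = k + sp (g - a) * C s + (Pf / sp f * (C s - C (s - f)) - Pe / sp e * (C s - C (s - e))) / sp (e - f)"
    if "s \<notin> \<int>" "e - s \<notin> \<int>" "f - s \<notin> \<int>" for s
  proof -
    have "sp s \<noteq> 0" "sp (s - e) \<noteq> 0" "sp (s - f) \<noteq> 0" "sp e \<noteq> 0" "sp f \<noteq> 0" "sp (e - f) \<noteq> 0"
      using that nI by (auto intro!: sp_nz not_Ints_minus)
    from cot_partial_fractions[OF this, of b c d] show ?thesis
      unfolding \<sigma> by (simp add: P_def k_def C_def Pe_def Pf_def)
  qed
  have P0: "P b = 0" "P c = 0" "P d = 0"
    by (simp_all add: P_def sp_def)
  define S0 Se Sf where "S0 = C a * r 0 + C b * r 1 + C c * r 2 + C d * r 3"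
    and "Se = C (a - e) * r 0 + C (b - e) * r 1 + C (c - e) * r 2 + C (d - e) * r 3"
    and "Sf = C (a - f) * r 0 + C (b - f) * r 1 + C (c - f) * r 2 + C (d - f) * r 3"
  have "P a * r 0 = P a * r 0 + P b * r 1 + P c * r 2 + P d * r 3"
    by (simp add: P0)
  also have "\<dots> = k * (r 0 + r 1 + r 2 + r 3) + sp (g - a) * S0 + (Pf / sp f * (S0 - Sf) - Pe / sp e * (S0 - Se)) / sp (e - f)"
  proof -
    have lin: "(k + h * x1 + (p * (x1 - y1) - q * (x1 - z1)) / w) * r1 + (k + h * x2 + (p * (x2 - y2) - q * (x2 - z2)) / w) * r2
       + (k + h * x3 + (p * (x3 - y3) - q * (x3 - z3)) / w) * r3 + (k + h * x4 + (p * (x4 - y4) - q * (x4 - z4)) / w) * r4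
      = k * (r1 + r2 + r3 + r4) + h * (x1 * r1 + x2 * r2 + x3 * r3 + x4 * r4) +
         (p * ((x1 * r1 + x2 * r2 + x3 * r3 + x4 * r4) - (y1 * r1 + y2 * r2 + y3 * r3 + y4 * r4))
          - q * ((x1 * r1 + x2 * r2 + x3 * r3 + x4 * r4) - (z1 * r1 + z2 * r2 + z3 * r3 + z4 * r4))) / w"
      for k h p q w x1 x2 x3 x4 y1 y2 y3 y4 z1 z2 z3 z4 r1 r2 r3 r4 :: complex
      unfolding divide_inverse by algebra
    show ?thesis
      unfolding pf[OF nI(1,9,13)] pf[OF nI(2,10,14)] pf[OF nI(3,11,15)] pf[OF nI(4,12,16)] S0_def Se_def Sf_def
      by (rule lin)
  qed
  finally have 1: "P a * r 0 = sp (g - a) * S0 + (Pf / sp f * (S0 - Sf) - Pe / sp e * (S0 - Se)) / sp (e - f)"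
    unfolding r(1) by simp
  define Q where "Q = sp (b - a) * sp (c - a) * sp (d - a) / (sp a * sp (e - a) * sp (f - a) * sp (g - a))"
  have PQ: "P a = - (sp (g - a) * Q)"
  proof -
    have "sp (a - z) = - sp (z - a)" for z by (rule sp_diff_commute)
    then show ?thesis using sp_nz[OF nI(17)] by (simp add: P_def Q_def)
  qed
  have "sp (g - a) * (of_real pi * S0 + of_real pi * r 0 * Q) = of_real pi * (sp (g - a) * S0 - P a * r 0)"
    unfolding PQ by (simp add: algebra_simps)
  also have "\<dots> = (Pe / sp e * (of_real pi * S0 - of_real pi * Se) - Pf / sp f * (of_real pi * S0 - of_real pi * Sf)) / sp (e - f)"
    unfolding 1 divide_inverse by algebra
  finally show ?thesis
    unfolding supp_pair_def r(2)[symmetric] Q_def[symmetric] r(3-5) Pe_def Pf_def S0_def Se_def Sf_def C_def .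
qed

lemma supp_pair_perm:
  "supp_pair a b c d e f g = supp_pair a b c d f e g" "supp_pair a b c d e f g = supp_pair a b c d e g f"
  by (simp_all add: supp_pair_def gamma_hyp_def res_a_def hyp4F3_at_1_def mult_ac)

text \<open>In the second summand the reflection formula is used in both directions: the four
  reciprocal Gamma products become the sines in the denominator of \<open>Q\<close>, while
  \<open>Gamma (b - a)\<close> and its companions absorb the sines of the numerator and become
  reciprocal Gammas at \<open>1 + a - b\<close> and so on.\<close>

lemma K_fun_supp_pair:
  assumes gen: "generic a b c d e f g"
  shows "K_fun (a, b, c, d, e, f, g) = A4 a b c d * A4 a (1 + a - e) (1 + a - f) (1 + a - g) / sp a * supp_pair a b c d e f g"
proof -
  have nI: "a \<notin> \<int>" "b \<notin> \<int>" "c \<notin> \<int>" "d \<notin> \<int>" "e \<notin> \<int>" "f \<notin> \<int>" "g \<notin> \<int>"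
      "e - a \<notin> \<int>" "f - a \<notin> \<int>" "g - a \<notin> \<int>" "b - a \<notin> \<int>" "c - a \<notin> \<int>" "d - a \<notin> \<int>"
    using gen by (auto simp: generic_def dest: not_Ints_minus)
  define G where "G = A4 a (1 + a - e) (1 + a - f) (1 + a - g)"
  define H1 H2 where "H1 = hyp4F3_at_1 a b c d e f g"
    and "H2 = hyp4F3_at_1 a (1 + a - e) (1 + a - f) (1 + a - g) (1 + a - b) (1 + a - c) (1 + a - d)"
  have t1: "A4 a b c d * gamma_hyp a b c d e f g = rGamma e * rGamma f * rGamma g * H1"
    using Gamma_nz[OF nI(1)] Gamma_nz[OF nI(2)] Gamma_nz[OF nI(3)] Gamma_nz[OF nI(4)]
    by (simp add: A4_def gamma_hyp_def H1_def rGamma_inverse_Gamma field_simps)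
  have gs: "Gamma (z - a) * sp (z - a) = of_real pi * rGamma (1 + a - z)" if "z - a \<notin> \<int>" for z
    using Gamma_sp[OF that] by (simp add: algebra_simps)
  have rs: "rGamma (1 + a - z) * rGamma (z - a) = sp (z - a) / of_real pi" for z
    using rGamma_sp[of "z - a"] by (simp add: mult.commute diff_diff_eq2)
  define D where "D = sp a * sp (e - a) * sp (f - a) * sp (g - a)"
  have D0: "D \<noteq> 0" using nI by (simp add: D_def sp_nz)
  have "G * (rGamma (1 - a) * rGamma (e - a) * rGamma (f - a) * rGamma (g - a))
     = (rGamma a * rGamma (1 - a)) * (rGamma (1 + a - e) * rGamma (e - a)) * (rGamma (1 + a - f) * rGamma (f - a)) * (rGamma (1 + a - g) * rGamma (g - a))"
    by (simp add: G_def A4_def mult_ac)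
  also have "\<dots> = D / of_real pi ^ 4"
    unfolding rs rGamma_sp by (simp add: D_def power4_eq_xxxx)
  finally have G1: "G * (rGamma (1 - a) * rGamma (e - a) * rGamma (f - a) * rGamma (g - a)) = D / of_real pi ^ 4" .
  have "G * (of_real pi * res_a a b c d e f g * (sp (b - a) * sp (c - a) * sp (d - a) / D))
    = of_real pi * (G * (rGamma (1 - a) * rGamma (e - a) * rGamma (f - a) * rGamma (g - a))) *
       ((Gamma (b - a) * sp (b - a)) * (Gamma (c - a) * sp (c - a)) * (Gamma (d - a) * sp (d - a))) / D * H2"
    unfolding res_a_def H2_def[symmetric] by (simp add: mult_ac)
  also have "\<dots> = rGamma (1 + a - b) * rGamma (1 + a - c) * rGamma (1 + a - d) * H2"
    unfolding G1 gs[OF nI(11)] gs[OF nI(12)] gs[OF nI(13)] using D0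
    by (simp add: power4_eq_xxxx)
  finally have t2: "G * (of_real pi * res_a a b c d e f g * (sp (b - a) * sp (c - a) * sp (d - a) / D)) = rGamma (1 + a - b) * rGamma (1 + a - c) * rGamma (1 + a - d) * H2" .
  have dist: "A * G / s * (x + y) = G * (A * x) / s + A * (G * y) / s" for A G s x y :: complex
    by (simp add: distrib_left add_divide_distrib mult_ac)
  have "A4 a b c d * G / sp a * supp_pair a b c d e f g = G * (A4 a b c d * gamma_hyp a b c d e f g) / sp a
     + A4 a b c d * (G * (of_real pi * res_a a b c d e f g * (sp (b - a) * sp (c - a) * sp (d - a) / D))) / sp a"
    unfolding supp_pair_def D_def by (rule dist)
  also have "\<dots> = K_fun (a, b, c, d, e, f, g)"
    unfolding t1 t2 by (simp add: H1_def H2_def sp_def G_def A4_def mult_ac)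
  finally show ?thesis unfolding G_def ..
qed

section \<open>The relation for generic parameters\<close>

lemma Ints_iff_shift:
  fixes w z :: complex
  assumes "w - z \<in> \<int> \<or> w + z \<in> \<int>"
  shows "w \<in> \<int> \<longleftrightarrow> z \<in> \<int>"
  using not_Ints_shift[of z w] not_Ints_shift[of w z] assms Ints_minus[of "w - z"] by (auto simp: add.commute)

lemma generic_dual:
  assumes "generic a b c d e f g"
  shows "generic (1 - a) (1 - b) (1 - c) (1 - d) (2 - e) (2 - f) (2 - g)"
proof -
  have "1 - x \<in> \<int> \<longleftrightarrow> x \<in> \<int>" "2 - x \<in> \<int> \<longleftrightarrow> x \<in> \<int>"
    "1 - x - (1 - y) \<in> \<int> \<longleftrightarrow> x - y \<in> \<int>" "2 - x - (2 - y) \<in> \<int> \<longleftrightarrow> x - y \<in> \<int>"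
    "2 - x - (1 - y) \<in> \<int> \<longleftrightarrow> x - y \<in> \<int>" for x y :: complex
    by (rule Ints_iff_shift, simp)+
  note iffs = this
  from assms show ?thesis
    unfolding generic_def by (simp only: ball_simps iffs simp_thms)
qed

lemma generic_shift:
  assumes "generic a b c d e f g"
  shows "generic (1 + a - e) (1 + b - e) (1 + c - e) (1 + d - e) (1 + f - e) (1 + g - e) (2 - e)"
proof -
  have "2 - x \<in> \<int> \<longleftrightarrow> x \<in> \<int>" "1 + y - x \<in> \<int> \<longleftrightarrow> x - y \<in> \<int>"
    "1 + x - z - (1 + y - z) \<in> \<int> \<longleftrightarrow> x - y \<in> \<int>"
    "2 - x - (1 + y - x) \<in> \<int> \<longleftrightarrow> y \<in> \<int>" "1 + y - x - (2 - x) \<in> \<int> \<longleftrightarrow> y \<in> \<int>" for x y z :: complex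
    by (rule Ints_iff_shift, simp)+
  note iffs = this
  from assms show ?thesis
    unfolding generic_def by (simp only: ball_simps iffs simp_thms)
qed

text \<open>Passing to the parameters of \<open>p4\<close> exchanges the lower parameters
  \<open>1\<close> and \<open>e\<close> up to a common translation. Neither \<open>res_a\<close> nor
  \<open>Q\<close> notices this, so only the Gamma series changes.\<close>

lemma supp_pair_shift:
  assumes gen: "generic a b c d e f g"
  shows "supp_pair (1 + a - e) (1 + b - e) (1 + c - e) (1 + d - e) (1 + f - e) (1 + g - e) (2 - e)
     = supp_pair a b c d e f g + (gamma_hyp (1 + a - e) (1 + b - e) (1 + c - e) (1 + d - e) (1 + f - e) (1 + g - e) (2 - e) - gamma_hyp a b c d e f g)"
proof -
  have "1 + b - e - (1 + a - e) = b - a" "1 + c - e - (1 + a - e) = c - a" "1 + d - e - (1 + a - e) = d - a"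
    "1 - (1 + a - e) = e - a" "1 + f - e - (1 + a - e) = f - a" "1 + g - e - (1 + a - e) = g - a" "2 - e - (1 + a - e) = 1 - a"
    "1 + (1 + a - e) - (1 + f - e) = 1 + a - f" "1 + (1 + a - e) - (1 + g - e) = 1 + a - g" "1 + (1 + a - e) - (2 - e) = a"
    "1 + (1 + a - e) - (1 + b - e) = 1 + a - b" "1 + (1 + a - e) - (1 + c - e) = 1 + a - c" "1 + (1 + a - e) - (1 + d - e) = 1 + a - d"
    by simp_all
  note eqs = this
  have "res_a (1 + a - e) (1 + b - e) (1 + c - e) (1 + d - e) (1 + f - e) (1 + g - e) (2 - e) = res_a a b c d e f g"
    unfolding res_a_def eqs by (simp add: hyp4F3_at_1_def mult_ac)
  moreover have "sp (1 + a - e) = sp (e - a)"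
    using sp_add_1[of "a - e"] sp_diff_commute[of a e] by (simp add: add_diff_eq)
  moreover have "sp (1 - a) = sp a" by (rule sp_1_minus)
  ultimately show ?thesis
    unfolding supp_pair_def eqs by (simp add: mult_ac)
qed

text \<open>Collects the conditions from the intermediate series in \<open>hyp4F3_pair_dual\<close>,
  for both orders of \<open>f\<close> and \<open>g\<close>.\<close>

definition generic_sums :: "complex \<Rightarrow> complex \<Rightarrow> complex \<Rightarrow> complex \<Rightarrow> complex \<Rightarrow> complex \<Rightarrow> complex \<Rightarrow> bool" where
  "generic_sums a b c d e f g \<longleftrightarrow> (\<forall>z\<in>{f - a - b, f - c - d, g - a - b, g - c - d, e + f - c - d, e + g - c - d, f + g - c - d}. z \<notin> \<int>)"

lemma Gamma_prod_A4:
  assumes "p \<notin> \<int>" "q \<notin> \<int>" "r \<notin> \<int>" "s \<notin> \<int>"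
  shows "Gamma p * Gamma q * Gamma r * Gamma s * A4 p q r s = 1"
  using assms[THEN Gamma_nz] by (simp add: A4_def rGamma_inverse_Gamma inverse_eq_divide)

text \<open>This is \<open>gamma_hyp_dual\<close> at the reflected parameters. Reflecting there
  brings back the original upper parameters, translated by \<open>1 - e\<close> and
  \<open>1 - f\<close>, so the right-hand difference belongs to the exponents \<open>1 - e\<close>
  and \<open>1 - f\<close>. Four reflection formulas at \<open>g - a, ..., g - d\<close> account for
  the power of \<pi>.\<close>

lemma dual_difference:
  assumes bal: "e + f + g = 1 + a + b + c + d" and gen: "generic a b c d e f g"
    and gen2: "f - a - b \<notin> \<int>" "f - c - d \<notin> \<int>" "g - c - d \<notin> \<int>" "e + f - c - d \<notin> \<int>" "f + g - c - d \<notin> \<int>"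
  shows "(gamma_hyp (1 - a) (1 - b) (1 - c) (1 - d) (2 - e) (2 - f) (2 - g)
        - gamma_hyp (g - a) (g - b) (g - c) (g - d) (1 + g - e) (1 + g - f) g)
      * sp (f - e) * (sp (g - a) * sp (g - b) * sp (g - c) * sp (g - d))
    = (gamma_hyp (1 + a - e) (1 + b - e) (1 + c - e) (1 + d - e) (1 + f - e) (1 + g - e) (2 - e)
        - gamma_hyp (1 + a - f) (1 + b - f) (1 + c - f) (1 + d - f) (1 + e - f) (1 + g - f) (2 - f))
      * sp g * of_real pi ^ 4 * (Gamma (1 - a) * Gamma (1 - b) * Gamma (1 - c) * Gamma (1 - d))
      * (A4 (1 + a - e) (1 + b - e) (1 + c - e) (1 + d - e) * A4 (1 + a - f) (1 + b - f) (1 + c - f) (1 + d - f)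
         * A4 (1 + a - g) (1 + b - g) (1 + c - g) (1 + d - g))"
proof -
  have nI: "a \<notin> \<int>" "b \<notin> \<int>" "c \<notin> \<int>" "d \<notin> \<int>" "e \<notin> \<int>" "f \<notin> \<int>" "g \<notin> \<int>"
    "e - f \<notin> \<int>" "e - g \<notin> \<int>" "f - g \<notin> \<int>"
    "e - a \<notin> \<int>" "e - b \<notin> \<int>" "e - c \<notin> \<int>" "e - d \<notin> \<int>"
    "f - a \<notin> \<int>" "f - b \<notin> \<int>" "f - c \<notin> \<int>" "f - d \<notin> \<int>" "g - a \<notin> \<int>" "g - b \<notin> \<int>" "g - c \<notin> \<int>" "g - d \<notin> \<int>"
    using gen by (auto simp: generic_def)
  have s: "1 - z \<notin> \<int>" "2 - z \<notin> \<int>" if "z \<notin> \<int>" for z :: complex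
    by (rule not_Ints_shift[OF that], simp)+
  have s2: "2 - x - (1 - y) \<notin> \<int>" "2 - x - (2 - y) \<notin> \<int>" "2 - y - (2 - x) \<notin> \<int>" if "x - y \<notin> \<int>" for x y :: complex
    by (rule not_Ints_shift[OF that], simp)+
  have "(gamma_hyp (1 - a) (1 - b) (1 - c) (1 - d) (2 - e) (2 - f) (2 - g)
       - gamma_hyp (1 + (1 - a) - (2 - g)) (1 + (1 - b) - (2 - g)) (1 + (1 - c) - (2 - g)) (1 + (1 - d) - (2 - g))
           (1 + (2 - e) - (2 - g)) (1 + (2 - f) - (2 - g)) (2 - (2 - g)))
      * sin (of_real pi * ((2 - e) - (2 - f))) *
      (Gamma ((2 - e) - (1 - a)) * Gamma ((2 - e) - (1 - b)) * Gamma ((2 - e) - (1 - c)) * Gamma ((2 - e) - (1 - d)) *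
        (Gamma ((2 - f) - (1 - a)) * Gamma ((2 - f) - (1 - b)) * Gamma ((2 - f) - (1 - c)) * Gamma ((2 - f) - (1 - d))))
    = (gamma_hyp ((2 - f) - (1 - a)) ((2 - f) - (1 - b)) ((2 - f) - (1 - c)) ((2 - f) - (1 - d)) (2 - f) (1 + (2 - f) - (2 - g)) (1 + (2 - f) - (2 - e))
        - gamma_hyp ((2 - e) - (1 - a)) ((2 - e) - (1 - b)) ((2 - e) - (1 - c)) ((2 - e) - (1 - d)) (2 - e) (1 + (2 - e) - (2 - g)) (1 + (2 - e) - (2 - f)))
      * sin (of_real pi * (2 - g)) *
      (Gamma (1 - a) * Gamma (1 - b) * Gamma (1 - c) * Gamma (1 - d) *
       (Gamma (1 + (1 - a) - (2 - g)) * Gamma (1 + (1 - b) - (2 - g)) * Gamma (1 + (1 - c) - (2 - g)) * Gamma (1 + (1 - d) - (2 - g))))"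
  proof (rule gamma_hyp_dual)
    show "2 - e + (2 - f) + (2 - g) = 1 + (1 - a) + (1 - b) + (1 - c) + (1 - d)"
    proof -
      have "2 - e + (2 - f) + (2 - g) = 6 - (e + f + g)" by simp
      then show ?thesis unfolding bal by simp
    qed
    show "2 - f - (1 - a) - (1 - b) \<notin> \<int>" by (rule not_Ints_shift[OF gen2(1)]) simp
    show "2 - f - (1 - c) - (1 - d) \<notin> \<int>" by (rule not_Ints_shift[OF gen2(2)]) simp
    show "2 - g - (1 - c) - (1 - d) \<notin> \<int>" by (rule not_Ints_shift[OF gen2(3)]) simp
    show "2 - e + (2 - f) - (1 - c) - (1 - d) \<notin> \<int>" by (rule not_Ints_shift[OF gen2(4)]) simp
    show "2 - f + (2 - g) - (1 - c) - (1 - d) \<notin> \<int>" by (rule not_Ints_shift[OF gen2(5)]) simp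
  qed (use nI(1-7)[THEN s(1)] nI(1-7)[THEN s(2)] nI(8-)[THEN s2(1)] nI(8-)[THEN s2(2)] nI(8-)[THEN s2(3)] in auto)
  moreover have "1 + (1 - z) - (2 - g) = g - z" "(2 - e) - (1 - z) = 1 + z - e" "(2 - f) - (1 - z) = 1 + z - f" for z
    by simp_all
  moreover have "1 + (2 - e) - (2 - g) = 1 + g - e" "1 + (2 - f) - (2 - g) = 1 + g - f" "2 - (2 - g) = g" "(2 - e) - (2 - f) = f - e"
    "1 + (2 - f) - (2 - e) = 1 + e - f" "1 + (2 - e) - (2 - f) = 1 + f - e"
    by simp_all
  moreover have "gamma_hyp p q r s (2 - f) (1 + g - f) (1 + e - f) = gamma_hyp p q r s (1 + e - f) (1 + g - f) (2 - f)"
    "gamma_hyp p q r s (2 - e) (1 + g - e) (1 + f - e) = gamma_hyp p q r s (1 + f - e) (1 + g - e) (2 - e)" for p q r s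
    by (simp_all add: gamma_hyp_def hyp4F3_at_1_def mult_ac)
  moreover define X where "X = gamma_hyp (1 - a) (1 - b) (1 - c) (1 - d) (2 - e) (2 - f) (2 - g)
        - gamma_hyp (g - a) (g - b) (g - c) (g - d) (1 + g - e) (1 + g - f) g"
  moreover define Fe Ff where "Fe = gamma_hyp (1 + a - e) (1 + b - e) (1 + c - e) (1 + d - e) (1 + f - e) (1 + g - e) (2 - e)"
     and "Ff = gamma_hyp (1 + a - f) (1 + b - f) (1 + c - f) (1 + d - f) (1 + e - f) (1 + g - f) (2 - f)"
  moreover define Ge Gf Gg W where "Ge = Gamma (1 + a - e) * Gamma (1 + b - e) * Gamma (1 + c - e) * Gamma (1 + d - e)"
    and "Gf = Gamma (1 + a - f) * Gamma (1 + b - f) * Gamma (1 + c - f) * Gamma (1 + d - f)"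
    and "Gg = Gamma (g - a) * Gamma (g - b) * Gamma (g - c) * Gamma (g - d)"
    and "W = Gamma (1 - a) * Gamma (1 - b) * Gamma (1 - c) * Gamma (1 - d)"
  ultimately have main: "X * sp (f - e) * (Ge * Gf) = (Ff - Fe) * sp (2 - g) * (W * Gg)"
    by (simp only: sp_def)
  define Sg where "Sg = sp (g - a) * sp (g - b) * sp (g - c) * sp (g - d)"
  define Ae Af Ag where "Ae = A4 (1 + a - e) (1 + b - e) (1 + c - e) (1 + d - e)" and "Af = A4 (1 + a - f) (1 + b - f) (1 + c - f) (1 + d - f)"
    and "Ag = A4 (1 + a - g) (1 + b - g) (1 + c - g) (1 + d - g)"
  have inv: "Ge * Ae = 1" "Gf * Af = 1"
    unfolding Ge_def Ae_def Gf_def Af_def by (rule Gamma_prod_A4; rule not_Ints_1_add(2), rule nI)+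
  have gs: "Gamma (g - z) * sp (g - z) = of_real pi * rGamma (1 + z - g)" if "g - z \<notin> \<int>" for z
    using Gamma_sp[OF that] by (simp add: algebra_simps)
  have "Gg * Sg = (Gamma (g - a) * sp (g - a)) * (Gamma (g - b) * sp (g - b)) * (Gamma (g - c) * sp (g - c)) * (Gamma (g - d) * sp (g - d))"
    by (simp only: Gg_def Sg_def mult_ac)
  also have "\<dots> = of_real pi ^ 4 * Ag"
    unfolding gs[OF nI(19)] gs[OF nI(20)] gs[OF nI(21)] gs[OF nI(22)] Ag_def A4_def by (simp add: power4_eq_xxxx mult_ac)
  finally have GS: "Gg * Sg = of_real pi ^ 4 * Ag" .
  have "Ge * Gf * (Ae * Af) = (Ge * Ae) * (Gf * Af)" by (simp only: mult_ac)
  then have inv2: "Ge * Gf * (Ae * Af) = 1" unfolding inv by simp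
  have "X * sp (f - e) * Sg = X * sp (f - e) * (Ge * Gf * (Ae * Af)) * Sg"
    unfolding inv2 by simp
  also have "\<dots> = X * sp (f - e) * (Ge * Gf) * (Ae * Af) * Sg"
    by (simp only: mult.assoc)
  also have "\<dots> = (Ff - Fe) * sp (2 - g) * W * (Gg * Sg) * (Ae * Af)"
    unfolding main by (simp only: mult_ac)
  also have "\<dots> = (Fe - Ff) * sp g * of_real pi ^ 4 * W * (Ae * Af * Ag)"
    unfolding GS sp_2_minus by (simp add: algebra_simps)
  finally show ?thesis unfolding X_def Fe_def Ff_def W_def Sg_def Ae_def Af_def Ag_def .
qed

text \<open>The values \<open>u, v, wf, wg\<close> will be the supplemented series at the exponents
  \<open>0, 1 - e, 1 - f, 1 - g\<close>. \<open>Rf\<close> and \<open>Rg\<close> determine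
  \<open>wf - v\<close> and \<open>wg - v\<close> from \<open>u\<close> and \<open>v\<close>; in
  doing so \<open>I1\<close> and \<open>I2\<close> remove \<open>Pe\<close>. In the remaining
  combination \<open>I3\<close> collects the coefficient of \<open>v\<close> and \<open>I4\<close>
  that of \<open>u - v\<close>, with the common factor \<open>Sfg\<close>.\<close>

lemma three_term_algebra:
  fixes u v wf wg :: complex
  assumes nz: "Se \<noteq> 0" "Sef \<noteq> 0" "Seg \<noteq> 0" "Sfg \<noteq> 0" "Sf \<noteq> 0" "Sg \<noteq> 0"
    and Rf: "Sga * u = (Pe / Se * (u - v) - Pf / Sf * (u - wf)) / Sef"
    and Rg: "Sfa * u = (Pe / Se * (u - v) - Pg / Sg * (u - wg)) / Seg"
    and I1: "Se * Pf - Sf * Pe = - (Sef * (B + Sga * Se * Sf))"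
    and I2: "Se * Pg - Sg * Pe = - (Seg * (B + Sfa * Se * Sg))"
    and I3: "Sf * Pg - Sg * Pf = - (Sfg * b4)"
    and I4: "Sfa * Pg - Sga * Pf = - (Sfg * b2)"
  shows "B * b2 * (u - v) - Se * Sfa * Sga * b4 * v
     + Se * (Pg * Sfa * (Pf * (wf - v) / - Sef) - Pf * Sga * (Pg * (wg - v) / - Seg)) / Sfg = 0"
proof -
  have f: "Se * (Pf * (wf - v)) = - Sef * ((u - v) * B - Se * Sf * Sga * v)"
  proof -
    have "Sga * u * Sef * Se * Sf = Pe * Sf * (u - v) - Pf * Se * (u - wf)"
      unfolding Rf using nz by (simp add: field_simps)
    then show ?thesis using I1 by algebra
  qed
  have g: "Se * (Pg * (wg - v)) = - Seg * ((u - v) * B - Se * Sg * Sfa * v)"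
  proof -
    have "Sfa * u * Seg * Se * Sg = Pe * Sg * (u - v) - Pg * Se * (u - wg)"
      unfolding Rg using nz by (simp add: field_simps)
    then show ?thesis using I2 by algebra
  qed
  have "Se * (Pg * Sfa * (Pf * (wf - v) / - Sef) - Pf * Sga * (Pg * (wg - v) / - Seg)) =
     Pg * Sfa * (Se * (Pf * (wf - v)) / - Sef) - Pf * Sga * (Se * (Pg * (wg - v)) / - Seg)"
    by (simp add: algebra_simps)
  also have "\<dots> = Pg * Sfa * ((u - v) * B - Se * Sf * Sga * v) - Pf * Sga * ((u - v) * B - Se * Sg * Sfa * v)"
    unfolding f g using nz by simp
  also have "\<dots> = - Sfg * ((u - v) * B * b2 - Se * Sfa * Sga * v * b4)"
    using I3 I4 by algebra
  finally have key: "Se * (Pg * Sfa * (Pf * (wf - v) / - Sef) - Pf * Sga * (Pg * (wg - v) / - Seg))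
      = - Sfg * ((u - v) * B * b2 - Se * Sfa * Sga * v * b4)" .
  have "- Sfg * Y / Sfg = - Y" for Y
    using nz(4) by simp
  then show ?thesis
    unfolding key by (simp only:) (simp add: algebra_simps)
qed

text \<open>The K functions are replaced by \<open>u\<close>, \<open>v\<close> and
  \<open>ud\<close>. The relation for \<open>ud\<close> involves differences of reflected series
  only; the duality expresses these by \<open>v - wf\<close> and \<open>v - wg\<close>, and
  \<open>three_term_algebra\<close> then concerns the original parameters alone.\<close>

lemma three_term_generic:
  assumes bal: "e + f + g = 1 + a + b + c + d" and gen: "generic a b c d e f g" and gen2: "generic_sums a b c d e f g"
  shows "A4 (1 - a) (1 - b) (1 - c) (1 - d)
           * A4 (1 + a - e) (1 + b - e) (1 + c - e) (1 + d - e) * B2 (a, b, c, d, e, f, g) * K_fun (p0 (a, b, c, d, e, f, g))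
         + sin_prod [e] * A4 (f - a) (f - b) (f - c) (f - d) * A4 (g - a) (g - b) (g - c) (g - d)
           * (A4 a (1 + a - e) (1 + a - f) (1 + a - g))\<^sup>2 * K_fun (n0 (a, b, c, d, e, f, g))
         - C_coeff (a, b, c, d, e, f, g) * K_fun (p4 (a, b, c, d, e, f, g)) = 0"
proof -
  have nI: "a \<notin> \<int>" "b \<notin> \<int>" "c \<notin> \<int>" "d \<notin> \<int>" "e \<notin> \<int>" "f \<notin> \<int>" "g \<notin> \<int>"
    "e - f \<notin> \<int>" "e - g \<notin> \<int>" "f - g \<notin> \<int>"
    "e - a \<notin> \<int>" "e - b \<notin> \<int>" "e - c \<notin> \<int>" "e - d \<notin> \<int>"
    "f - a \<notin> \<int>" "f - b \<notin> \<int>" "f - c \<notin> \<int>" "f - d \<notin> \<int>" "g - a \<notin> \<int>" "g - b \<notin> \<int>" "g - c \<notin> \<int>" "g - d \<notin> \<int>"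
    using gen by (auto simp: generic_def)
  note snz = nI[THEN sp_nz]
  have nI2: "f - a - b \<notin> \<int>" "f - c - d \<notin> \<int>" "g - a - b \<notin> \<int>" "g - c - d \<notin> \<int>" "e + f - c - d \<notin> \<int>" "e + g - c - d \<notin> \<int>" "f + g - c - d \<notin> \<int>"
    using gen2 by (auto simp: generic_sums_def)
  have gen': "generic a b c d e g f"
    using gen not_Ints_minus[OF nI(10)] by (simp add: generic_def)
  have bal': "e + g + f = 1 + a + b + c + d"
    using bal by (simp add: add_ac)
  define \<phi>0 \<phi>e \<phi>f \<phi>g where "\<phi>0 = gamma_hyp a b c d e f g"
    and "\<phi>e = gamma_hyp (1 + a - e) (1 + b - e) (1 + c - e) (1 + d - e) (1 + f - e) (1 + g - e) (2 - e)"
    and "\<phi>f = gamma_hyp (1 + a - f) (1 + b - f) (1 + c - f) (1 + d - f) (1 + e - f) (1 + g - f) (2 - f)"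
    and "\<phi>g = gamma_hyp (1 + a - g) (1 + b - g) (1 + c - g) (1 + d - g) (1 + e - g) (1 + f - g) (2 - g)"
  define u where "u = supp_pair a b c d e f g"
  define v wf wg where "v = u + (\<phi>e - \<phi>0)" and "wf = u + (\<phi>f - \<phi>0)" and "wg = u + (\<phi>g - \<phi>0)"
  define ud where "ud = supp_pair (1 - a) (1 - b) (1 - c) (1 - d) (2 - e) (2 - f) (2 - g)"
  define Pe Pf Pg B where "Pe = sp (e - b) * sp (e - c) * sp (e - d)" and "Pf = sp (f - b) * sp (f - c) * sp (f - d)"
    and "Pg = sp (g - b) * sp (g - c) * sp (g - d)" and "B = sp b * sp c * sp d"
  have ghp: "gamma_hyp p q r s x y z = gamma_hyp p q r s y x z" "gamma_hyp p q r s x y z = gamma_hyp p q r s x z y"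
    for p q r s x y z by (simp_all add: gamma_hyp_def hyp4F3_at_1_def mult_ac)
  have Rf: "sp (g - a) * u = (Pe / sp e * (u - v) - Pf / sp f * (u - wf)) / sp (e - f)"
    using supp_pair_relation[OF bal gen] by (simp add: u_def v_def wf_def \<phi>0_def \<phi>e_def \<phi>f_def Pe_def Pf_def)
  have Rg: "sp (f - a) * u = (Pe / sp e * (u - v) - Pg / sp g * (u - wg)) / sp (e - g)"
  proof -
    have "supp_pair a b c d e g f = u" unfolding u_def by (rule supp_pair_perm(2))
    moreover have "gamma_hyp a b c d e g f = \<phi>0" unfolding \<phi>0_def by (rule ghp(2))
    moreover have "gamma_hyp (1 + a - e) (1 + b - e) (1 + c - e) (1 + d - e) (1 + g - e) (1 + f - e) (2 - e) = \<phi>e"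
      unfolding \<phi>e_def by (rule ghp(1))
    ultimately show ?thesis
      using supp_pair_relation[OF bal' gen'] by (simp add: v_def wg_def \<phi>g_def Pe_def Pg_def)
  qed
  have bd: "b + c + d = e + f + g - 1 - a" using bal by simp
  have spm: "sp (z - 1) = - sp z" for z using sp_1_minus[of z] sp_diff_commute[of z 1] by simp
  \<comment> \<open>For every ordering \<open>x, y, z\<close> of the lower parameters balance turns
    the remaining sine of \<open>sp_identity\<close> into that of \<open>z - a\<close>. The choices
    of \<open>z\<close> yield \<open>I1\<close>, \<open>I2\<close> and \<open>I3\<close>.\<close>
  have I: "sp x * (sp (y - b) * sp (y - c) * sp (y - d)) - sp y * (sp (x - b) * sp (x - c) * sp (x - d))
    = - (sp (x - y) * (B + sp (z - a) * sp x * sp y))" if "x + y + z = e + f + g" for x y z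
  proof -
    have "b + c + d - x - y = z - a - 1" unfolding bd using that[symmetric] by simp
    then show ?thesis using sp_identity[of x y b c d] spm[of "z - a"] by (simp add: B_def)
  qed
  have I1: "sp e * Pf - sp f * Pe = - (sp (e - f) * (B + sp (g - a) * sp e * sp f))"
    unfolding Pe_def Pf_def by (rule I) simp
  have I2: "sp e * Pg - sp g * Pe = - (sp (e - g) * (B + sp (f - a) * sp e * sp g))"
    unfolding Pe_def Pg_def by (rule I) simp
  define b4 b2 where "b4 = B + sp (e - a) * sp f * sp g"
    and "b2 = sp (b - a) * sp (c - a) * sp (d - a) + sp (e - 2 * a) * sp (f - a) * sp (g - a)"
  have I3: "sp f * Pg - sp g * Pf = - (sp (f - g) * b4)"
    unfolding Pf_def Pg_def b4_def by (rule I) simp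
  \<comment> \<open>The same identity after translation of all arguments by \<open>- a\<close>; this
    is the origin of the argument \<open>e - 2 a\<close> in \<open>B2\<close>.\<close>
  have I4: "sp (f - a) * Pg - sp (g - a) * Pf = - (sp (f - g) * b2)"
  proof -
    have "b - a + (c - a) + (d - a) - (f - a) - (g - a) = e - 2 * a - 1"
      using bd by (simp add: algebra_simps)
    then have "sp (b - a + (c - a) + (d - a) - (f - a) - (g - a)) = - sp (e - 2 * a)"
      by (simp only: spm)
    then show ?thesis
      using sp_identity[of "f - a" "g - a" "b - a" "c - a" "d - a"] by (simp add: Pf_def Pg_def b2_def)
  qed
  have core: "B * b2 * (u - v) - sp e * sp (f - a) * sp (g - a) * b4 * v
     + sp e * (Pg * sp (f - a) * (Pf * (wf - v) / - sp (e - f)) - Pf * sp (g - a) * (Pg * (wg - v) / - sp (e - g))) / sp (f - g) = 0"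
    by (rule three_term_algebra[OF snz(5,8,9,10,6,7) Rf Rg I1 I2 I3 I4])
  define W Ae Af Ag where "W = Gamma (1 - a) * Gamma (1 - b) * Gamma (1 - c) * Gamma (1 - d)"
    and "Ae = A4 (1 + a - e) (1 + b - e) (1 + c - e) (1 + d - e)" and "Af = A4 (1 + a - f) (1 + b - f) (1 + c - f) (1 + d - f)"
    and "Ag = A4 (1 + a - g) (1 + b - g) (1 + c - g) (1 + d - g)"
  define \<psi>0 \<psi>f \<psi>g where "\<psi>0 = gamma_hyp (1 - a) (1 - b) (1 - c) (1 - d) (2 - e) (2 - f) (2 - g)"
    and "\<psi>f = gamma_hyp (f - a) (f - b) (f - c) (f - d) (1 + f - e) (1 + f - g) f"
    and "\<psi>g = gamma_hyp (g - a) (g - b) (g - c) (g - d) (1 + g - e) (1 + g - f) g"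
  have Dg: "(\<psi>0 - \<psi>g) * sp (f - e) * (sp (g - a) * Pg) = (\<phi>e - \<phi>f) * sp g * of_real pi ^ 4 * W * (Ae * Af * Ag)"
    using dual_difference[OF bal gen nI2(1,2,4,5,7)]
    unfolding \<psi>0_def \<psi>g_def \<phi>e_def \<phi>f_def W_def Ae_def Af_def Ag_def Pg_def by (simp only: mult.assoc)
  have Df: "(\<psi>0 - \<psi>f) * sp (g - e) * (sp (f - a) * Pf) = (\<phi>e - \<phi>g) * sp f * of_real pi ^ 4 * W * (Ae * Af * Ag)"
  proof -
    have "g + f - c - d \<notin> \<int>" using nI2(7) by (simp add: add.commute)
    note d = dual_difference[OF bal' gen' nI2(3,4,2,6) this]
    have 1: "gamma_hyp (1 - a) (1 - b) (1 - c) (1 - d) (2 - e) (2 - g) (2 - f) = \<psi>0" unfolding \<psi>0_def by (rule ghp(2))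
    have 2: "gamma_hyp (1 + a - e) (1 + b - e) (1 + c - e) (1 + d - e) (1 + g - e) (1 + f - e) (2 - e) = \<phi>e" unfolding \<phi>e_def by (rule ghp(1))
    show ?thesis
      using d unfolding 1 2 unfolding \<psi>f_def[symmetric] \<phi>g_def[symmetric] W_def[symmetric] Ae_def[symmetric] Af_def[symmetric] Ag_def[symmetric] Pf_def
      by (simp only: mult_ac)
  qed
  \<comment> \<open>At the reflected parameters the relation is taken for the pair
    \<open>2 - f, 2 - g\<close>. The differences from \<open>\<psi>0\<close> that then occur are
    those whose duals contain \<open>\<phi>e\<close>, the series belonging to
    \<open>p4\<close>.\<close>
  have Rd: "sp (e - a) * ud = (Pf / sp f * (\<psi>0 - \<psi>f) - Pg / sp g * (\<psi>0 - \<psi>g)) / sp (f - g)"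
  proof -
    have gd: "generic (1 - a) (1 - b) (1 - c) (1 - d) (2 - f) (2 - g) (2 - e)"
      using generic_dual[OF gen] not_Ints_minus by (auto simp: generic_def)
    have bald: "2 - f + (2 - g) + (2 - e) = 1 + (1 - a) + (1 - b) + (1 - c) + (1 - d)"
    proof -
      have "2 - f + (2 - g) + (2 - e) = 6 - (e + f + g)" by simp
      then show ?thesis unfolding bal by simp
    qed
    have e1: "2 - x - (1 - y) = 1 - (x - y)" for x y :: complex by simp
    have e2: "1 + (1 - z) - (2 - x) = x - z" "1 + (2 - y) - (2 - x) = 1 + x - y" "2 - (2 - x) = x" for x y z :: complex by simp_all
    have e3: "(2 - f) - (2 - g) = g - f" by simp
    have 1: "supp_pair (1 - a) (1 - b) (1 - c) (1 - d) (2 - f) (2 - g) (2 - e) = ud"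
      unfolding ud_def by (metis supp_pair_perm)
    have 2: "gamma_hyp (1 - a) (1 - b) (1 - c) (1 - d) (2 - f) (2 - g) (2 - e) = \<psi>0"
      unfolding \<psi>0_def by (metis ghp)
    have 3: "gamma_hyp (f - a) (f - b) (f - c) (f - d) (1 + f - g) (1 + f - e) f = \<psi>f"
       "gamma_hyp (g - a) (g - b) (g - c) (g - d) (1 + g - f) (1 + g - e) g = \<psi>g"
      unfolding \<psi>f_def \<psi>g_def by (rule ghp(1))+
    have neg: "(p / - s * X - q / - t * Y) / - w = (p / s * X - q / t * Y) / w" for p s X q t Y w :: complex
      unfolding divide_inverse by (simp add: algebra_simps)
    have "sp (e - a) * ud = (Pf / - sp f * (\<psi>0 - \<psi>f) - Pg / - sp g * (\<psi>0 - \<psi>g)) / sp (g - f)"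
      using supp_pair_relation[OF bald gd] unfolding e1 e2 e3 1 2 3 sp_1_minus sp_2_minus Pf_def Pg_def .
    also have "\<dots> = (Pf / sp f * (\<psi>0 - \<psi>f) - Pg / sp g * (\<psi>0 - \<psi>g)) / sp (f - g)"
      unfolding sp_diff_commute[of g f] by (rule neg)
    finally show ?thesis .
  qed
  have nzP: "Pf \<noteq> 0" "Pg \<noteq> 0" using snz by (auto simp: Pf_def Pg_def)
  \<comment> \<open>Both dual differences carry the same Gamma factor \<open>k\<close>, since it is
    symmetric in \<open>f\<close> and \<open>g\<close>. It can therefore be taken out of the
    relation for \<open>ud\<close>.\<close>
  have Kd: "sp (e - a) * ud * (sp (f - a) * sp (g - a) * (Pf * Pg)) = of_real pi ^ 4 * W * (Ae * Af * Ag) *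
     (Pg * sp (f - a) * (Pf * (wf - v) / - sp (e - f)) - Pf * sp (g - a) * (Pg * (wg - v) / - sp (e - g))) / sp (f - g)"
  proof -
    define k where "k = of_real pi ^ 4 * W * (Ae * Af * Ag)"
    have n1: "sp (g - e) * (sp (f - a) * Pf) \<noteq> 0" and n2: "sp (f - e) * (sp (g - a) * Pg) \<noteq> 0"
      using snz(8,9,15,19) sp_diff_commute[of g e] sp_diff_commute[of f e] nzP by simp_all
    have "(\<psi>0 - \<psi>f) * (sp (g - e) * (sp (f - a) * Pf)) = - (wg - v) * sp f * k"
      using Df by (simp add: k_def v_def wg_def mult.assoc)
    then have ff: "\<psi>0 - \<psi>f = - (wg - v) * sp f * k / (sp (g - e) * (sp (f - a) * Pf))"
      by (simp only: nonzero_eq_divide_eq[OF n1])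
    have "(\<psi>0 - \<psi>g) * (sp (f - e) * (sp (g - a) * Pg)) = - (wf - v) * sp g * k"
      using Dg by (simp add: k_def v_def wf_def mult.assoc)
    then have gg: "\<psi>0 - \<psi>g = - (wf - v) * sp g * k / (sp (f - e) * (sp (g - a) * Pg))"
      by (simp only: nonzero_eq_divide_eq[OF n2])
    have alg: "(Pf / sf * (- X * sf * k / (sge * (sfa * Pf))) - Pg / sg * (- Y * sg * k / (sfe * (sga * Pg)))) / sfg * (sfa * sga * (Pf * Pg)) =
        k * (Pg * sfa * (Pf * Y / sfe) - Pf * sga * (Pg * X / sge)) / sfg"
      if "Pf \<noteq> 0" "Pg \<noteq> 0" "sf \<noteq> 0" "sg \<noteq> 0" "sfa \<noteq> 0" "sga \<noteq> 0" for Pf Pg sf sg sfa sga sfe sge sfg X Y k :: complex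
    proof -
      have r: "Pf / sf * (- X * sf * k / (sge * (sfa * Pf))) = - (X * k / (sge * sfa))"
        "Pg / sg * (- Y * sg * k / (sfe * (sga * Pg))) = - (Y * k / (sfe * sga))"
        using that by simp_all
      have t: "X * k / (sge * sfa) * (sfa * sga * (Pf * Pg)) = k * (Pf * sga * (Pg * X / sge))"
        "Y * k / (sfe * sga) * (sfa * sga * (Pf * Pg)) = k * (Pg * sfa * (Pf * Y / sfe))"
        using that by (simp_all add: mult_ac)
      have "(- p - - q) / sfg * m = (q * m - p * m) / sfg" for p q m :: complex
        by (simp add: left_diff_distrib)
      then show ?thesis unfolding r by (simp only: t right_diff_distrib)
    qed
    show ?thesis
      unfolding Rd ff gg k_def[symmetric] sp_diff_commute[of e f, symmetric]
      using alg[OF nzP snz(6,7,15,19), of "wg - v" k "sp (g - e)" "wf - v" "sp (f - e)" "sp (f - g)"]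
      unfolding sp_diff_commute[of f e] sp_diff_commute[of g e] by simp
  qed
  define G where "G = A4 a (1 + a - e) (1 + a - f) (1 + a - g)"
  define A1 Aa Gd where "A1 = A4 (1 - a) (1 - b) (1 - c) (1 - d)" and "Aa = A4 a b c d" and "Gd = A4 (1 - a) (e - a) (f - a) (g - a)"
  have K0: "K_fun (a, b, c, d, e, f, g) = Aa * G / sp a * u"
    unfolding Aa_def G_def u_def by (rule K_fun_supp_pair[OF gen])
  have K4: "K_fun (1 + a - e, 1 + b - e, 1 + c - e, 1 + d - e, 1 + f - e, 1 + g - e, 2 - e) = Ae * G / sp (e - a) * v"
  proof -
    have 1: "1 + (1 + a - e) - (1 + f - e) = 1 + a - f" "1 + (1 + a - e) - (1 + g - e) = 1 + a - g" "1 + (1 + a - e) - (2 - e) = a"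
      by simp_all
    have "A4 (1 + a - e) (1 + a - f) (1 + a - g) a = G" by (simp add: G_def A4_def mult_ac)
    moreover have "sp (1 + a - e) = sp (e - a)"
      using sp_add_1[of "a - e"] sp_diff_commute[of a e] by (simp add: add_diff_eq)
    moreover have "supp_pair (1 + a - e) (1 + b - e) (1 + c - e) (1 + d - e) (1 + f - e) (1 + g - e) (2 - e) = v"
      unfolding supp_pair_shift[OF gen] v_def u_def \<phi>e_def \<phi>0_def ..
    ultimately show ?thesis
      using K_fun_supp_pair[OF generic_shift[OF gen]] unfolding 1 Ae_def by (simp only:)
  qed
  have Kn: "K_fun (1 - a, 1 - b, 1 - c, 1 - d, 2 - e, 2 - f, 2 - g) = A1 * Gd / sp a * ud"
  proof -
    have "1 + (1 - a) - (2 - z) = z - a" for z by simp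
    then show ?thesis
      using K_fun_supp_pair[OF generic_dual[OF gen]] by (simp only: A1_def Gd_def ud_def sp_1_minus)
  qed
  have rr: "rGamma (1 + z - x) * rGamma (x - z) = sp (x - z) / of_real pi" for x z
    using rGamma_sp[of "x - z"] by (simp add: mult.commute diff_diff_eq2)
  have AA: "A1 * Aa = sp a * B / of_real pi ^ 4"
  proof -
    have "A1 * Aa = (rGamma a * rGamma (1 - a)) * (rGamma b * rGamma (1 - b)) * (rGamma c * rGamma (1 - c)) * (rGamma d * rGamma (1 - d))"
      unfolding A1_def Aa_def A4_def by (simp only: mult_ac)
    then show ?thesis unfolding rGamma_sp B_def by (simp add: power4_eq_xxxx)
  qed
  have GG: "G * Gd = sp a * sp (e - a) * sp (f - a) * sp (g - a) / of_real pi ^ 4"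
  proof -
    have "G * Gd = (rGamma a * rGamma (1 - a)) * (rGamma (1 + a - e) * rGamma (e - a)) * (rGamma (1 + a - f) * rGamma (f - a)) * (rGamma (1 + a - g) * rGamma (g - a))"
      unfolding G_def Gd_def A4_def by (simp only: mult_ac)
    then show ?thesis unfolding rGamma_sp rr by (simp add: power4_eq_xxxx)
  qed
  have AAx: "A4 (x - a) (x - b) (x - c) (x - d) * A4 (1 + a - x) (1 + b - x) (1 + c - x) (1 + d - x)
     = sp (x - a) * (sp (x - b) * sp (x - c) * sp (x - d)) / of_real pi ^ 4" for x
  proof -
    have "A4 (x - a) (x - b) (x - c) (x - d) * A4 (1 + a - x) (1 + b - x) (1 + c - x) (1 + d - x)
      = (rGamma (1 + a - x) * rGamma (x - a)) * (rGamma (1 + b - x) * rGamma (x - b)) * (rGamma (1 + c - x) * rGamma (x - c)) * (rGamma (1 + d - x) * rGamma (x - d))"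
      unfolding A4_def by (simp only: mult_ac)
    then show ?thesis unfolding rr by (simp add: power4_eq_xxxx)
  qed
  define Xf Xg where "Xf = A4 (f - a) (f - b) (f - c) (f - d)" and "Xg = A4 (g - a) (g - b) (g - c) (g - d)"
  have Xf: "Xf * Af = sp (f - a) * Pf / of_real pi ^ 4" unfolding Xf_def Af_def Pf_def by (rule AAx)
  have Xg: "Xg * Ag = sp (g - a) * Pg / of_real pi ^ 4" unfolding Xg_def Ag_def Pg_def by (rule AAx)
  have A1W: "A1 * W = 1"
    using Gamma_prod_A4[OF nI(1-4)[THEN not_Ints_1_add(4)]] by (simp add: A1_def W_def mult.commute)
  define p where "p = (of_real pi :: complex) ^ 4"
  have p0: "p \<noteq> 0" by (simp add: p_def)
  define R where "R = (Pg * sp (f - a) * (Pf * (wf - v) / - sp (e - f)) - Pf * sp (g - a) * (Pg * (wg - v) / - sp (e - g))) / sp (f - g)"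
  \<comment> \<open>One factor \<open>G\<close> of the square is turned into sines by reflection
    against \<open>Gd\<close>; the other is the factor that the K functions at \<open>p0\<close> and
    \<open>p4\<close> contain as well. This explains the square in the coefficient.\<close>
  have t2: "sp e * Xf * Xg * G ^ 2 * (A1 * Gd / sp a * ud) = Ae * G * (sp e * (sp (f - a) * sp (g - a)) * R) / p ^ 2"
  proof -
    have "sp e * Xf * Xg * G ^ 2 * (A1 * Gd / sp a * ud) = sp e * Xf * Xg * G * A1 * (G * Gd) / sp a * ud"
      by (simp add: power2_eq_square mult_ac)
    also have "\<dots> = sp e * Xf * Xg * G * A1 * (sp (f - a) * sp (g - a)) * (sp (e - a) * ud) / p"
      unfolding GG p_def[symmetric] using snz(1) by (simp add: mult_ac)
    finally have s1: "sp e * Xf * Xg * G ^ 2 * (A1 * Gd / sp a * ud) =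
       sp e * Xf * Xg * G * A1 * (sp (f - a) * sp (g - a)) * (sp (e - a) * ud) / p" .
    have assoc: "K * E / p * m = K * (E * m) / p" for K E p m :: complex
      by simp
    have "sp e * Xf * Xg * G ^ 2 * (A1 * Gd / sp a * ud) * (sp (f - a) * sp (g - a) * (Pf * Pg)) =
       sp e * Xf * Xg * G * A1 * (sp (f - a) * sp (g - a)) * (sp (e - a) * ud * (sp (f - a) * sp (g - a) * (Pf * Pg))) / p"
      unfolding s1 by (rule assoc)
    also have "\<dots> = sp e * G * (sp (f - a) * sp (g - a)) * (A1 * W) * (Xf * Af) * (Xg * Ag) * Ae * R"
      unfolding Kd p_def[symmetric] R_def using p0 by (simp add: mult_ac)
    also have "\<dots> = (Ae * G * (sp e * (sp (f - a) * sp (g - a)) * R) / p ^ 2) * (sp (f - a) * sp (g - a) * (Pf * Pg))"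
      unfolding A1W Xf Xg p_def[symmetric] by (simp add: power2_eq_square mult_ac)
    finally show ?thesis
      using mult_right_cancel[of "sp (f - a) * sp (g - a) * (Pf * Pg)"] nzP snz(15,19) by (simp only: mult_eq_0_iff) blast
  qed
  have B2: "B2 (a, b, c, d, e, f, g) = sp (f - a) * sp (g - a) * b2 / p"
    by (simp add: sin_prod_def sp_def b2_def p_def)
  have B4: "B4 (a, b, c, d, e, f, g) = sp (f - a) * sp (g - a) * b4 / p"
    by (simp add: sin_prod_def sp_def b4_def B_def p_def)
  \<comment> \<open>Outside \<open>R\<close>, the value \<open>v\<close> enters \<open>core\<close>
    once through \<open>u - v\<close> with coefficient \<open>B b2\<close> and once with
    \<open>b4\<close>; these two contributions are the two summands of
    \<open>C_coeff\<close>.\<close>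
  have C: "C_coeff (a, b, c, d, e, f, g) = sp (e - a) * (B * (sp (f - a) * sp (g - a) * b2 / p) + sp e * sp (f - a) * sp (g - a) * (sp (f - a) * sp (g - a) * b4 / p)) / p"
    unfolding C_coeff.simps B2 B4 by (simp add: sin_prod_def sp_def B_def p_def mult.assoc)
  have "A1 * Ae * B2 (a, b, c, d, e, f, g) * (Aa * G / sp a * u) + sp e * Xf * Xg * G ^ 2 * (A1 * Gd / sp a * ud)
     - C_coeff (a, b, c, d, e, f, g) * (Ae * G / sp (e - a) * v)
    = Ae * G * (sp (f - a) * sp (g - a)) / p ^ 2 * (B * b2 * (u - v) - sp e * sp (f - a) * sp (g - a) * b4 * v + sp e * R)"
  proof -
    have "A1 * Ae * B2 (a, b, c, d, e, f, g) * (Aa * G / sp a * u) = (A1 * Aa) * (Ae * B2 (a, b, c, d, e, f, g) * G * u) / sp a"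
      by (simp add: mult_ac)
    also have "\<dots> = Ae * G * (sp (f - a) * sp (g - a)) / p ^ 2 * (B * b2 * u)"
      unfolding AA B2 p_def[symmetric] using snz(1) by (simp add: power2_eq_square mult_ac)
    finally have t1: "A1 * Ae * B2 (a, b, c, d, e, f, g) * (Aa * G / sp a * u) = Ae * G * (sp (f - a) * sp (g - a)) / p ^ 2 * (B * b2 * u)" .
    have t3: "C_coeff (a, b, c, d, e, f, g) * (Ae * G / sp (e - a) * v) =
       Ae * G * (sp (f - a) * sp (g - a)) / p ^ 2 * (B * b2 * v + sp e * sp (f - a) * sp (g - a) * b4 * v)"
      unfolding C using snz(11) p0 by (simp add: power2_eq_square field_simps)
    show ?thesis
      unfolding t1 t2 t3 by (simp add: algebra_simps add_divide_distrib diff_divide_distrib)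
  qed
  also have "B * b2 * (u - v) - sp e * sp (f - a) * sp (g - a) * b4 * v + sp e * R = 0"
    using core by (simp add: R_def)
  finally show ?thesis
    unfolding p0.simps n0.simps p4.simps K0 K4 Kn A1_def Ae_def[symmetric] Xf_def Xg_def G_def
    by (simp add: sin_prod_def sp_def)
qed

section \<open>Continuity in the parameters\<close>

text \<open>The constant 7/4 lies between the exponent 3/2 of the majorant and the decay rate 2 of
  the series; the gap to 2 is what absorbs the error in the ratio of consecutive terms.\<close>

lemma powr_ratio_bound:
  assumes "n > 0"
  shows "1 - (7 / 4) / real n \<le> (real n / (real n + 1)) powr (3 / 2)"
proof -
  have l: "ln (1 + 1 / real n) \<le> 1 / real n"
    using ln_add_one_self_le_self[of "1 / real n"] by simp
  have pos: "1 + 1 / real n > 0" by (simp add: add_pos_nonneg)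
  have "real n / (real n + 1) = inverse (1 + 1 / real n)"
    using assms by (simp add: field_simps)
  then have e: "(real n / (real n + 1)) powr (3 / 2) = exp (- (3 / 2) * ln (1 + 1 / real n))"
    using assms pos by (simp add: powr_def ln_inverse)
  have "1 - (7 / 4) / real n = 1 - (7 / 4) * (1 / real n)" by simp
  also have "\<dots> \<le> 1 + (- (3 / 2) * ln (1 + 1 / real n))"
  proof -
    have "1 - (7 / 4) * h \<le> 1 + (- (3 / 2) * k)" if "0 \<le> h" "k \<le> h" for h k :: real
      using that by simp
    from this[OF _ l] show ?thesis by (simp only: zero_le_divide_iff) simp
  qed
  also have "\<dots> \<le> exp (- (3 / 2) * ln (1 + 1 / real n))" by (rule exp_ge_add_one_self)
  finally show ?thesis unfolding e .
qed

lemma hyp4F3_term_Suc: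
  "hyp4F3_term a b c d e f g (Suc n) = hyp4F3_term a b c d e f g n *
     (((of_nat n + a) * (of_nat n + b) * (of_nat n + c) * (of_nat n + d)) / ((of_nat n + 1) * (of_nat n + e) * (of_nat n + f) * (of_nat n + g)))"
  by (simp add: hyp4F3_term_def pochhammer_Suc add.commute mult_ac)

lemma tendsto_pochhammer:
  fixes h :: "'i \<Rightarrow> complex"
  assumes "(h \<longlongrightarrow> l) F"
  shows "((\<lambda>i. pochhammer (h i) n) \<longlongrightarrow> pochhammer l n) F"
  unfolding pochhammer_prod by (intro tendsto_prod tendsto_add assms tendsto_const)

text \<open>Balance at the limit point gives the ratio of consecutive terms the expansion
  \<open>1 - 2 / n\<close>, with an error that is small jointly for large \<open>n\<close> and
  parameters near the limit; the product filter expresses this. From some fixed \<open>N\<close> on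
  the terms are then dominated by a multiple of \<open>n powr (- 3 / 2)\<close>, uniformly in the
  parameters.\<close>

lemma hyp4F3_at_1_tendsto:
  fixes A B C D E G H :: "'i \<Rightarrow> complex"
  assumes lim: "(A \<longlongrightarrow> a) F" "(B \<longlongrightarrow> b) F" "(C \<longlongrightarrow> c) F" "(D \<longlongrightarrow> d) F"
      "(E \<longlongrightarrow> e) F" "(G \<longlongrightarrow> g) F" "(H \<longlongrightarrow> h) F"
    and bal: "e + g + h = 1 + a + b + c + d" and nz: "e \<notin> \<int>\<^sub>\<le>\<^sub>0" "g \<notin> \<int>\<^sub>\<le>\<^sub>0" "h \<notin> \<int>\<^sub>\<le>\<^sub>0" and F: "F \<noteq> bot"
  shows "((\<lambda>i. hyp4F3_at_1 (A i) (B i) (C i) (D i) (E i) (G i) (H i)) \<longlongrightarrow> hyp4F3_at_1 a b c d e g h) F"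
proof -
  define t where "t = (\<lambda>n i. hyp4F3_term (A i) (B i) (C i) (D i) (E i) (G i) (H i) n)"
  define s where "s = hyp4F3_term a b c d e g h"
  have tlim: "(t n \<longlongrightarrow> s n) F" for n
  proof -
    have "pochhammer z n \<noteq> 0" if "z \<notin> \<int>\<^sub>\<le>\<^sub>0" for z :: complex
      using that by (auto simp: pochhammer_eq_0_iff)
    then have "fact n * pochhammer e n * pochhammer g n * pochhammer h n \<noteq> 0"
      using nz by simp
    then show ?thesis
      unfolding t_def s_def hyp4F3_term_def
      by (intro tendsto_divide tendsto_mult tendsto_pochhammer lim tendsto_const)
  qed
  define r where "r = (\<lambda>n i. ((of_nat n + A i) * (of_nat n + B i) * (of_nat n + C i) * (of_nat n + D i))
      / ((of_nat n + 1) * (of_nat n + E i) * (of_nat n + G i) * (of_nat n + H i)))"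
  have rt: "t (Suc n) i = t n i * r n i" for n i
    by (simp add: t_def r_def hyp4F3_term_Suc)
  have rlim: "((\<lambda>(n, i). (r n i - 1) / (1 / of_nat n)) \<longlongrightarrow> -2) (sequentially \<times>\<^sub>F F)"
  proof -
    have fst: "((\<lambda>p. f (snd p)) \<longlongrightarrow> l) (sequentially \<times>\<^sub>F F)" if "(f \<longlongrightarrow> l) F" for f :: "'i \<Rightarrow> complex" and l
      by (rule filterlim_compose[OF that filterlim_snd])
    have x: "((\<lambda>p. 1 / of_nat (fst p) :: complex) \<longlongrightarrow> 0) (sequentially \<times>\<^sub>F F)"
      by (rule filterlim_compose[OF lim_1_over_n filterlim_fst])
    have x0: "eventually (\<lambda>p. 1 / of_nat (fst p) \<noteq> (0 :: complex)) (sequentially \<times>\<^sub>F F)"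
    proof -
      have "eventually (\<lambda>n::nat. 1 / of_nat n \<noteq> (0 :: complex)) sequentially"
        using eventually_gt_at_top[of 0] by eventually_elim simp
      then show ?thesis
        by (rule eventually_compose_filterlim) (rule filterlim_fst)
    qed
    have sg: "a + b + c + d - (1 + e + g + h) = -2"
    proof -
      have "a + b + c + d - (1 + e + g + h) = a + b + c + d - 1 - (e + g + h)" by simp
      then show ?thesis unfolding bal by simp
    qed
    have "((\<lambda>p. (((1 / (1 / of_nat (fst p)) + A (snd p)) * (1 / (1 / of_nat (fst p)) + B (snd p)) * (1 / (1 / of_nat (fst p)) + C (snd p)) * (1 / (1 / of_nat (fst p)) + D (snd p)))
      / ((1 / (1 / of_nat (fst p)) + 1) * (1 / (1 / of_nat (fst p)) + E (snd p)) * (1 / (1 / of_nat (fst p)) + G (snd p)) * (1 / (1 / of_nat (fst p)) + H (snd p))) - 1) / (1 / of_nat (fst p))) \<longlongrightarrow> -2)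
        (sequentially \<times>\<^sub>F F)"
      by (rule expansion_quotient4[OF x x0 fst[OF lim(1)] fst[OF lim(2)] fst[OF lim(3)] fst[OF lim(4)] tendsto_const fst[OF lim(5)] fst[OF lim(6)] fst[OF lim(7)] sg])
    then show ?thesis
      unfolding r_def split_def by (simp only: div_by_1 divide_divide_eq_right mult_1)
  qed
  have "eventually (\<lambda>(n, i). norm (r n i) \<le> (real n / (real n + 1)) powr (3 / 2)) (sequentially \<times>\<^sub>F F)"
  proof -
    have "eventually (\<lambda>p. dist (case p of (n, i) \<Rightarrow> (r n i - 1) / (1 / of_nat n)) (-2) < 1 / 4) (sequentially \<times>\<^sub>F F)"
      by (rule tendstoD[OF rlim]) simp
    moreover have "eventually (\<lambda>p. fst p \<ge> 2) (sequentially \<times>\<^sub>F F)"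
      by (rule eventually_compose_filterlim[OF eventually_ge_at_top filterlim_fst])
    ultimately show ?thesis
    proof eventually_elim
      case (elim p)
      obtain n i where p: "p = (n, i)" by (cases p)
      \<comment> \<open>The deviation of \<open>n (r n i - 1)\<close> from its limit
        \<open>-2\<close>; norm below 1/4 puts the ratio below
        \<open>1 - (7 / 4) / n\<close>.\<close>
      define w where "w = (r n i - 1) * of_nat n + 2"
      have w: "norm w < 1 / 4" and n2: "n \<ge> 2" using elim by (simp_all add: p dist_norm w_def)
      have n0: "(of_nat n :: complex) \<noteq> 0" using n2 by simp
      have "r n i = (of_nat n - 2 + w) / of_nat n"
        using n0 by (simp add: w_def field_simps)
      moreover have "norm (of_nat n - 2 + w) \<le> real n - 7 / 4"
      proof -
        have "(of_nat n - 2 :: complex) = of_nat (n - 2)" using n2 by (simp add: of_nat_diff)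
        then have "norm (of_nat n - 2 :: complex) = real (n - 2)" by (simp only: norm_of_nat)
        then show ?thesis using norm_triangle_ineq[of "of_nat n - 2" w] w n2 by simp
      qed
      ultimately have "norm (r n i) \<le> (real n - 7 / 4) / real n"
        by (simp add: norm_divide divide_right_mono)
      also have "\<dots> = 1 - (7 / 4) / real n" using n2 by (simp add: diff_divide_distrib)
      also have "\<dots> \<le> (real n / (real n + 1)) powr (3 / 2)" using n2 by (intro powr_ratio_bound) simp
      finally show ?case by (simp add: p)
    qed
  qed
  then obtain P Q where P: "eventually P sequentially" and Q: "eventually Q F"
    and PQ: "\<And>n i. P n \<Longrightarrow> Q i \<Longrightarrow> norm (r n i) \<le> (real n / (real n + 1)) powr (3 / 2)"
    unfolding eventually_prod_filter by auto
  obtain N0 where N0: "\<And>n. n \<ge> N0 \<Longrightarrow> P n"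
    using P by (auto simp: eventually_at_top_linorder)
  define N where "N = max N0 1"
  have N: "N \<ge> 1" "\<And>n. n \<ge> N \<Longrightarrow> P n" using N0 by (auto simp: N_def)
  define M where "M = (\<lambda>n. (norm (s N) + 1) * (real N / real n) powr (3 / 2))"
  have step: "norm (t n i) \<le> norm (t N i) * (real N / real n) powr (3 / 2)" if "n \<ge> N" "Q i" for n i
    using that(1)
  proof (induction n rule: dec_induct)
    case base
    then show ?case using N(1) by simp
  next
    case (step n)
    have pm: "((real N / real n) * (real n / (real n + 1))) powr (3 / 2)
        = (real N / real n) powr (3 / 2) * (real n / (real n + 1)) powr (3 / 2)"
      by (rule powr_mult)
    have "norm (t (Suc n) i) = norm (t n i) * norm (r n i)"
      by (simp add: rt norm_mult)
    also have "\<dots> \<le> (norm (t N i) * (real N / real n) powr (3 / 2)) * (real n / (real n + 1)) powr (3 / 2)"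
      using step.IH PQ[OF N(2)[OF step(1)] that(2)] by (intro mult_mono) auto
    also have "\<dots> = norm (t N i) * ((real N / real n) * (real n / (real n + 1))) powr (3 / 2)"
      unfolding pm by (simp only: mult.assoc)
    also have "(real N / real n) * (real n / (real n + 1)) = real N / real (Suc n)"
      using step(1) N(1) by simp
    finally show ?case .
  qed
  have bd: "eventually (\<lambda>(n, i). norm (t n i) \<le> M n) (sequentially \<times>\<^sub>F F)"
  proof -
    have "eventually (\<lambda>i. norm (t N i) < norm (s N) + 1) F"
      using tendsto_norm[OF tlim] by (rule order_tendstoD) simp
    with Q have "eventually (\<lambda>i. Q i \<and> norm (t N i) < norm (s N) + 1) F"
      by (rule eventually_conj)
    moreover have "norm (t n i) \<le> M n" if "n \<ge> N" "Q i \<and> norm (t N i) < norm (s N) + 1" for n i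
    proof -
      have "norm (t N i) * (real N / real n) powr (3 / 2) \<le> M n"
        unfolding M_def using that by (intro mult_right_mono) auto
      then show ?thesis using step[of n i] that by linarith
    qed
    ultimately show ?thesis
      unfolding eventually_prod_filter using eventually_ge_at_top[of N] by fastforce
  qed
  have "summable M"
  proof -
    have "summable (\<lambda>n. (norm (s N) + 1) * real N powr (3 / 2) * real n powr (- (3 / 2)))"
      by (intro summable_mult) (simp add: summable_real_powr_iff)
    moreover have "M = (\<lambda>n. (norm (s N) + 1) * real N powr (3 / 2) * real n powr (- (3 / 2)))"
      unfolding M_def powr_divide powr_minus mult.assoc divide_inverse[of "real N powr (3 / 2)"] ..
    ultimately show ?thesis by (simp only:)
  qed
  from tannerys_theorem[OF tlim bd this F] show ?thesis
    unfolding hyp4F3_at_1_eq t_def s_def by auto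
qed

section \<open>Continuity of the K functions and approximation by generic parameters\<close>

lemma tendsto_rGamma:
  fixes h :: "'i \<Rightarrow> complex"
  assumes "(h \<longlongrightarrow> l) F"
  shows "((\<lambda>i. rGamma (h i)) \<longlongrightarrow> rGamma l) F"
proof -
  have "isCont rGamma l"
    by (rule DERIV_isCont, rule has_field_derivative_rGamma)
  then show ?thesis using assms by (rule isCont_tendsto_compose)
qed

lemma tendsto_sin_pi:
  fixes h :: "'i \<Rightarrow> complex"
  assumes "(h \<longlongrightarrow> l) F"
  shows "((\<lambda>i. sin (of_real pi * h i)) \<longlongrightarrow> sin (of_real pi * l)) F"
  by (rule isCont_tendsto_compose[OF isCont_sin]) (intro tendsto_mult tendsto_const assms)

lemma K_fun_tendsto:
  fixes A B C D E G H :: "'i \<Rightarrow> complex"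
  assumes lim: "(A \<longlongrightarrow> a) F" "(B \<longlongrightarrow> b) F" "(C \<longlongrightarrow> c) F" "(D \<longlongrightarrow> d) F"
      "(E \<longlongrightarrow> e) F" "(G \<longlongrightarrow> g) F" "(H \<longlongrightarrow> h) F"
    and x: "(a, b, c, d, e, g, h) \<in> V" and def: "K_defined (a, b, c, d, e, g, h)" and F: "F \<noteq> bot"
  shows "((\<lambda>i. K_fun (A i, B i, C i, D i, E i, G i, H i)) \<longlongrightarrow> K_fun (a, b, c, d, e, g, h)) F"
proof -
  have bal: "e + g + h = 1 + a + b + c + d" "1 + a - b + (1 + a - c) + (1 + a - d) = 1 + a + (1 + a - e) + (1 + a - g) + (1 + a - h)"
    using x by (simp_all add: V_iff)
  have nz: "sin (of_real pi * a) \<noteq> 0" "e \<notin> \<int>\<^sub>\<le>\<^sub>0" "g \<notin> \<int>\<^sub>\<le>\<^sub>0" "h \<notin> \<int>\<^sub>\<le>\<^sub>0" "1 + a - b \<notin> \<int>\<^sub>\<le>\<^sub>0" "1 + a - c \<notin> \<int>\<^sub>\<le>\<^sub>0" "1 + a - d \<notin> \<int>\<^sub>\<le>\<^sub>0"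
    using def by auto
  have h1: "((\<lambda>i. hyp4F3_at_1 (A i) (B i) (C i) (D i) (E i) (G i) (H i)) \<longlongrightarrow> hyp4F3_at_1 a b c d e g h) F"
    by (rule hyp4F3_at_1_tendsto[OF lim bal(1) nz(2-4) F])
  have h2: "((\<lambda>i. hyp4F3_at_1 (A i) (1 + A i - E i) (1 + A i - G i) (1 + A i - H i) (1 + A i - B i) (1 + A i - C i) (1 + A i - D i))
      \<longlongrightarrow> hyp4F3_at_1 a (1 + a - e) (1 + a - g) (1 + a - h) (1 + a - b) (1 + a - c) (1 + a - d)) F"
    by (rule hyp4F3_at_1_tendsto[OF _ _ _ _ _ _ _ bal(2) nz(5-7) F]) (intro tendsto_intros lim)+
  show ?thesis
    unfolding K_fun.simps
    by (intro tendsto_add tendsto_divide tendsto_mult tendsto_diff tendsto_const tendsto_rGamma tendsto_sin_pi h1 h2 lim nz(1))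
qed

text \<open>If the value at 0 is not an integer, closedness of the integers suffices. If it is, a
  small nonzero multiple of the slope has norm between 0 and 1 and hence leaves the integers. The
  slope is written as \<open>k 1 - k 0\<close> so that it need not be supplied separately.\<close>

lemma eventually_affine_not_Ints:
  fixes k :: "complex \<Rightarrow> complex"
  assumes "k 1 - k 0 \<noteq> 0" "\<And>t. k t = k 0 + t * (k 1 - k 0)"
  shows "eventually (\<lambda>t. k t \<notin> \<int>) (at 0)"
proof -
  define w where "w = k 1 - k 0"
  have kt: "k t = k 0 + t * w" for t unfolding w_def by (rule assms(2))
  have w: "w \<noteq> 0" using assms(1) by (simp add: w_def)
  have lim: "((\<lambda>t. k 0 + t * w) \<longlongrightarrow> k 0 + 0 * w) (at 0)"
    by (intro tendsto_intros)
  show ?thesis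
  proof (cases "k 0 \<in> \<int>")
    case False
    have "eventually (\<lambda>t. k 0 + t * w \<in> - \<int>) (at 0)"
      by (rule topological_tendstoD[OF lim]) (use False in \<open>auto intro: open_Compl closed_Ints\<close>)
    then show ?thesis
    proof eventually_elim
      case (elim t)
      then show ?case unfolding kt[of t] by simp
    qed
  next
    case True
    have "eventually (\<lambda>t. dist (k 0 + t * w) (k 0 + 0 * w) < 1) (at 0)"
      by (rule tendstoD[OF lim]) simp
    then show ?thesis
      using eventually_neq_at_within[of 0]
    proof eventually_elim
      case (elim t)
      show ?case
      proof
        assume "k t \<in> \<int>"
        then have "k t - k 0 \<in> \<int>" using True by (rule Ints_diff)
        moreover have "k t - k 0 = t * w" unfolding kt[of t] by simp
        ultimately have "t * w \<in> \<int>" by (simp only:)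
        then obtain m where m: "t * w = of_int m" by (elim Ints_cases)
        have "norm (t * w) < 1" using elim(1) by (simp add: dist_norm)
        then have "\<bar>real_of_int m\<bar> < 1" unfolding m by simp
        then have "m = 0" by linarith
        then show False using m w elim(2) by simp
      qed
    qed
  qed
qed

theorem proposition6p16:
  fixes a b c d e f g :: complex and x :: vec7
  assumes x: "x = (a, b, c, d, e, f, g)" and "x \<in> V"
    and "K_defined (p0 x)" and "K_defined (n0 x)" and "K_defined (p4 x)"
  shows "A4 (1 - a) (1 - b) (1 - c) (1 - d)
           * A4 (1 + a - e) (1 + b - e) (1 + c - e) (1 + d - e) * B2 x * K_fun (p0 x)
         + sin_prod [e] * A4 (f - a) (f - b) (f - c) (f - d) * A4 (g - a) (g - b) (g - c) (g - d)
           * (A4 a (1 + a - e) (1 + a - f) (1 + a - g))\<^sup>2 * K_fun (n0 x)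
         - C_coeff x * K_fun (p4 x) = 0"
proof -
  define L where "L = (\<lambda>(a, b, c, d, e, f, g). A4 (1 - a) (1 - b) (1 - c) (1 - d)
           * A4 (1 + a - e) (1 + b - e) (1 + c - e) (1 + d - e) * B2 (a, b, c, d, e, f, g) * K_fun (p0 (a, b, c, d, e, f, g))
         + sin_prod [e] * A4 (f - a) (f - b) (f - c) (f - d) * A4 (g - a) (g - b) (g - c) (g - d)
           * (A4 a (1 + a - e) (1 + a - f) (1 + a - g))\<^sup>2 * K_fun (n0 (a, b, c, d, e, f, g))
         - C_coeff (a, b, c, d, e, f, g) * K_fun (p4 (a, b, c, d, e, f, g)))"
  \<comment> \<open>The direction satisfies \<open>2 + 40 + 1069 = 1 + 10 + 100 + 1000\<close>, so
    the line stays in \<open>V\<close>, and its entries are spread out so that none of the linear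
    forms in \<open>generic\<close> and \<open>generic_sums\<close> is constant along it.\<close>
  define y where "y = (\<lambda>t. (a + t * 1, b + t * 10, c + t * 100, d + t * 1000, e + t * 2, f + t * 40, g + t * 1069))"
  have xV: "e + f + g = 1 + a + b + c + d"
    using assms(2) by (simp add: x V_iff)
  have lim: "((\<lambda>t. z + t * w) \<longlongrightarrow> z) (at 0)" for z w :: complex
  proof -
    have "((\<lambda>t. z + t * w) \<longlongrightarrow> z + 0 * w) (at 0)" by (intro tendsto_intros)
    then show ?thesis by simp
  qed
  have "((\<lambda>t. L (y t)) \<longlongrightarrow> L x) (at 0)"
  proof -
    have K0: "((\<lambda>t. K_fun (p0 (y t))) \<longlongrightarrow> K_fun (p0 x)) (at 0)"
      unfolding y_def x p0.simps
      by (intro K_fun_tendsto lim) (use assms p0_in_V in \<open>auto simp: x\<close>)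
    have Kn: "((\<lambda>t. K_fun (n0 (y t))) \<longlongrightarrow> K_fun (n0 x)) (at 0)"
      unfolding y_def x n0.simps
      by (intro K_fun_tendsto tendsto_intros lim)
         (use assms n0_in_V[OF assms(2)] in \<open>simp_all only: x n0.simps trivial_limit_at not_False_eq_True\<close>)
    have K4: "((\<lambda>t. K_fun (p4 (y t))) \<longlongrightarrow> K_fun (p4 x)) (at 0)"
      unfolding y_def x p4.simps
      by (intro K_fun_tendsto tendsto_intros lim)
         (use assms p4_in_V[OF assms(2)] in \<open>simp_all only: x p4.simps trivial_limit_at not_False_eq_True\<close>)
    have A4: "((\<lambda>t. A4 (h1 t) (h2 t) (h3 t) (h4 t)) \<longlongrightarrow> A4 l1 l2 l3 l4) (at 0)"
      if "(h1 \<longlongrightarrow> l1) (at 0)" "(h2 \<longlongrightarrow> l2) (at 0)" "(h3 \<longlongrightarrow> l3) (at 0)" "(h4 \<longlongrightarrow> l4) (at 0)" for h1 h2 h3 h4 l1 l2 l3 l4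
      unfolding A4_def by (intro tendsto_mult tendsto_rGamma that)
    have B2: "((\<lambda>t. B2 (y t)) \<longlongrightarrow> B2 x) (at 0)"
      unfolding y_def x B2.simps sin_prod_def list.map prod_list.Cons prod_list.Nil
      by (intro tendsto_add tendsto_mult tendsto_const tendsto_sin_pi tendsto_diff lim)
    have B4: "((\<lambda>t. B4 (y t)) \<longlongrightarrow> B4 x) (at 0)"
      unfolding y_def x B4.simps sin_prod_def list.map prod_list.Cons prod_list.Nil
      by (intro tendsto_add tendsto_mult tendsto_const tendsto_sin_pi tendsto_diff lim)
    have Cc: "((\<lambda>t. C_coeff (y t)) \<longlongrightarrow> C_coeff x) (at 0)"
      using B2 B4 unfolding y_def x C_coeff.simps sin_prod_def list.map prod_list.Cons prod_list.Nil
      by (intro tendsto_add tendsto_mult tendsto_const tendsto_sin_pi tendsto_diff lim)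
    show ?thesis
      using K0 Kn K4 B2 Cc
      unfolding L_def y_def x split_conv sin_prod_def list.map prod_list.Cons prod_list.Nil
      by (intro tendsto_diff tendsto_add tendsto_mult tendsto_power A4 tendsto_const tendsto_sin_pi lim)
  qed
  moreover have "eventually (\<lambda>t. L (y t) = 0) (at 0)"
  proof -
    have "eventually (\<lambda>t. generic (a + t * 1) (b + t * 10) (c + t * 100) (d + t * 1000) (e + t * 2) (f + t * 40) (g + t * 1069)) (at 0)"
      unfolding generic_def ball_simps simp_thms eventually_conj_iff
      by (intro conjI eventually_affine_not_Ints) (simp_all add: algebra_simps)
    moreover have "eventually (\<lambda>t. generic_sums (a + t * 1) (b + t * 10) (c + t * 100) (d + t * 1000) (e + t * 2) (f + t * 40) (g + t * 1069)) (at 0)"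
      unfolding generic_sums_def ball_simps simp_thms eventually_conj_iff
      by (intro conjI eventually_affine_not_Ints) (simp_all add: algebra_simps)
    ultimately show ?thesis
    proof eventually_elim
      case (elim t)
      have "(e + t * 2) + (f + t * 40) + (g + t * 1069) = (e + f + g) + t * 1111" by (simp add: algebra_simps)
      also have "\<dots> = 1 + (a + t * 1) + (b + t * 10) + (c + t * 100) + (d + t * 1000)" unfolding xV by (simp add: algebra_simps)
      finally show ?case
        unfolding L_def y_def split_conv using elim by (rule three_term_generic)
    qed
  qed
  ultimately have "((\<lambda>t. 0) \<longlongrightarrow> L x) (at (0 :: complex))"
    by (rule Lim_transform_eventually)
  then have "L x = 0"
    by (simp add: tendsto_const_iff)
  then show ?thesis by (simp only: L_def x split_conv)
qed

end
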